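(* For $n\ge4$, let $\mathcal{A}$ be the cluster algebra of type $D_n$ with the special frozen variables coming from the polygon model ($N=2n$). Then the elements in the union of the sets $$\{v(l): l\text{ is a diagonal or edge of }\mathbf{P}_N\text{ of length at most }n-2\}$$ and $$\{w(j,k): 1\le j\le n,\ 0\le k\le n-1\}$$ generate the rays of the Gröbner cone $\mathcal{C}_{\mathcal{A}}$ modulo lineality space (i.e. their images in the quotient of $\mathbb{R}^{\mathcal{V}\cup\mathcal{W}}$ by the lineality space of $\mathcal{C}_{\mathcal{A}}$ are generators of the rays of the image of $\mathcal{C}_{\mathcal{A}}$: each generates a ray, and every ray is generated by one of them).
   Context: **Cluster algebras and Gröbner cone.** Cluster algebras are of geometric type over a field $\mathbb{K}$ of characteristic zero, generated as $\mathbb{K}$-algebras by all cluster variables and all frozen variables (frozen variables are not inverted). Let $\mathcal{V}$ be the (finite) set of cluster variables and $\mathcal{W}$ the set of frozen variables. Let $\mathbb{K}[\mathbf{z}]=\mathbb{K}[z_v\mid v\in\mathcal{V}\cup\mathcal{W}]$, let $I_{\mathcal{A}}$ be the kernel of $\mathbb{K}[\mathbf{z}]\to\mathcal{A}$, $z_v\mapsto v$, and let $I_{\mathcal{A}}^{\times}$ be the ideal generated by all $z_vz_w$ with $v,w\in\mathcal{V}$ not in a common cluster. For $\omega\in\mathbb{R}^{\mathcal{V}\cup\mathcal{W}}$, $\mathrm{In}_\omega(f)$ is the sum of the terms of $f$ of maximal $\omega$-weight and $\mathrm{In}_\omega(I)=\langle\mathrm{In}_\omega(f):f\in I\rangle$.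 The Gröbner cone $\mathcal{C}_{\mathcal{A}}$ is the closure of $\{\omega\in\mathbb{R}^{\mathcal{V}\cup\mathcal{W}}:\mathrm{In}_\omega(I_{\mathcal{A}})=I_{\mathcal{A}}^{\times}\}$. **Polygon model for $D_n$ (Fomin–Zelevinsky).** $N=2n$; $\mathbf{P}_{N}$ is a regular $N$-gon with vertices $1,\dots,N$ (modulo $N$) labeled counterclockwise; $[i,j]$ is the edge or diagonal with endpoints $i,j$ (diagonals join non-adjacent vertices); $\overline i$ is the vertex antipodal to $i$ and $\overline{[i,j]}=[\overline i,\overline j]$. Each diameter comes in two colors: blue, denoted $[a,\overline a]$, and red, denoted $\widehat{[a,\overline a]}$. Two diameters cross only if they have different colors and different endpoints. $\mathcal{A}$ is the cluster algebra of type $D_n$ whose cluster variables $x_l=x_{\overline l}$ correspond to pairs $\{l,\overline l\}$ of non-diameter diagonals and to colored diameters, and whose frozen variables correspond to pairs $\{l,\overline l\}$ of edges; clusters correspond to colored symmetric triangulations (maximal sets of mutually non-crossing diagonal pairs and colored diameters). The exchange relations are exactly: $x_{[a,c]}x_{[b,d]}=x_{[a,b]}x_{[c,d]}+x_{[a,d]}x_{[b,c]}$ for $a,b,c,d,\overline a$ in counterclockwise order; $x_{[a,c]}x_{[a,\overline b]}=x_{[a,b]}x_{[a,\overline c]}+x_{[a,\overline a]}x_{\widehat{[a,\overline a]}}x_{[b,c]}$ for $a,b,c,\overline a$ in counterclockwise order; $x_{[a,\overline a]}x_{\widehat{[b,\overline b]}}=x_{[a,b]}+x_{[a,\overline b]}$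 for $a,b,\overline a$ in counterclockwise order; and, for $a,b,c,\overline a$ in counterclockwise order, $x_{[a,\overline a]}x_{[b,\overline c]}=x_{[a,b]}x_{[c,\overline c]}+x_{[a,\overline c]}x_{[b,\overline b]}$ and $x_{\widehat{[a,\overline a]}}x_{[b,\overline c]}=x_{[a,b]}x_{\widehat{[c,\overline c]}}+x_{[a,\overline c]}x_{\widehat{[b,\overline b]}}$. **Vectors.** $e_l$ (for a colored diameter $l$) and $e_{\{l,\overline l\}}$ (for a diagonal or edge pair) are the standard basis vectors of $\mathbb{R}^{\mathcal{V}\cup\mathcal{W}}$. The length of $[i,j]$ is the number of edges in a shortest boundary path (arc) between $i$ and $j$; for an edge or non-diameter diagonal $l$, the shorter arc between its endpoints is its minor arc, $F_l$ is the set of all diagonals and edges with both endpoints on the minor arc of $l$, and $v(l)=-\sum_{k\in F_l}e_{\{k,\overline k\}}$. For each vertex $i$ (the vectors depend only on $i$ modulo $n$), $$w(i)=e_{[i,\overline i]}+v([i+1,\overline i-1]),\qquad \widehat w(i)=e_{\widehat{[i,\overline i]}}+v([i+1,\overline i-1]).$$ For $1\le j\le n$, $0\le k\le n-1$: if $k$ is even, $w(j,k)=\sum_{i=0}^{k/2}w(j+2i)-\sum_{i=1}^{k/2}\widehat w(j+2i-1)$; if $k$ is odd, $w(j,k)=v([j+k,\overline j+k+1])+\sum_{i=0}^{(k-1)/2}w(j+2i)-\sum_{i=1}^{(k+1)/2}\widehat w(j+2i-1)$. *)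

theory Defs
  imports "HOL-Analysis.Analysis" "HOL-Analysis.Finite_Function_Topology" "HOL-Library.Multiset"
begin

section \<open>Polynomials and initial ideals\<close>

text \<open>
  Polynomials over \<open>'k\<close> in indeterminates \<open>z\<^sub>v\<close>, \<open>v :: 'v\<close>, are finitely supported maps from monomials
  (exponent vectors) to coefficients; multiplication is the convolution product of
  \<^theory>\<open>HOL-Library.Poly_Mapping\<close>. The ring of polynomials in the \<open>z\<^sub>v\<close> with \<open>v \<in> X\<close> only is the subset
  \<open>polys X\<close>, and ideals of that ring are taken relative to \<open>X\<close>.
\<close>

type_synonym ('v, 'k) mpoly = "('v \<Rightarrow>\<^sub>0 nat) \<Rightarrow>\<^sub>0 'k"

definition polys :: "'v set \<Rightarrow> ('v, 'k::comm_ring_1) mpoly set" where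
  "polys X = {p. \<forall>m \<in> Poly_Mapping.keys p. Poly_Mapping.keys m \<subseteq> X}"

definition var :: "'v \<Rightarrow> ('v, 'k::comm_ring_1) mpoly" where
  "var v = Poly_Mapping.single (Poly_Mapping.single v 1) 1"

definition is_ideal :: "'v set \<Rightarrow> ('v, 'k::comm_ring_1) mpoly set \<Rightarrow> bool" where
  "is_ideal X A \<longleftrightarrow> A \<subseteq> polys X \<and> 0 \<in> A \<and> (\<forall>p\<in>A. \<forall>q\<in>A. p + q \<in> A) \<and>
     (\<forall>r\<in>polys X. \<forall>p\<in>A. r * p \<in> A)"

definition ideal_gen :: "'v set \<Rightarrow> ('v, 'k::comm_ring_1) mpoly set \<Rightarrow> ('v, 'k) mpoly set" where
  "ideal_gen X G = is_ideal X hull G"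

definition weight :: "('v \<Rightarrow>\<^sub>0 real) \<Rightarrow> ('v \<Rightarrow>\<^sub>0 nat) \<Rightarrow> real" where
  "weight \<omega> m = (\<Sum>v\<in>Poly_Mapping.keys m. Poly_Mapping.lookup \<omega> v * real (Poly_Mapping.lookup m v))"

definition initial_form ::
    "('v \<Rightarrow>\<^sub>0 real) \<Rightarrow> ('v, 'k::comm_ring_1) mpoly \<Rightarrow> ('v, 'k) mpoly" where
  "initial_form \<omega> p =
     (\<Sum>m | m \<in> Poly_Mapping.keys p \<and> (\<forall>m'\<in>Poly_Mapping.keys p. weight \<omega> m' \<le> weight \<omega> m).
        Poly_Mapping.single m (Poly_Mapping.lookup p m))"

definition initial_ideal ::
    "'v set \<Rightarrow> ('v \<Rightarrow>\<^sub>0 real) \<Rightarrow> ('v, 'k::comm_ring_1) mpoly set \<Rightarrow> ('v, 'k) mpoly set" where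
  "initial_ideal X \<omega> A = ideal_gen X (initial_form \<omega> ` A)"

text \<open>
  The substitution \<open>z\<^sub>v \<mapsto> v\<close>: the indeterminates are indexed by elements of a field extension of \<open>'k\<close>,
  whose structure map is \<open>\<iota>\<close>.
\<close>

definition poly_eval :: "('k::field \<Rightarrow> 'f::field) \<Rightarrow> ('f, 'k) mpoly \<Rightarrow> 'f" where
  "poly_eval \<iota> p =
     (\<Sum>m\<in>Poly_Mapping.keys p. \<iota> (Poly_Mapping.lookup p m) *
        (\<Prod>v\<in>Poly_Mapping.keys m. v ^ Poly_Mapping.lookup m v))"

text \<open>The whole field is the field of rational functions over \<open>'k\<close> in the elements of \<open>X\<close>.\<close>

definition free_generating_set :: "('k::field \<Rightarrow> 'f::field) \<Rightarrow> 'f set \<Rightarrow> bool" where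
  "free_generating_set \<iota> X \<longleftrightarrow>
     (\<forall>p\<in>polys X. poly_eval \<iota> p = 0 \<longrightarrow> p = 0) \<and>
     (\<forall>f. \<exists>p\<in>polys X. \<exists>q\<in>polys X. poly_eval \<iota> q \<noteq> 0 \<and> f = poly_eval \<iota> p / poly_eval \<iota> q)"


section \<open>Cones modulo lineality\<close>

definition lineality_space :: "'a::real_vector set \<Rightarrow> 'a set" where
  "lineality_space C = C \<inter> uminus ` C"

definition mod_class :: "'a::real_vector set \<Rightarrow> 'a \<Rightarrow> 'a set" where
  "mod_class L u = (\<lambda>y. u + y) ` L"

definition ray_mod :: "'a::real_vector set \<Rightarrow> 'a \<Rightarrow> 'a set set" where
  "ray_mod L u = {mod_class L (t *\<^sub>R u) | t. 0 \<le> t}"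

text \<open>
  The rays (one-dimensional faces) of the image of a convex cone \<open>C\<close> in the quotient by its lineality
  space \<open>L\<close>: the half-lines spanned by a nonzero class of an element of \<open>C\<close> such that a sum of two
  classes of elements of \<open>C\<close> lies on the half-line only if both summands do.
\<close>

definition rays_mod_lineality :: "'a::real_vector set \<Rightarrow> 'a set set set" where
  "rays_mod_lineality C =
     (let L = lineality_space C in
      {R. \<exists>u \<in> C - L. R = ray_mod L u \<and>
            (\<forall>a\<in>C. \<forall>b\<in>C. mod_class L (a + b) \<in> R \<longrightarrow> mod_class L a \<in> R \<and> mod_class L b \<in> R)})"


section \<open>Cluster algebras of geometric type\<close>

text \<open>
  A seed is an assignment of field elements to the indices together with an extended exchange matrix
  \<open>B\<close>; \<open>I\<close> is the set of mutable and \<open>J\<close> the set of frozen indices. Only the entries \<open>B i k\<close> with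
  \<open>i \<in> I \<union> J\<close> and \<open>k \<in> I\<close> are meaningful.
\<close>

type_synonym ('i, 'f) seed = "('i \<Rightarrow> 'f) \<times> ('i \<Rightarrow> 'i \<Rightarrow> int)"

definition mutate_matrix :: "'i \<Rightarrow> ('i \<Rightarrow> 'i \<Rightarrow> int) \<Rightarrow> 'i \<Rightarrow> 'i \<Rightarrow> int" where
  "mutate_matrix k B = (\<lambda>i j. if i = k \<or> j = k then - B i j
                              else B i j + sgn (B i k) * max (B i k * B k j) 0)"

definition mutate_var :: "'i set \<Rightarrow> 'i set \<Rightarrow> 'i \<Rightarrow> ('i, 'f::field) seed \<Rightarrow> 'f" where
  "mutate_var I J k s =
     ((\<Prod>i\<in>I \<union> J. fst s i ^ nat (snd s i k)) + (\<Prod>i\<in>I \<union> J. fst s i ^ nat (- snd s i k))) / fst s k"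

definition mutate :: "'i set \<Rightarrow> 'i set \<Rightarrow> 'i \<Rightarrow> ('i, 'f::field) seed \<Rightarrow> ('i, 'f) seed" where
  "mutate I J k s = ((fst s)(k := mutate_var I J k s), mutate_matrix k (snd s))"

definition skew_symmetrizable :: "'i set \<Rightarrow> ('i \<Rightarrow> 'i \<Rightarrow> int) \<Rightarrow> bool" where
  "skew_symmetrizable I B \<longleftrightarrow>
     (\<exists>d :: 'i \<Rightarrow> int. (\<forall>i\<in>I. 0 < d i) \<and> (\<forall>i\<in>I. \<forall>j\<in>I. d i * B i j = - (d j * B j i)))"

definition cartan_counterpart :: "('i \<Rightarrow> 'i \<Rightarrow> int) \<Rightarrow> 'i \<Rightarrow> 'i \<Rightarrow> int" where
  "cartan_counterpart B i j = (if i = j then 2 else - \<bar>B i j\<bar>)"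

text \<open>The algebra is determined by an initial seed \<open>s\<^sub>0\<close> in the ambient field \<open>'f\<close>.\<close>

locale cluster_algebra =
  fixes \<iota> :: "'k::field_char_0 \<Rightarrow> 'f::field"
    and I J :: "'i set"
    and s\<^sub>0 :: "('i, 'f) seed"
  assumes \<iota>_one: "\<iota> 1 = 1"
    and \<iota>_add: "\<iota> (a + b) = \<iota> a + \<iota> b"
    and \<iota>_mult: "\<iota> (a * b) = \<iota> a * \<iota> b"
    and finite_indices: "finite I" "finite J"
    and disjoint_indices: "I \<inter> J = {}"
    and skew: "skew_symmetrizable I (snd s\<^sub>0)"
    and inj_seed: "inj_on (fst s\<^sub>0) (I \<union> J)"
    and free_seed: "free_generating_set \<iota> (fst s\<^sub>0 ` (I \<union> J))"
begin

inductive_set seeds :: "('i, 'f) seed set" where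
  initial: "s\<^sub>0 \<in> seeds"
| mutation: "s \<in> seeds \<Longrightarrow> k \<in> I \<Longrightarrow> mutate I J k s \<in> seeds"

definition clusters :: "'f set set" where
  "clusters = (\<lambda>s. fst s ` I) ` seeds"

definition cluster_variables :: "'f set" where
  "cluster_variables = \<Union> clusters"

definition frozen_variables :: "'f set" where
  "frozen_variables = fst s\<^sub>0 ` J"

abbreviation generators :: "'f set" where
  "generators \<equiv> cluster_variables \<union> frozen_variables"

text \<open>
  The \<open>'k\<close>-algebra generated by the cluster and frozen variables (which are not inverted), as a subset
  of the ambient field.
\<close>

definition algebra :: "'f set" where
  "algebra = poly_eval \<iota> ` polys generators"

text \<open>
  The exchange relation \<open>x\<^sub>k x\<^sub>k' = M + M'\<close>, recorded as the unordered pair \<open>x\<^sub>k, x\<^sub>k'\<close> and the unordered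
  pair of monomials \<open>M, M'\<close>, where a monomial is the multiset of its factors.
\<close>

definition exchange_relations :: "('f multiset \<times> 'f multiset multiset) set" where
  "exchange_relations =
     {({# fst s k, mutate_var I J k s #},
       {# (\<Sum>i\<in>I \<union> J. replicate_mset (nat (snd s i k)) (fst s i)),
          (\<Sum>i\<in>I \<union> J. replicate_mset (nat (- snd s i k)) (fst s i)) #}) | s k. s \<in> seeds \<and> k \<in> I}"

text \<open>The kernel of the surjection from \<open>polys generators\<close> onto \<open>algebra\<close>.\<close>

definition relation_ideal :: "('f, 'k) mpoly set" where
  "relation_ideal = {p \<in> polys generators. poly_eval \<iota> p = 0}"

definition monomial_ideal :: "('f, 'k) mpoly set" where
  "monomial_ideal = ideal_gen generators
     {var v * var w | v w. v \<in> cluster_variables \<and> w \<in> cluster_variables \<and>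
                           \<not> (\<exists>c\<in>clusters. v \<in> c \<and> w \<in> c)}"

text \<open>
  Real vectors indexed by \<open>generators\<close> are finitely supported functions vanishing off
  \<open>generators\<close>. On this subspace, which is closed, the norm of
  \<^theory>\<open>HOL-Analysis.Finite_Function_Topology\<close> induces the Euclidean topology when there are finitely
  many generators.
\<close>

definition groebner_cone :: "('f \<Rightarrow>\<^sub>0 real) set" where
  "groebner_cone = closure {\<omega>. Poly_Mapping.keys \<omega> \<subseteq> generators \<and>
                               initial_ideal generators \<omega> relation_ideal = monomial_ideal}"

end


section \<open>The polygon model of type D\<close>

text \<open>
  The vertices of the \<open>2n\<close>-gon are the residues \<open>0, \<dots>, 2n - 1\<close>, in counterclockwise order; any integer
  denotes the vertex given by its residue, and vertex \<open>2n\<close> is \<open>0\<close>. Integers \<open>a < b < c < \<dots> < a + 2n\<close>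
  denote vertices in counterclockwise order. The vertex antipodal to \<open>i\<close> is \<open>i + n\<close>. A chord is an edge
  or a diagonal, given by its two endpoints.
\<close>

definition vertex :: "nat \<Rightarrow> int \<Rightarrow> int" where
  "vertex n i = i mod (2 * int n)"

definition chord :: "nat \<Rightarrow> int \<Rightarrow> int \<Rightarrow> int set" where
  "chord n i j = {vertex n i, vertex n j}"

definition antipode :: "nat \<Rightarrow> int set \<Rightarrow> int set" where
  "antipode n c = (\<lambda>i. vertex n (i + int n)) ` c"

definition chord_length :: "nat \<Rightarrow> int \<Rightarrow> int \<Rightarrow> int" where
  "chord_length n i j = min (vertex n (j - i)) (vertex n (i - j))"

definition chords :: "nat \<Rightarrow> int set set" where
  "chords n = {chord n i j | i j. vertex n i \<noteq> vertex n j}"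

definition edges :: "nat \<Rightarrow> int set set" where
  "edges n = {chord n i (i + 1) | i. True}"

definition diagonals :: "nat \<Rightarrow> int set set" where
  "diagonals n = chords n - edges n"

definition chord_crossing :: "nat \<Rightarrow> int set \<Rightarrow> int set \<Rightarrow> bool" where
  "chord_crossing n c d \<longleftrightarrow>
     (\<exists>i p j q. i < p \<and> p < j \<and> j < q \<and> q < i + 2 * int n \<and> c = chord n i j \<and> d = chord n p q)"

text \<open>
  Labels of cluster and frozen variables: \<open>Sym {l, antipode l}\<close> for a chord \<open>l\<close> that is not a
  diameter, and one label for each color of a diameter.
\<close>

datatype label = Sym "int set set" | Blue "int set" | Red "int set"

definition chord_label :: "nat \<Rightarrow> int set \<Rightarrow> label" where
  "chord_label n c = (if antipode n c = c then Blue c else Sym {c, antipode n c})"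

abbreviation lab :: "nat \<Rightarrow> int \<Rightarrow> int \<Rightarrow> label" where
  "lab n i j \<equiv> chord_label n (chord n i j)"

abbreviation blue :: "nat \<Rightarrow> int \<Rightarrow> label" where
  "blue n i \<equiv> Blue (chord n i (i + int n))"

abbreviation red :: "nat \<Rightarrow> int \<Rightarrow> label" where
  "red n i \<equiv> Red (chord n i (i + int n))"

fun label_chords :: "label \<Rightarrow> int set set" where
  "label_chords (Sym P) = P"
| "label_chords (Blue c) = {c}"
| "label_chords (Red c) = {c}"

fun label_crossing :: "nat \<Rightarrow> label \<Rightarrow> label \<Rightarrow> bool" where
  "label_crossing n (Blue c) (Blue d) = False"
| "label_crossing n (Red c) (Red d) = False"
| "label_crossing n (Blue c) (Red d) = (c \<noteq> d)"
| "label_crossing n (Red c) (Blue d) = (c \<noteq> d)"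
| "label_crossing n k l = (\<exists>c\<in>label_chords k. \<exists>d\<in>label_chords l. chord_crossing n c d)"

definition diagonal_labels :: "nat \<Rightarrow> label set" where
  "diagonal_labels n = chord_label n ` diagonals n \<union> range (red n)"

definition edge_labels :: "nat \<Rightarrow> label set" where
  "edge_labels n = chord_label n ` edges n"

definition colored_triangulations :: "nat \<Rightarrow> label set set" where
  "colored_triangulations n =
     {T. T \<subseteq> diagonal_labels n \<and> (\<forall>k\<in>T. \<forall>l\<in>T. \<not> label_crossing n k l) \<and>
         (\<forall>l\<in>diagonal_labels n - T. \<exists>k\<in>T. label_crossing n k l)}"

text \<open>The five families are encoded as in \<open>exchange_relations\<close>.\<close>

definition polygon_relations :: "nat \<Rightarrow> (label multiset \<times> label multiset multiset) set" where
  "polygon_relations n =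
     {({# lab n a c, lab n b d #},
       {# {# lab n a b, lab n c d #}, {# lab n a d, lab n b c #} #})
      | a b c d. a < b \<and> b < c \<and> c < d \<and> d < a + int n}
   \<union> {({# lab n a c, lab n a (b + int n) #},
       {# {# lab n a b, lab n a (c + int n) #}, {# blue n a, red n a, lab n b c #} #})
      | a b c. a < b \<and> b < c \<and> c < a + int n}
   \<union> {({# blue n a, red n b #},
       {# {# lab n a b #}, {# lab n a (b + int n) #} #})
      | a b. a < b \<and> b < a + int n}
   \<union> {({# blue n a, lab n b (c + int n) #},
       {# {# lab n a b, blue n c #}, {# lab n a (c + int n), blue n b #} #})
      | a b c. a < b \<and> b < c \<and> c < a + int n}
   \<union> {({# red n a, lab n b (c + int n) #},
       {# {# lab n a b, red n c #}, {# lab n a (c + int n), red n b #} #})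
      | a b c. a < b \<and> b < c \<and> c < a + int n}"

text \<open>
  The Cartan matrix of type \<open>D\<^sub>n\<close>: the Dynkin diagram is the path \<open>1, \<dots>, n - 1\<close> with the additional
  node \<open>n\<close> attached to \<open>n - 2\<close>.
\<close>

definition cartan_D :: "nat \<Rightarrow> nat \<Rightarrow> nat \<Rightarrow> int" where
  "cartan_D n p q =
     (if p = q then 2
      else if {p, q} \<in> {{i, i + 1} | i. 1 \<le> i \<and> i + 1 \<le> n - 1} \<union> {{n - 2, n}} then - 1
      else 0)"

text \<open>
  A cluster algebra of type \<open>D\<^sub>n\<close> together with an identification \<open>x\<close> of its cluster and frozen
  variables with the labels of the polygon model.
\<close>

locale polygon_model_D = cluster_algebra \<iota> I J s\<^sub>0
  for \<iota> :: "'k::field_char_0 \<Rightarrow> 'f::field" and I J :: "'i set" and s\<^sub>0 :: "('i, 'f) seed" +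
  fixes n :: nat and x :: "label \<Rightarrow> 'f"
  assumes type_D: "\<exists>s\<in>seeds. \<exists>\<pi>. bij_betw \<pi> {1..n} I \<and>
      (\<forall>p\<in>{1..n}. \<forall>q\<in>{1..n}. cartan_counterpart (snd s) (\<pi> p) (\<pi> q) = cartan_D n p q)"
    and bij_cluster_variables: "bij_betw x (diagonal_labels n) cluster_variables"
    and bij_frozen_variables: "bij_betw x (edge_labels n) frozen_variables"
    and clusters_eq: "clusters = (\<lambda>T. x ` T) ` colored_triangulations n"
    and exchange_relations_eq: "exchange_relations =
      map_prod (image_mset x) (image_mset (image_mset x)) ` polygon_relations n"


section \<open>The vectors\<close>

definition unit_vec :: "(label \<Rightarrow> 'f) \<Rightarrow> label \<Rightarrow> 'f \<Rightarrow>\<^sub>0 real" where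
  "unit_vec x l = Poly_Mapping.single (x l) 1"

definition arc :: "nat \<Rightarrow> int \<Rightarrow> int \<Rightarrow> int set" where
  "arc n i j = {vertex n (i + t) | t. 0 \<le> t \<and> t \<le> vertex n (j - i)}"

definition minor_arc :: "nat \<Rightarrow> int \<Rightarrow> int \<Rightarrow> int set" where
  "minor_arc n i j = (if vertex n (j - i) \<le> vertex n (i - j) then arc n i j else arc n j i)"

text \<open>The value of \<open>v_vec\<close> is meaningful for chords other than diameters, which have a unique minor arc.\<close>

definition v_vec :: "nat \<Rightarrow> (label \<Rightarrow> 'f) \<Rightarrow> int \<Rightarrow> int \<Rightarrow> 'f \<Rightarrow>\<^sub>0 real" where
  "v_vec n x i j = - (\<Sum>c | c \<in> chords n \<and> c \<subseteq> minor_arc n i j. unit_vec x (chord_label n c))"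

definition w_vec :: "nat \<Rightarrow> (label \<Rightarrow> 'f) \<Rightarrow> int \<Rightarrow> 'f \<Rightarrow>\<^sub>0 real" where
  "w_vec n x i = unit_vec x (blue n i) + v_vec n x (i + 1) (i + int n - 1)"

definition w_hat_vec :: "nat \<Rightarrow> (label \<Rightarrow> 'f) \<Rightarrow> int \<Rightarrow> 'f \<Rightarrow>\<^sub>0 real" where
  "w_hat_vec n x i = unit_vec x (red n i) + v_vec n x (i + 1) (i + int n - 1)"

definition w_jk_vec :: "nat \<Rightarrow> (label \<Rightarrow> 'f) \<Rightarrow> int \<Rightarrow> int \<Rightarrow> 'f \<Rightarrow>\<^sub>0 real" where
  "w_jk_vec n x j k =
     (if even k then
        (\<Sum>i = 0..k div 2. w_vec n x (j + 2 * i)) - (\<Sum>i = 1..k div 2. w_hat_vec n x (j + 2 * i - 1))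
      else
        v_vec n x (j + k) (j + int n + k + 1)
        + (\<Sum>i = 0..(k - 1) div 2. w_vec n x (j + 2 * i))
        - (\<Sum>i = 1..(k + 1) div 2. w_hat_vec n x (j + 2 * i - 1)))"

end

theory Submission
  imports Defs
begin

text \<open>
  Write \<open>D a c\<close> for the \<open>\<omega>\<close>-weight of the chord from \<open>a\<close> to \<open>c\<close>, where the weight of a diameter is the sum
  of the weights of its two colors. The Groebner cone is cut out by the \<open>n (n - 2)\<close> inequalities
  \<open>D a (c + 1) + D (a + 1) c \<le> D a c + D (a + 1) (c + 1)\<close> and the \<open>2 n\<close> inequalities
  \<open>D (a + 1) (a + n) \<le> \<beta> a + \<rho> (a + 1)\<close> and \<open>D (a + 1) (a + n) \<le> \<rho> a + \<beta> (a + 1)\<close>, where \<open>\<beta>\<close> and \<open>\<rho>\<close> are the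
  weights of the blue and red diameters. The slacks of the last two families have the same sum, and this
  is the only linear relation between the slacks. So modulo lineality the cone is the product of an orthant
  with the cone over a product of two simplices. Its rays have one slack of the first kind equal to \<open>1\<close>
  (the vectors \<open>v l\<close>), or one slack of each of the other two kinds equal to \<open>1\<close> (the vectors \<open>w j k\<close>).

  These inequalities are necessary because both monomials of an exchange relation lie in a cluster.
  If they are strict, every product of two incompatible variables is a sum of monomials of smaller weight,
  so that \<open>I\<^sup>\<times>\<close> is contained in the initial ideal, and equality follows from the linear independence of the
  compatible monomials. For the latter, let \<open>B a\<close> be the blue diameters and
  \<open>\<delta> i = x\<^bsub>[i, i + 1]\<^esub> / (B i * B (i + 1))\<close>. These are algebraically independent since the blue diameters form
  a cluster, and every chord is \<open>B a * B c * (\<delta> a + \<dots> + \<delta> (c - 1))\<close>, every red diameter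
  \<open>B a * (\<delta> a + \<dots> + \<delta> (a + n - 1))\<close>. For a suitable order of the \<open>\<delta> i\<close> different compatible monomials have
  different leading terms.
\<close>

text \<open>A strict weight may take negative values, so rewriting into lighter monomials need not
  stop by itself. The expressions for crossing products are therefore found uniformly in all strict
  weights: applied to one strict weight with natural values, \<open>\<omega>\<^sub>0\<close>, they
  bound the rewriting. The same \<open>\<omega>\<^sub>0\<close> is the interior point from which the
  whole cone is approximated. Symmetric pairs of chords can cross twice; such products are not
  exchange products, and their expression comes from multiplying out the formulas in the \<delta> i.
  The order of the \<delta> i is realised by degrees: the independent variables are multiplied by
  powers of a new variable \<open>T\<close> whose exponents are built from powers of a large base
  \<open>q\<close>. The degree of a monomial then has base \<open>q\<close> digits that count its
  sides by vertex and by leading gap, and a noncrossing multiset is recovered from these counts one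
  side at a time. The cut between \<open>n - 1\<close> and \<open>n\<close> breaks the cyclic
  symmetry, since a choice of leading gaps needs a linear order.\<close>

abbreviation lookup where "lookup \<equiv> Poly_Mapping.lookup"
abbreviation keys where "keys \<equiv> Poly_Mapping.keys"
abbreviation single where "single \<equiv> Poly_Mapping.single"

section \<open>Evaluation of polynomials\<close>

definition eval_mon :: "('v \<Rightarrow> 'a::comm_semiring_1) \<Rightarrow> ('v \<Rightarrow>\<^sub>0 nat) \<Rightarrow> 'a" where
  "eval_mon \<phi> m = (\<Prod>v\<in>keys m. \<phi> v ^ lookup m v)"

lemma eval_mon_superset:
  assumes "finite A" "keys m \<subseteq> A"
  shows "eval_mon \<phi> m = (\<Prod>v\<in>A. \<phi> v ^ lookup m v)"
  unfolding eval_mon_def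
  by (rule prod.mono_neutral_left) (use assms in \<open>auto simp: in_keys_iff\<close>)

lemma eval_mon_0 [simp]: "eval_mon \<phi> 0 = 1"
  by (simp add: eval_mon_def)

lemma eval_mon_add: "eval_mon \<phi> (m + m') = eval_mon \<phi> m * eval_mon \<phi> m'"
proof -
  let ?A = "keys m \<union> keys m'"
  have "keys (m + m') \<subseteq> ?A" by (rule Poly_Mapping.keys_add)
  then show ?thesis
    by (simp add: eval_mon_superset[of ?A] lookup_add power_add prod.distrib)
qed

lemma eval_mon_single [simp]: "eval_mon \<phi> (single v k) = \<phi> v ^ k"
  by (cases "k = 0") (auto simp: eval_mon_def)

lemma poly_mapping_sum_singles: "p = (\<Sum>m\<in>keys p. single m (lookup p m))"
proof (rule poly_mapping_eqI)
  fix k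
  have "lookup (\<Sum>m\<in>keys p. single m (lookup p m)) k
      = (\<Sum>m\<in>keys p. if m = k then lookup p m else 0)"
    by (auto simp: lookup_sum lookup_single when_def intro!: sum.cong)
  also have "\<dots> = lookup p k" by (simp add: in_keys_iff)
  finally show "lookup p k = lookup (\<Sum>m\<in>keys p. single m (lookup p m)) k" by simp
qed

text \<open>Target ring and coefficient map are kept general because the same polynomials are
  evaluated twice: through \<open>\<iota>\<close> in the ambient field and through
  \<open>\<kappa>\<close> in polynomials in one variable over it.\<close>

definition peval :: "('k::comm_ring_1 \<Rightarrow> 'a::comm_ring_1) \<Rightarrow> ('v \<Rightarrow> 'a) \<Rightarrow> ('v, 'k) mpoly \<Rightarrow> 'a" where
  "peval \<kappa> \<phi> p = (\<Sum>m\<in>keys p. \<kappa> (lookup p m) * eval_mon \<phi> m)"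

lemma poly_eval_eq_peval: "poly_eval \<iota> p = peval \<iota> (\<lambda>v. v) p"
  by (simp add: poly_eval_def peval_def eval_mon_def)

locale coeff_hom =
  fixes \<kappa> :: "'k::comm_ring_1 \<Rightarrow> 'a::comm_ring_1"
  assumes one: "\<kappa> 1 = 1" and add: "\<kappa> (a + b) = \<kappa> a + \<kappa> b" and mult: "\<kappa> (a * b) = \<kappa> a * \<kappa> b"
begin

lemma zero [simp]: "\<kappa> 0 = 0"
  using add[of 0 0] by simp

lemma peval_superset:
  assumes "finite A" "keys p \<subseteq> A"
  shows "peval \<kappa> \<phi> p = (\<Sum>m\<in>A. \<kappa> (lookup p m) * eval_mon \<phi> m)"
  unfolding peval_def
  by (rule sum.mono_neutral_left) (use assms in \<open>auto simp: in_keys_iff\<close>)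

lemma peval_add: "peval \<kappa> \<phi> (p + q) = peval \<kappa> \<phi> p + peval \<kappa> \<phi> q"
proof -
  let ?A = "keys p \<union> keys q"
  have "keys (p + q) \<subseteq> ?A" by (rule Poly_Mapping.keys_add)
  then show ?thesis
    by (simp add: peval_superset[of ?A] lookup_add add distrib_right sum.distrib)
qed

lemma peval_0 [simp]: "peval \<kappa> \<phi> 0 = 0"
  by (simp add: peval_def)

lemma peval_single [simp]: "peval \<kappa> \<phi> (single m c) = \<kappa> c * eval_mon \<phi> m"
  by (cases "c = 0") (auto simp: peval_def)

lemma peval_1 [simp]: "peval \<kappa> \<phi> 1 = 1"
  by (simp add: single_one[symmetric] one del: single_one)

lemma peval_sum: "peval \<kappa> \<phi> (sum f A) = (\<Sum>a\<in>A. peval \<kappa> \<phi> (f a))"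
  by (induction A rule: infinite_finite_induct) (auto simp: peval_add)

lemma peval_mult: "peval \<kappa> \<phi> (p * q) = peval \<kappa> \<phi> p * peval \<kappa> \<phi> q"
proof -
  have "p * q = (\<Sum>m\<in>keys p. single m (lookup p m)) * (\<Sum>m\<in>keys q. single m (lookup q m))"
    using poly_mapping_sum_singles[of p] poly_mapping_sum_singles[of q] by simp
  also have "peval \<kappa> \<phi> \<dots> = peval \<kappa> \<phi> p * peval \<kappa> \<phi> q"
    by (simp add: sum_product peval_sum mult_single mult eval_mon_add peval_def[of _ _ p]
        peval_def[of _ _ q] mult_ac)
  finally show ?thesis .
qed

lemma peval_uminus: "peval \<kappa> \<phi> (- p) = - peval \<kappa> \<phi> p"
  using peval_add[of \<phi> p "- p"] by (simp add: eq_neg_iff_add_eq_0 add.commute)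

lemma peval_diff: "peval \<kappa> \<phi> (p - q) = peval \<kappa> \<phi> p - peval \<kappa> \<phi> q"
  using peval_add[of \<phi> p "- q"] by (simp add: peval_uminus)

lemma peval_power: "peval \<kappa> \<phi> (p ^ k) = peval \<kappa> \<phi> p ^ k"
  by (induction k) (auto simp: peval_mult)

lemma peval_prod: "peval \<kappa> \<phi> (prod f A) = (\<Prod>a\<in>A. peval \<kappa> \<phi> (f a))"
  by (induction A rule: infinite_finite_induct) (auto simp: peval_mult)

lemma peval_var [simp]: "peval \<kappa> \<phi> (var v) = \<phi> v"
  by (simp add: var_def one)

end

lemma polys_0 [simp]: "0 \<in> polys X"
  and polys_single: "keys m \<subseteq> X \<Longrightarrow> single m c \<in> polys X"
  and polys_var: "v \<in> X \<Longrightarrow> var v \<in> polys X"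
  by (auto simp: polys_def var_def split: if_splits)

lemma polys_lookup_eq_0: "p \<in> polys X \<Longrightarrow> m \<in> keys p \<Longrightarrow> v \<notin> X \<Longrightarrow> lookup m v = 0"
  unfolding polys_def using in_keys_iff[of v m] by blast

lemma polys_1 [simp]: "1 \<in> polys X"
  by (simp add: single_one[symmetric] polys_single del: single_one)

lemma polys_add: "p \<in> polys X \<Longrightarrow> q \<in> polys X \<Longrightarrow> p + q \<in> polys X"
  using Poly_Mapping.keys_add[of p q] by (auto simp: polys_def)

lemma polys_uminus: "p \<in> polys X \<Longrightarrow> - p \<in> polys X"
  by (auto simp: polys_def in_keys_iff)

lemma polys_diff: "p \<in> polys X \<Longrightarrow> q \<in> polys X \<Longrightarrow> p - q \<in> polys X"
  using polys_add[of p X "- q"] polys_uminus[of q X] by simp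

lemma polys_sum: "(\<And>a. a \<in> A \<Longrightarrow> f a \<in> polys X) \<Longrightarrow> sum f A \<in> polys X"
  by (induction A rule: infinite_finite_induct) (auto intro: polys_add)

lemma polys_mult:
  assumes "p \<in> polys X" "q \<in> polys X" shows "p * q \<in> polys X"
proof -
  have "keys m \<subseteq> X" if "m \<in> keys (p * q)" for m
  proof -
    from that keys_mult[of p q] have "m \<in> {a + b |a b. a \<in> keys p \<and> b \<in> keys q}" by (rule rev_subsetD)
    then obtain a b where "m = a + b" "a \<in> keys p" "b \<in> keys q" by blast
    then show ?thesis
      using assms Poly_Mapping.keys_add[of a b] unfolding polys_def by blast
  qed
  then show ?thesis by (auto simp: polys_def)
qed

lemma polys_power: "p \<in> polys X \<Longrightarrow> p ^ k \<in> polys X"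
  by (induction k) (auto intro: polys_mult)

lemma polys_prod: "(\<And>a. a \<in> A \<Longrightarrow> f a \<in> polys X) \<Longrightarrow> prod f A \<in> polys X"
  by (induction A rule: infinite_finite_induct) (auto intro: polys_mult)

lemma polys_mono: "p \<in> polys X \<Longrightarrow> X \<subseteq> Y \<Longrightarrow> p \<in> polys Y"
  by (auto simp: polys_def)

lemma lookup_mult_single:
  fixes a :: "'b::cancel_comm_monoid_add \<Rightarrow>\<^sub>0 'k::comm_ring_1"
  shows "lookup (a * single t 1) (m + t) = lookup a m"
proof -
  have "lookup (a * single t 1) (m + t) = lookup ((\<Sum>k\<in>keys a. single k (lookup a k)) * single t 1) (m + t)"
    using poly_mapping_sum_singles[of a] by simp
  also have "\<dots> = (\<Sum>k\<in>keys a. if k = m then lookup a k else 0)"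
    by (auto simp: sum_distrib_right mult_single lookup_sum lookup_single when_def intro!: sum.cong)
  also have "\<dots> = lookup a m" by (simp add: in_keys_iff)
  finally show ?thesis .
qed

lemma keys_mult_single:
  fixes a :: "'b::cancel_comm_monoid_add \<Rightarrow>\<^sub>0 'k::comm_ring_1"
  assumes "m \<in> keys (a * single t 1)"
  shows "\<exists>m'\<in>keys a. m = m' + t"
  using assms keys_mult[of a "single t 1"] by auto

lemma var_power: "(var v :: ('v, 'k::comm_ring_1) mpoly) ^ k = single (single v k) 1"
  by (induction k) (auto simp: var_def mult_single single_add[symmetric])

section \<open>Algebraic independence\<close>

text \<open>The injectivity half of \<open>free_generating_set\<close>; this is the property carried
  along mutations.\<close>

definition alg_indep :: "('k::field \<Rightarrow> 'f::field) \<Rightarrow> 'f set \<Rightarrow> bool" where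
  "alg_indep \<iota> Y \<longleftrightarrow> (\<forall>p\<in>polys Y. poly_eval \<iota> p = 0 \<longrightarrow> p = 0)"

text \<open>The exponent of \<open>y\<close> in a monomial tells which summand it comes from,
  because the coefficients \<open>a j\<close> do not involve \<open>y\<close>.\<close>

lemma var_coeffs_zero:
  fixes a :: "nat \<Rightarrow> ('v, 'k::comm_ring_1) mpoly"
  assumes a: "\<And>j. j \<le> d \<Longrightarrow> a j \<in> polys Y" and y: "y \<notin> Y"
    and 0: "(\<Sum>j\<le>d. a j * var y ^ j) = 0" and k: "k \<le> d"
  shows "a k = 0"
proof (rule poly_mapping_eqI)
  fix m
  show "lookup (a k) m = lookup 0 m"
  proof (cases "m \<in> keys (a k)")
    case True
    have ym: "lookup m y = 0" by (rule polys_lookup_eq_0[OF a[OF k] True y])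
    have "lookup (a j * var y ^ j) (m + single y k) = 0" if "j \<le> d" "j \<noteq> k" for j
    proof (rule ccontr)
      assume "lookup (a j * var y ^ j) (m + single y k) \<noteq> 0"
      then have "m + single y k \<in> keys (a j * single (single y j) 1)"
        by (simp add: in_keys_iff var_power)
      then obtain m' where m': "m' \<in> keys (a j)" "m + single y k = m' + single y j"
        using keys_mult_single by blast
      have "lookup m' y = 0" using polys_lookup_eq_0[OF a[OF that(1)] m'(1) y] .
      moreover have "lookup (m + single y k) y = lookup (m' + single y j) y" using m' by simp
      ultimately show False using ym that by (simp add: lookup_add)
    qed
    then have "lookup (\<Sum>j\<le>d. a j * var y ^ j) (m + single y k)
       = (\<Sum>j\<le>d. if j = k then lookup (a k * var y ^ k) (m + single y k) else 0)"
      unfolding lookup_sum by (intro sum.cong) auto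
    also have "\<dots> = lookup (a k) m" using k by (simp add: var_power lookup_mult_single)
    finally show ?thesis using 0 by simp
  qed (simp add: in_keys_iff)
qed

lemma var_expansion:
  fixes p :: "('v, 'k::comm_ring_1) mpoly"
  assumes p: "p \<in> polys (insert y Y)" and y: "y \<notin> Y"
  shows "\<exists>d a. (\<forall>j\<le>d. a j \<in> polys Y) \<and> p = (\<Sum>j\<le>d. a j * var y ^ j)"
proof -
  define rem where "rem m = m - single y (lookup m y)" for m :: "'v \<Rightarrow>\<^sub>0 nat"
  have rem: "rem m + single y (lookup m y) = m" for m
    by (rule poly_mapping_eqI) (auto simp: rem_def lookup_add lookup_minus lookup_single when_def)
  have remY: "keys (rem m) \<subseteq> Y" if "m \<in> keys p" for m
  proof
    fix v assume v: "v \<in> keys (rem m)"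
    then have "lookup m v \<noteq> 0" "v \<noteq> y"
      by (auto simp: rem_def in_keys_iff lookup_minus lookup_single when_def split: if_splits)
    then show "v \<in> Y" using polys_lookup_eq_0[OF p that, of v] by auto
  qed
  define d where "d = Max (insert 0 ((\<lambda>m. lookup m y) ` keys p))"
  have d: "lookup m y \<le> d" if "m \<in> keys p" for m
    unfolding d_def using that by (intro Max_ge) auto
  define a where "a j = (\<Sum>m | m \<in> keys p \<and> lookup m y = j. single (rem m) (lookup p m))" for j
  have "a j \<in> polys Y" for j
    unfolding a_def by (rule polys_sum) (use remY in \<open>auto intro: polys_single\<close>)
  moreover have "(\<Sum>j\<le>d. a j * var y ^ j)
      = (\<Sum>j\<le>d. \<Sum>m | m \<in> keys p \<and> lookup m y = j. single m (lookup p m))"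
    unfolding a_def sum_distrib_right
    by (intro sum.cong refl) (auto simp: var_power mult_single rem)
  moreover have "\<dots> = (\<Sum>m\<in>keys p. single m (lookup p m))"
    using d by (subst sum.group) auto
  ultimately show ?thesis
    using poly_mapping_sum_singles[of p] by (intro exI[of _ d] exI[of _ a]) simp
qed

text \<open>
  If \<open>y' = P / y\<close> satisfies an equation over \<open>Y\<close>, then clearing denominators gives one for \<open>y\<close>.
\<close>

lemma alg_indep_exchange:
  assumes \<iota>: "coeff_hom \<iota>"
    and indep: "alg_indep \<iota> (insert y Y)" and y: "y \<notin> Y"
    and Q: "Q \<in> polys Y" "Q \<noteq> 0" and y': "y' = poly_eval \<iota> Q / y"
  shows "y' \<notin> Y" "alg_indep \<iota> (insert y' Y)"
proof -
  interpret coeff_hom \<iota> by fact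
  note ev = poly_eval_eq_peval peval_sum peval_mult peval_power peval_diff
  have Y: "polys Y \<subseteq> polys (insert y Y)" using polys_mono by blast
  have zeroD: "p = 0" if "p \<in> polys (insert y Y)" "poly_eval \<iota> p = 0" for p
    using indep that by (auto simp: alg_indep_def)
  have y0: "y \<noteq> 0"
  proof
    assume "y = 0"
    then have "poly_eval \<iota> (var y) = 0" by (simp add: ev)
    then have "(var y :: ('b, 'a) mpoly) = 0" by (intro zeroD polys_var) auto
    then have "lookup (var y :: ('b, 'a) mpoly) (single y 1) = 0" by simp
    then show False by (simp add: var_def)
  qed
  have Q0: "poly_eval \<iota> Q \<noteq> 0" using Q zeroD Y by blast
  have main: "\<forall>k\<le>d. a k = 0"
    if a: "\<And>j. j \<le> d \<Longrightarrow> a j \<in> polys Y" and 0: "(\<Sum>j\<le>d. poly_eval \<iota> (a j) * y' ^ j) = 0" for a d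
  proof -
    \<comment> \<open>Multiplication by \<open>y ^ d\<close> turns \<open>a j * y' ^ j\<close> into
      \<open>a j * Q ^ j * y ^ (d - j)\<close>; \<open>b\<close> lists these coefficients by the
      power of \<open>y\<close>.\<close>
    define b where "b j = a (d - j) * Q ^ (d - j)" for j
    have b: "b j \<in> polys Y" if "j \<le> d" for j
      unfolding b_def using a Q by (auto intro!: polys_mult polys_power)
    have "poly_eval \<iota> (\<Sum>j\<le>d. b j * var y ^ j) = (\<Sum>j\<le>d. poly_eval \<iota> (b j) * y ^ j)"
      by (simp add: ev)
    also have "\<dots> = (\<Sum>j\<le>d. poly_eval \<iota> (b (d - j)) * y ^ (d - j))"
      using sum.nat_diff_reindex[of "\<lambda>j. poly_eval \<iota> (b j) * y ^ j" "Suc d"]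
      by (simp add: lessThan_Suc_atMost)
    also have "\<dots> = (\<Sum>j\<le>d. y ^ d * (poly_eval \<iota> (a j) * y' ^ j))"
    proof (rule sum.cong)
      fix j assume "j \<in> {..d}"
      then have "y ^ d = y ^ (d - j) * y ^ j" by (simp add: power_add[symmetric])
      then show "poly_eval \<iota> (b (d - j)) * y ^ (d - j) = y ^ d * (poly_eval \<iota> (a j) * y' ^ j)"
        using \<open>j \<in> {..d}\<close> y0 by (simp add: b_def ev y' power_divide)
    qed simp
    also have "\<dots> = 0" using 0 by (simp add: sum_distrib_left[symmetric])
    finally have "(\<Sum>j\<le>d. b j * var y ^ j) = 0"
      using b Y by (intro zeroD) (auto intro!: polys_sum polys_mult polys_power polys_var)
    from var_coeffs_zero[OF _ y this] b have b0: "b k = 0" if "k \<le> d" for k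
      using that by blast
    have "a k = 0" if "k \<le> d" for k
    proof -
      have "b (d - k) = 0" by (rule b0) simp
      then have "poly_eval \<iota> (b (d - k)) = 0" by (simp add: ev)
      then have "poly_eval \<iota> (a k) * poly_eval \<iota> Q ^ k = 0" using that by (simp add: b_def ev)
      then have "poly_eval \<iota> (a k) = 0" using Q0 by simp
      then show ?thesis using a[OF that] zeroD Y by blast
    qed
    then show ?thesis by blast
  qed
  show y'Y: "y' \<notin> Y"
  proof
    assume "y' \<in> Y"
    \<comment> \<open>If \<open>y'\<close> were in \<open>Y\<close>, then \<open>y' - T\<close>
      would be a polynomial over \<open>Y\<close> vanishing at \<open>T = y'\<close>, although its
      coefficient \<open>- 1\<close> is not zero.\<close>
    define a where "a j = (if j = 0 then var y' else - 1 :: ('b, 'a) mpoly)" for j :: nat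
    have "a j \<in> polys Y" for j using \<open>y' \<in> Y\<close> by (auto simp: a_def intro: polys_var polys_uminus)
    moreover have "(\<Sum>j\<le>1. poly_eval \<iota> (a j) * y' ^ j) = 0"
      by (simp add: a_def ev peval_uminus)
    ultimately have "a 1 = 0" using main[of 1 a] by blast
    then show False by (simp add: a_def)
  qed
  show "alg_indep \<iota> (insert y' Y)"
    unfolding alg_indep_def
  proof (intro ballI impI)
    fix p assume "p \<in> polys (insert y' Y)" and p0: "poly_eval \<iota> p = 0"
    from var_expansion[OF this(1) y'Y] obtain d a where
      a: "\<forall>j\<le>d. a j \<in> polys Y" and p: "p = (\<Sum>j\<le>d. a j * var y' ^ j)" by blast
    have "\<forall>k\<le>d. a k = 0" using p0 a by (intro main) (auto simp: p ev)
    then show "p = 0" by (simp add: p)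
  qed
qed

section \<open>Initial ideals\<close>

lemma weight_superset:
  assumes "finite A" "keys m \<subseteq> A"
  shows "weight \<omega> m = (\<Sum>v\<in>A. lookup \<omega> v * real (lookup m v))"
  unfolding weight_def
  by (rule sum.mono_neutral_left) (use assms in \<open>auto simp: in_keys_iff\<close>)

lemma weight_add: "weight \<omega> (m + m') = weight \<omega> m + weight \<omega> m'"
proof -
  let ?A = "keys m \<union> keys m'"
  have "keys (m + m') \<subseteq> ?A" by (rule Poly_Mapping.keys_add)
  then show ?thesis
    by (simp add: weight_superset[of ?A] lookup_add distrib_left sum.distrib)
qed

lemma weight_0 [simp]: "weight \<omega> 0 = 0"
  by (simp add: weight_def)

lemma weight_single [simp]: "weight \<omega> (single v k) = lookup \<omega> v * real k"
  by (cases "k = 0") (auto simp: weight_def)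

definition nat_weight :: "('v \<Rightarrow> nat) \<Rightarrow> ('v \<Rightarrow>\<^sub>0 nat) \<Rightarrow> nat" where
  "nat_weight h m = (\<Sum>v\<in>keys m. h v * lookup m v)"

lemma nat_weight_superset:
  assumes "finite A" "keys m \<subseteq> A"
  shows "nat_weight h m = (\<Sum>v\<in>A. h v * lookup m v)"
  unfolding nat_weight_def
  by (rule sum.mono_neutral_left) (use assms in \<open>auto simp: in_keys_iff\<close>)

lemma nat_weight_add: "nat_weight h (m + m') = nat_weight h m + nat_weight h m'"
proof -
  let ?A = "keys m \<union> keys m'"
  have "keys (m + m') \<subseteq> ?A" by (rule Poly_Mapping.keys_add)
  then show ?thesis
    by (simp add: nat_weight_superset[of ?A] lookup_add distrib_left sum.distrib)
qed

lemma nat_weight_0 [simp]: "nat_weight h 0 = 0"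
  by (simp add: nat_weight_def)

lemma nat_weight_single [simp]: "nat_weight h (single v k) = h v * k"
  by (cases "k = 0") (auto simp: nat_weight_def)

lemma lookup_initial_form:
  "lookup (initial_form \<omega> p) m =
     (if m \<in> keys p \<and> (\<forall>m'\<in>keys p. weight \<omega> m' \<le> weight \<omega> m) then lookup p m else 0)"
proof -
  let ?M = "{m \<in> keys p. \<forall>m'\<in>keys p. weight \<omega> m' \<le> weight \<omega> m}"
  have "lookup (initial_form \<omega> p) m = (\<Sum>m'\<in>?M. if m' = m then lookup p m' else 0)"
    unfolding initial_form_def
    by (auto simp: lookup_sum lookup_single when_def intro!: sum.cong)
  also have "\<dots> = (if m \<in> ?M then lookup p m else 0)" by (subst sum.delta) auto
  finally show ?thesis by simp
qed

lemma keys_initial_form: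
  "keys (initial_form \<omega> p) = {m \<in> keys p. \<forall>m'\<in>keys p. weight \<omega> m' \<le> weight \<omega> m}"
  unfolding set_eq_iff in_keys_iff[of _ "initial_form \<omega> p"] lookup_initial_form
  by (simp add: in_keys_iff)

lemma in_keys_sumE:
  assumes "j \<in> keys (sum f A)"
  obtains a where "a \<in> A" "j \<in> keys (f a)"
proof -
  have "(\<Sum>a\<in>A. lookup (f a) j) \<noteq> 0" using assms by (simp add: in_keys_iff lookup_sum)
  then obtain a where "a \<in> A" "lookup (f a) j \<noteq> 0" by (rule sum.not_neutral_contains_not_neutral)
  with that show ?thesis by (simp add: in_keys_iff)
qed

lemma lookup_const_mult: "lookup (single 0 c * q) m = c * lookup q m"
  unfolding mult_map_scale_conv_mult[symmetric] by (simp add: Poly_Mapping.map.rep_eq when_def)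

lemma keys_const_mult: "keys (single 0 c * q) \<subseteq> keys q"
  by (auto simp: in_keys_iff lookup_const_mult)

lemma keys_initial_form_nonempty:
  assumes "p \<noteq> 0" shows "keys (initial_form \<omega> p) \<noteq> {}"
proof -
  have "finite (keys p)" "keys p \<noteq> {}" using assms poly_mapping_sum_singles[of p] by auto
  then have "Max (weight \<omega> ` keys p) \<in> weight \<omega> ` keys p" by (intro Max_in) auto
  then obtain m where "m \<in> keys p" "weight \<omega> m = Max (weight \<omega> ` keys p)" by force
  then have "m \<in> keys (initial_form \<omega> p)" by (simp add: keys_initial_form)
  then show ?thesis by blast
qed

lemma is_ideal_Inter: "F \<noteq> {} \<Longrightarrow> (\<And>S. S \<in> F \<Longrightarrow> is_ideal X S) \<Longrightarrow> is_ideal X (\<Inter>F)"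
  unfolding is_ideal_def by blast

lemma is_ideal_polys: "is_ideal X (polys X)"
  by (auto simp: is_ideal_def intro: polys_add polys_mult)

lemma is_ideal_ideal_gen:
  assumes "G \<subseteq> polys X" shows "is_ideal X (ideal_gen X G)"
  unfolding ideal_gen_def hull_def
  by (rule is_ideal_Inter) (use assms is_ideal_polys in auto)

lemma ideal_gen_subset: "G \<subseteq> ideal_gen X G"
  by (simp add: ideal_gen_def hull_subset)

lemma ideal_gen_minimal: "G \<subseteq> S \<Longrightarrow> is_ideal X S \<Longrightarrow> ideal_gen X G \<subseteq> S"
  by (simp add: ideal_gen_def hull_minimal)

lemma is_ideal_sum:
  assumes "is_ideal X S" "\<And>a. a \<in> A \<Longrightarrow> f a \<in> S"
  shows "sum f A \<in> S"
  using assms(2) by (induction A rule: infinite_finite_induct) (use assms(1) in \<open>auto simp: is_ideal_def\<close>)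

section \<open>Ideals generated by products of two variables, and rewriting to standard
  monomials\<close>

definition divisible :: "('v \<Rightarrow> 'v \<Rightarrow> bool) \<Rightarrow> ('v \<Rightarrow>\<^sub>0 nat) \<Rightarrow> bool" where
  "divisible R m \<longleftrightarrow> (\<exists>v w m0. R v w \<and> m = m0 + (single v 1 + single w 1))"

lemma divisibleI: "R v w \<Longrightarrow> divisible R (m0 + (single v 1 + single w 1))"
  unfolding divisible_def by (rule exI[of _ v], rule exI[of _ w], rule exI[of _ m0]) simp

lemma divisibleE:
  assumes "divisible R m"
  obtains v w m0 where "R v w" "m = m0 + (single v 1 + single w 1)"
  using assms unfolding divisible_def by (elim exE conjE)

definition pair_products :: "('v \<Rightarrow> 'v \<Rightarrow> bool) \<Rightarrow> ('v, 'k::comm_ring_1) mpoly set" where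
  "pair_products R = {var v * var w | v w. R v w}"

lemma var_mult_var: "var v * var w = single (single v 1 + single w 1) 1"
  by (simp add: var_def mult_single)

text \<open>A monomial ideal is spanned by its monomials: the polynomials with divisible monomials
  only form an ideal containing the generators, and conversely each of their terms is a multiple of
  a generator.\<close>

lemma mem_pair_ideal_iff:
  assumes R: "\<And>v w. R v w \<Longrightarrow> v \<in> X \<and> w \<in> X"
  shows "p \<in> ideal_gen X (pair_products R) \<longleftrightarrow> p \<in> polys X \<and> (\<forall>m\<in>keys p. divisible R m)"
proof
  let ?S = "{p :: ('a, 'b) mpoly. p \<in> polys X \<and> (\<forall>m\<in>keys p. divisible R m)}"
  have mult: "divisible R m" if p: "\<forall>m\<in>keys p. divisible R m" and m: "m \<in> keys (r * p)"
    for r p :: "('a, 'b) mpoly" and m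
  proof -
    from m keys_mult[of r p] have "m \<in> {a + b |a b. a \<in> keys r \<and> b \<in> keys p}" by (rule rev_subsetD)
    then obtain a b where ab: "m = a + b" "b \<in> keys p" by blast
    have "divisible R b" using p ab(2) by blast
    then obtain v w m0 where "R v w" "b = m0 + (single v 1 + single w 1)" by (rule divisibleE)
    then have "R v w" "m = (a + m0) + (single v 1 + single w 1)" using ab(1) by (simp_all add: add.assoc)
    then show ?thesis using divisibleI by simp
  qed
  have add: "divisible R m"
    if p: "\<forall>m\<in>keys p. divisible R m" and q: "\<forall>m\<in>keys q. divisible R m" and m: "m \<in> keys (p + q)"
    for q p :: "('a, 'b) mpoly" and m
  proof -
    have "m \<in> keys p \<union> keys q" using m Poly_Mapping.keys_add by (rule rev_subsetD)
    then show ?thesis using p q by blast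
  qed
  have "is_ideal X ?S"
    unfolding is_ideal_def
  proof (intro conjI ballI)
    fix p q :: "('a, 'b) mpoly" assume "p \<in> ?S" "q \<in> ?S"
    then show "p + q \<in> ?S" using add[of p q] by (simp add: polys_add)
  next
    fix p q :: "('a, 'b) mpoly" assume "p \<in> polys X" "q \<in> ?S"
    then show "p * q \<in> ?S" using mult[of q _ p] by (simp add: polys_mult)
  qed auto
  moreover have "pair_products R \<subseteq> ?S"
  proof
    fix g :: "('a, 'b) mpoly" assume "g \<in> pair_products R"
    then obtain v w where g: "g = var v * var w" "R v w" by (auto simp: pair_products_def)
    then have "divisible R (single v 1 + single w 1)" using divisibleI[of R v w 0] by simp
    moreover have "g \<in> polys X" using R[OF g(2)] by (auto simp: g(1) intro!: polys_mult polys_var)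
    ultimately show "g \<in> ?S" by (simp add: g(1) var_mult_var)
  qed
  ultimately have sub: "ideal_gen X (pair_products R) \<subseteq> ?S" by (intro ideal_gen_minimal)
  assume "p \<in> ideal_gen X (pair_products R)"
  with sub have "p \<in> ?S" by (rule subsetD)
  then show "p \<in> polys X \<and> (\<forall>m\<in>keys p. divisible R m)" by simp
next
  assume p: "p \<in> polys X \<and> (\<forall>m\<in>keys p. divisible R m)"
  have "pair_products R \<subseteq> polys X"
    using R by (auto simp: pair_products_def intro!: polys_mult polys_var)
  then have ideal: "is_ideal X (ideal_gen X (pair_products R :: ('a, 'b) mpoly set))"
    by (rule is_ideal_ideal_gen)
  have "single m (lookup p m) \<in> ideal_gen X (pair_products R)" if "m \<in> keys p" for m
  proof -
    from that p have "divisible R m" "keys m \<subseteq> X" by (auto simp: polys_def)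
    from this(1) obtain v w m0 where m: "R v w" "m = m0 + (single v 1 + single w 1)" by (rule divisibleE)
    have "keys m0 \<subseteq> keys m" using m(2) by (auto simp: in_keys_iff lookup_add)
    then have "single m0 (lookup p m) \<in> polys X"
      using \<open>keys m \<subseteq> X\<close> by (auto intro: polys_single)
    moreover have "var v * var w \<in> ideal_gen X (pair_products R :: ('a, 'b) mpoly set)"
      using m(1) ideal_gen_subset by (force simp: pair_products_def)
    ultimately have "single m0 (lookup p m) * (var v * var w) \<in> ideal_gen X (pair_products R)"
      using ideal unfolding is_ideal_def by blast
    then show ?thesis by (simp add: m(2) var_mult_var mult_single)
  qed
  then show "p \<in> ideal_gen X (pair_products R)"
    using poly_mapping_sum_singles[of p] is_ideal_sum[OF ideal, of "keys p" "\<lambda>m. single m (lookup p m)"] by simp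
qed

text \<open>The strict inequality for divisible \<open>m\<close> ensures that rewriting
  \<open>m\<close> cannot affect the coefficient of a standard monomial that is at least as heavy as
  \<open>m\<close>.\<close>

definition normal_form ::
    "('k::field \<Rightarrow> 'f::field) \<Rightarrow> ('f \<Rightarrow> 'f \<Rightarrow> bool) \<Rightarrow> ('f \<Rightarrow>\<^sub>0 real) \<Rightarrow> 'f set \<Rightarrow>
       ('f \<Rightarrow>\<^sub>0 nat) \<Rightarrow> ('f, 'k) mpoly \<Rightarrow> bool" where
  "normal_form \<iota> R \<omega> X m q \<longleftrightarrow>
     q \<in> polys X \<and> poly_eval \<iota> q = eval_mon (\<lambda>v. v) m \<and> (\<forall>k\<in>keys q. \<not> divisible R k) \<and>
     (if divisible R m then \<forall>k\<in>keys q. weight \<omega> k < weight \<omega> m else q = single m 1)"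

text \<open>
  \<open>\<omega>\<close> need not be positive, so that rewriting terminates only because of the auxiliary
  \<open>\<nat>\<close>-valued weight \<open>h\<close>.
\<close>

lemma reduction:
  assumes \<iota>: "coeff_hom \<iota>"
    and rel: "\<And>v w. R v w \<Longrightarrow> \<exists>P\<in>polys X. poly_eval \<iota> P = v * w \<and>
           (\<forall>m\<in>keys P. weight \<omega> m < lookup \<omega> v + lookup \<omega> w \<and> nat_weight h m < h v + h w)"
    and m: "keys m \<subseteq> X"
  shows "\<exists>q. normal_form \<iota> R \<omega> X m q"
  using m
proof (induction "nat_weight h m" arbitrary: m rule: less_induct)
  case less
  interpret coeff_hom \<iota> by fact
  note ev = poly_eval_eq_peval
  show ?case
  proof (cases "divisible R m")
    case False
    then show ?thesis using less.prems
      by (intro exI[of _ "single m 1"]) (auto simp: normal_form_def ev one intro: polys_single)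
  next
    case True
    then obtain v w m0 where m: "R v w" "m = m0 + (single v 1 + single w 1)" by (rule divisibleE)
    from rel[OF m(1)] obtain P where P: "P \<in> polys X" "poly_eval \<iota> P = v * w"
      and wt: "\<And>k. k \<in> keys P \<Longrightarrow> weight \<omega> k < lookup \<omega> v + lookup \<omega> w"
      and hwt: "\<And>k. k \<in> keys P \<Longrightarrow> nat_weight h k < h v + h w" by blast
    have m0: "keys m0 \<subseteq> X" using less.prems m(2) by (auto simp: in_keys_iff lookup_add)
    have "\<exists>q. normal_form \<iota> R \<omega> X (m0 + k) q \<and> (\<forall>j\<in>keys q. weight \<omega> j < weight \<omega> m)"
      if k: "k \<in> keys P" for k
    proof -
      have kX: "keys (m0 + k) \<subseteq> X"
        using m0 P(1) k Poly_Mapping.keys_add[of m0 k] unfolding polys_def by blast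
      have "nat_weight h (m0 + k) < nat_weight h m"
        using hwt[OF k] by (simp add: m(2) nat_weight_add)
      from less.hyps[OF this kX] obtain q where q: "normal_form \<iota> R \<omega> X (m0 + k) q" by blast
      have "weight \<omega> (m0 + k) < weight \<omega> m"
        using wt[OF k] by (simp add: m(2) weight_add)
      then have "\<forall>j\<in>keys q. weight \<omega> j < weight \<omega> m"
        using q by (auto simp: normal_form_def split: if_splits intro: less_trans)
      with q show ?thesis by blast
    qed
    then have "\<forall>k\<in>keys P. \<exists>q. normal_form \<iota> R \<omega> X (m0 + k) q \<and> (\<forall>j\<in>keys q. weight \<omega> j < weight \<omega> m)"
      by blast
    from bchoice[OF this] obtain q where
      nf: "\<And>k. k \<in> keys P \<Longrightarrow> normal_form \<iota> R \<omega> X (m0 + k) (q k)"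
      and qwt: "\<And>k j. k \<in> keys P \<Longrightarrow> j \<in> keys (q k) \<Longrightarrow> weight \<omega> j < weight \<omega> m"
      by blast
    have q: "q k \<in> polys X" "poly_eval \<iota> (q k) = eval_mon (\<lambda>v. v) (m0 + k)"
      "\<And>j. j \<in> keys (q k) \<Longrightarrow> \<not> divisible R j" if "k \<in> keys P" for k
      using nf[OF that] by (auto simp: normal_form_def)
    let ?q = "\<Sum>k\<in>keys P. single 0 (lookup P k) * q k"
    have "?q \<in> polys X" using q(1) by (auto intro!: polys_sum polys_mult polys_single)
    moreover have "poly_eval \<iota> ?q = eval_mon (\<lambda>v. v) m0 * poly_eval \<iota> P"
      using q(2) by (simp add: ev peval_sum peval_mult eval_mon_add sum_distrib_left mult_ac peval_def[of _ _ P])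
    then have "poly_eval \<iota> ?q = eval_mon (\<lambda>v. v) m"
      using P(2) by (simp add: m(2) eval_mon_add)
    moreover have "\<not> divisible R j \<and> weight \<omega> j < weight \<omega> m" if j: "j \<in> keys ?q" for j
    proof -
      from j obtain k where k: "k \<in> keys P" "j \<in> keys (single 0 (lookup P k) * q k)" by (rule in_keys_sumE)
      have "j \<in> keys (q k)" by (rule subsetD[OF keys_const_mult k(2)])
      with q(3) qwt k(1) show ?thesis by blast
    qed
    ultimately show ?thesis using True by (intro exI[of _ ?q]) (simp add: normal_form_def)
  qed
qed

text \<open>For \<open>R v w\<close> the element \<open>v w - P\<close> of the kernel has initial
  form \<open>v w\<close>. Conversely, if some \<open>f\<close> in the kernel had a standard
  monomial of top weight, rewriting all of \<open>f\<close> would keep its coefficient and produce a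
  nontrivial relation between standard monomials.\<close>

theorem initial_ideal_kernel_eq_pair_ideal:
  assumes \<iota>: "coeff_hom \<iota>"
    and R: "\<And>v w. R v w \<Longrightarrow> v \<in> X \<and> w \<in> X"
    and rel: "\<And>v w. R v w \<Longrightarrow> \<exists>P\<in>polys X. poly_eval \<iota> P = v * w \<and>
           (\<forall>m\<in>keys P. weight \<omega> m < lookup \<omega> v + lookup \<omega> w \<and> nat_weight h m < h v + h w)"
    and indep: "\<And>p. p \<in> polys X \<Longrightarrow> \<forall>m\<in>keys p. \<not> divisible R m \<Longrightarrow> poly_eval \<iota> p = 0 \<Longrightarrow> p = 0"
  shows "initial_ideal X \<omega> {p \<in> polys X. poly_eval \<iota> p = 0} = ideal_gen X (pair_products R)"
proof (rule antisym)
  interpret coeff_hom \<iota> by fact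
  note ev = poly_eval_eq_peval
  let ?I = "{p \<in> polys X. poly_eval \<iota> p = 0}"
  have in_polys: "initial_form \<omega> p \<in> polys X" if "p \<in> polys X" for p :: "('b, 'a) mpoly"
    using that by (auto simp: polys_def keys_initial_form)
  have "initial_form \<omega> f \<in> ideal_gen X (pair_products R)" if f: "f \<in> ?I" for f
  proof -
    have "divisible R m" if "m \<in> keys f" and max: "\<forall>m'\<in>keys f. weight \<omega> m' \<le> weight \<omega> m" for m
    proof (rule ccontr)
      assume std: "\<not> divisible R m"
      have "\<forall>k\<in>keys f. \<exists>q. normal_form \<iota> R \<omega> X k q"
        using f by (intro ballI reduction[OF \<iota> rel]) (auto simp: polys_def)
      from bchoice[OF this] obtain q where nf: "\<And>k. k \<in> keys f \<Longrightarrow> normal_form \<iota> R \<omega> X k (q k)"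
        by blast
      note q = nf[unfolded normal_form_def, THEN conjunct1] nf[unfolded normal_form_def, THEN conjunct2, THEN conjunct1]
        nf[unfolded normal_form_def, THEN conjunct2, THEN conjunct2, THEN conjunct1, THEN bspec]
        nf[unfolded normal_form_def, THEN conjunct2, THEN conjunct2, THEN conjunct2]
      let ?q = "\<Sum>k\<in>keys f. single 0 (lookup f k) * q k"
      have "?q = 0"
      proof (rule indep)
        show "?q \<in> polys X" using q(1) by (auto intro!: polys_sum polys_mult polys_single)
        have "poly_eval \<iota> ?q = poly_eval \<iota> f"
          using q(2) by (simp add: ev peval_sum peval_mult peval_def[of _ _ f])
        then show "poly_eval \<iota> ?q = 0" using f by simp
        show "\<forall>j\<in>keys ?q. \<not> divisible R j"
        proof
          fix j assume j: "j \<in> keys ?q"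
          from j obtain k where k: "k \<in> keys f" "j \<in> keys (single 0 (lookup f k) * q k)" by (rule in_keys_sumE)
          have "j \<in> keys (q k)" by (rule subsetD[OF keys_const_mult k(2)])
          with q(3) k(1) show "\<not> divisible R j" by blast
        qed
      qed
      \<comment> \<open>A divisible \<open>k\<close> rewrites to monomials lighter than
        \<open>k\<close>, hence lighter than the top monomial \<open>m\<close>; a standard
        \<open>k\<close> stays as it is. So only \<open>k = m\<close> contributes.\<close>
      have "lookup (q k) m = (if k = m then 1 else 0)" if k: "k \<in> keys f" for k
      proof (cases "divisible R k")
        case True
        with q(4)[OF k] max k have "m \<notin> keys (q k)" by fastforce
        with True std show ?thesis by (auto simp: in_keys_iff)
      next
        case False
        with q(4)[OF k] show ?thesis by (auto simp: lookup_single when_def)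
      qed
      then have "lookup ?q m = (\<Sum>k\<in>keys f. if k = m then lookup f k else 0)"
        unfolding lookup_sum by (intro sum.cong refl) (auto simp: lookup_const_mult)
      also have "\<dots> = lookup f m" by (simp add: in_keys_iff)
      finally show False using \<open>?q = 0\<close> \<open>m \<in> keys f\<close> by (simp add: in_keys_iff)
    qed
    then show ?thesis using f in_polys[of f] by (auto simp: mem_pair_ideal_iff[OF R] keys_initial_form)
  qed
  moreover have "is_ideal X (ideal_gen X (pair_products R :: ('b, 'a) mpoly set))"
    using R by (intro is_ideal_ideal_gen) (auto simp: pair_products_def intro!: polys_mult polys_var)
  ultimately show "initial_ideal X \<omega> ?I \<subseteq> ideal_gen X (pair_products R)"
    unfolding initial_ideal_def by (intro ideal_gen_minimal) auto
  have "var v * var w \<in> initial_ideal X \<omega> ?I" if vw: "R v w" for v w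
  proof -
    from rel[OF vw] obtain P where P: "P \<in> polys X" "poly_eval \<iota> P = v * w"
      and wt: "\<And>k. k \<in> keys P \<Longrightarrow> weight \<omega> k < lookup \<omega> v + lookup \<omega> w" by blast
    let ?m = "single v 1 + single w 1"
    have wm: "weight \<omega> ?m = lookup \<omega> v + lookup \<omega> w" by (simp add: weight_add)
    have Pm: "?m \<notin> keys P" using wt[of ?m] wm by auto
    let ?f = "var v * var w - P"
    have fI: "?f \<in> ?I" using P R[OF vw] by (auto simp: ev peval_diff peval_mult intro!: polys_diff polys_mult polys_var)
    have lf: "lookup ?f k = (if k = ?m then 1 else - lookup P k)" for k
      using Pm by (auto simp: var_mult_var lookup_minus lookup_single when_def in_keys_iff)
    then have kf: "keys ?f = insert ?m (keys P)" by (auto simp: in_keys_iff split: if_splits)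
    have "initial_form \<omega> ?f = var v * var w"
    proof (rule poly_mapping_eqI)
      fix k
      show "lookup (initial_form \<omega> ?f) k = lookup (var v * var w) k"
      proof (cases "k = ?m")
        case True
        have "\<forall>m'\<in>keys ?f. weight \<omega> m' \<le> weight \<omega> ?m"
          unfolding kf wm using wt wm by (simp add: less_imp_le)
        moreover have "?m \<in> keys ?f" unfolding kf by (rule insertI1)
        ultimately have "lookup (initial_form \<omega> ?f) ?m = lookup ?f ?m"
          unfolding lookup_initial_form by (intro if_P conjI)
        also have "\<dots> = 1" unfolding lf by simp
        also have "\<dots> = lookup (var v * var w) ?m" by (simp add: var_mult_var)
        finally show ?thesis unfolding True .
      next
        case False
        have "\<not> (k \<in> keys ?f \<and> (\<forall>m'\<in>keys ?f. weight \<omega> m' \<le> weight \<omega> k))"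
          using False wt[of k] wm by (auto simp: kf not_le)
        then have "lookup (initial_form \<omega> ?f) k = 0"
          unfolding lookup_initial_form by (rule if_not_P)
        moreover have "lookup (var v * var w :: ('b, 'a) mpoly) k = 0"
          using False unfolding var_mult_var lookup_single by (auto simp: when_def)
        ultimately show ?thesis by simp
      qed
    qed
    with imageI[OF fI, of "initial_form \<omega>"] have "var v * var w \<in> initial_form \<omega> ` ?I" by simp
    then show ?thesis unfolding initial_ideal_def by (rule subsetD[OF ideal_gen_subset])
  qed
  then have "pair_products R \<subseteq> initial_ideal X \<omega> ?I" by (auto simp: pair_products_def)
  moreover have "is_ideal X (initial_ideal X \<omega> ?I)"
    unfolding initial_ideal_def by (rule is_ideal_ideal_gen) (use in_polys in auto)
  ultimately show "ideal_gen X (pair_products R) \<subseteq> initial_ideal X \<omega> ?I"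
    by (rule ideal_gen_minimal)
qed

text \<open>If \<open>b\<close> outweighed \<open>a\<close>, the initial form would consist of the
  standard monomials \<open>b\<close> and \<open>c\<close> only, whereas all its monomials have to
  be divisible.\<close>

lemma weight_le_of_initial_ideal_eq:
  fixes A :: "('v, 'k::{comm_ring_1, ring_char_0}) mpoly set"
  assumes R: "\<And>v w. R v w \<Longrightarrow> v \<in> X \<and> w \<in> X"
    and eq: "initial_ideal X \<omega> A = ideal_gen X (pair_products R)"
    and f: "single a 1 - (single b 1 + single c 1) \<in> A"
    and b: "\<not> divisible R b" and c: "\<not> divisible R c"
  shows "weight \<omega> b \<le> weight \<omega> a"
proof (rule ccontr)
  assume less: "\<not> weight \<omega> b \<le> weight \<omega> a"
  let ?f = "single a 1 - (single b 1 + single c 1) :: ('v, 'k) mpoly"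
  \<comment> \<open>For \<open>b = c\<close> the coefficient is \<open>- 2\<close>, which is nonzero
    in characteristic zero.\<close>
  have "lookup ?f b = - (1 + (if b = c then 1 else 0))"
    using less by (auto simp: lookup_minus lookup_add lookup_single when_def)
  then have bf: "b \<in> keys ?f" by (auto simp: in_keys_iff)
  then have "?f \<noteq> 0" by auto
  then obtain m where m: "m \<in> keys (initial_form \<omega> ?f)"
    using keys_initial_form_nonempty by blast
  have "initial_form \<omega> ?f \<in> ideal_gen X (pair_products R)"
    unfolding eq[symmetric] initial_ideal_def using f ideal_gen_subset by blast
  with m have "divisible R m" by (auto simp: mem_pair_ideal_iff[OF R])
  moreover have "m \<in> {a, b, c}"
    using m by (auto simp: keys_initial_form in_keys_iff lookup_minus lookup_add lookup_single when_def split: if_splits)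
  ultimately have "m = a" using b c by auto
  then show False using m bf less by (auto simp: keys_initial_form)
qed

section \<open>Rays of a cone cut out by balanced inequalities\<close>

lemma mod_class_eq_iff:
  assumes "subspace L" shows "mod_class L a = mod_class L b \<longleftrightarrow> a - b \<in> L"
proof
  assume "mod_class L a = mod_class L b"
  moreover have "a \<in> mod_class L a"
    unfolding mod_class_def using subspace_0[OF assms] by (intro image_eqI[of _ _ 0]) auto
  ultimately obtain y where "a = b + y" "y \<in> L" unfolding mod_class_def by auto
  then show "a - b \<in> L" by simp
next
  have sub: "mod_class L a \<subseteq> mod_class L b" if d: "a - b \<in> L" for a b
  proof
    fix x assume "x \<in> mod_class L a"
    then obtain y where y: "y \<in> L" "x = a + y" unfolding mod_class_def by auto
    then show "x \<in> mod_class L b"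
      unfolding mod_class_def using subspace_add[OF assms d y(1)]
      by (intro image_eqI[of _ _ "(a - b) + y"]) auto
  qed
  assume "a - b \<in> L"
  moreover from subspace_neg[OF assms this] have "b - a \<in> L" by simp
  ultimately show "mod_class L a = mod_class L b" using sub[of a b] sub[of b a] by blast
qed

lemma mod_class_mem_ray_mod_iff:
  assumes "subspace L"
  shows "mod_class L a \<in> ray_mod L u \<longleftrightarrow> (\<exists>t\<ge>0. a - t *\<^sub>R u \<in> L)"
  unfolding ray_mod_def using mod_class_eq_iff[OF assms] by auto

lemma ray_mod_eqI:
  assumes L: "subspace L" and t: "t > 0" "a - t *\<^sub>R u \<in> L"
  shows "ray_mod L a = ray_mod L u"
proof -
  have sub: "ray_mod L a \<subseteq> ray_mod L u" if t: "t \<ge> 0" "a - t *\<^sub>R u \<in> L" for t a u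
  proof
    fix c assume "c \<in> ray_mod L a"
    then obtain s where s: "c = mod_class L (s *\<^sub>R a)" "s \<ge> 0" unfolding ray_mod_def by auto
    have "s *\<^sub>R (a - t *\<^sub>R u) \<in> L" using subspace_scale[OF L t(2)] .
    then have "s *\<^sub>R a - (s * t) *\<^sub>R u \<in> L" by (simp add: algebra_simps)
    then show "c \<in> ray_mod L u"
      unfolding s(1) mod_class_mem_ray_mod_iff[OF L] using s t by (intro exI[of _ "s * t"]) auto
  qed
  have "- inverse t *\<^sub>R (a - t *\<^sub>R u) \<in> L" using subspace_scale[OF L t(2)] .
  then have "u - inverse t *\<^sub>R a \<in> L" using t(1) by (simp add: algebra_simps)
  with sub[of t a u] sub[of "inverse t" u a] t show ?thesis by auto
qed

text \<open>Modulo \<open>L\<close> a vector is its list of slacks. A summand of a multiple of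
  \<open>u\<close> has positive slacks only where \<open>u\<close> has, and \<open>balance\<close>
  equates the two slacks in the pair case, so the summand is proportional to \<open>u\<close>.
  Conversely, from every element of the cone outside \<open>L\<close> a positive multiple of some
  \<open>u\<close> in \<open>U\<close> can be split off, so an element spanning a ray is
  proportional to \<open>u\<close>.\<close>

theorem rays_mod_lineality_balanced:
  fixes K V :: "'a::real_vector set" and \<sigma> :: "'i \<Rightarrow> 'a \<Rightarrow> real" and SI GI HI :: "'i set"
  defines "A \<equiv> SI \<union> GI \<union> HI"
  assumes V: "subspace V"
    and add: "\<And>i x y. \<sigma> i (x + y) = \<sigma> i x + \<sigma> i y"
    and scale: "\<And>i c x. \<sigma> i (c *\<^sub>R x) = c * \<sigma> i x"
    and K: "K = {x \<in> V. \<forall>i\<in>A. 0 \<le> \<sigma> i x}"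
    and finite: "finite GI" "finite HI"
    and disjoint: "SI \<inter> GI = {}" "SI \<inter> HI = {}" "GI \<inter> HI = {}"
    and balance: "\<And>x. x \<in> V \<Longrightarrow> (\<Sum>i\<in>GI. \<sigma> i x) = (\<Sum>i\<in>HI. \<sigma> i x)"
    and U: "U \<subseteq> V"
    and U_cases: "\<And>u. u \<in> U \<Longrightarrow> (\<exists>i\<in>SI. \<forall>j\<in>A. \<sigma> j u = (if j = i then 1 else 0)) \<or>
        (\<exists>g\<in>GI. \<exists>h\<in>HI. \<forall>j\<in>A. \<sigma> j u = (if j = g \<or> j = h then 1 else 0))"
    and U_single: "\<And>i. i \<in> SI \<Longrightarrow> \<exists>u\<in>U. \<forall>j\<in>A. \<sigma> j u = (if j = i then 1 else 0)"
    and U_pair: "\<And>g h. g \<in> GI \<Longrightarrow> h \<in> HI \<Longrightarrow> \<exists>u\<in>U. \<forall>j\<in>A. \<sigma> j u = (if j = g \<or> j = h then 1 else 0)"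
  shows "ray_mod (lineality_space K) ` U = rays_mod_lineality K"
proof -
  define L where "L = lineality_space K"
  have neg: "\<sigma> i (- x) = - \<sigma> i x" for i x using scale[of i "-1" x] by simp
  have diff: "\<sigma> i (x - y) = \<sigma> i x - \<sigma> i y" for i x y using add[of i x "- y"] by (simp add: neg)
  have zero: "\<sigma> i 0 = 0" for i using scale[of i 0 0] by simp
  have L: "L = {x \<in> V. \<forall>i\<in>A. \<sigma> i x = 0}"
  proof
    show "L \<subseteq> {x \<in> V. \<forall>i\<in>A. \<sigma> i x = 0}"
      unfolding L_def lineality_space_def K by (force simp: neg intro: antisym)
    show "{x \<in> V. \<forall>i\<in>A. \<sigma> i x = 0} \<subseteq> L"
    proof
      fix x assume x: "x \<in> {x \<in> V. \<forall>i\<in>A. \<sigma> i x = 0}"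
      then have "- x \<in> K" "x \<in> K" using subspace_neg[OF V] by (auto simp: K neg)
      then show "x \<in> L" unfolding L_def lineality_space_def by (auto intro: image_eqI[of _ _ "- x"])
    qed
  qed
  have LS: "subspace L"
    unfolding subspace_def L using V by (auto simp: zero add scale subspace_0 subspace_add subspace_scale)
  have indicator_nonneg: "u \<in> K" if "u \<in> U" for u
    using U_cases[OF that] U that by (auto simp: K)
  have extremal: "\<exists>t\<ge>0. a - t *\<^sub>R u \<in> L"
    if u: "u \<in> U" and a: "a \<in> K" and b: "b \<in> K" and t: "a + b - t *\<^sub>R u \<in> L" for u a b t
  proof -
    have sum: "\<sigma> i a + \<sigma> i b = t * \<sigma> i u" if "i \<in> A" for i
      using t that by (auto simp: L add diff scale)
    have off: "\<sigma> i a = 0" if "i \<in> A" "\<sigma> i u = 0" for i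
      using sum[OF that(1)] that a b by (simp add: K) (smt (verit))
    have "u \<in> V" "a \<in> V" using u U a by (auto simp: K)
    show ?thesis
      using U_cases[OF u]
    proof
      assume "\<exists>i\<in>SI. \<forall>j\<in>A. \<sigma> j u = (if j = i then 1 else 0)"
      then obtain i where i: "i \<in> SI" "\<forall>j\<in>A. \<sigma> j u = (if j = i then 1 else 0)" by blast
      then have "a - \<sigma> i a *\<^sub>R u \<in> L"
        using off \<open>u \<in> V\<close> \<open>a \<in> V\<close> by (auto simp: L diff scale intro!: subspace_diff[OF V] subspace_scale[OF V])
      moreover have "\<sigma> i a \<ge> 0" using a i(1) by (auto simp: K A_def)
      ultimately show ?thesis by blast
    next
      assume "\<exists>g\<in>GI. \<exists>h\<in>HI. \<forall>j\<in>A. \<sigma> j u = (if j = g \<or> j = h then 1 else 0)"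
      then obtain g h where g: "g \<in> GI" and h: "h \<in> HI"
        and gh: "\<forall>j\<in>A. \<sigma> j u = (if j = g \<or> j = h then 1 else 0)" by blast
      have off': "\<sigma> i a = 0" if "i \<in> A" "i \<noteq> g" "i \<noteq> h" for i
        using off[OF that(1)] gh that by auto
      have "g \<notin> HI" "h \<notin> GI" using g h disjoint by blast+
      \<comment> \<open>Each of the two balanced families has a single slack that may survive, at
        \<open>g\<close> and at \<open>h\<close>.\<close>
      have "(\<Sum>i\<in>GI. \<sigma> i a) = (\<Sum>i\<in>GI. if i = g then \<sigma> g a else 0)"
        using \<open>h \<notin> GI\<close> by (intro sum.cong refl) (auto simp: A_def intro!: off')
      moreover have "(\<Sum>i\<in>HI. \<sigma> i a) = (\<Sum>i\<in>HI. if i = h then \<sigma> h a else 0)"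
        using \<open>g \<notin> HI\<close> by (intro sum.cong refl) (auto simp: A_def intro!: off')
      ultimately have eq: "\<sigma> g a = \<sigma> h a"
        using balance[OF \<open>a \<in> V\<close>] finite g h by simp
      have "a - \<sigma> g a *\<^sub>R u \<in> L"
        using off' gh \<open>u \<in> V\<close> \<open>a \<in> V\<close> eq
        by (auto simp: L diff scale intro!: subspace_diff[OF V] subspace_scale[OF V])
      moreover have "\<sigma> g a \<ge> 0" using a g by (auto simp: K A_def)
      ultimately show ?thesis by blast
    qed
  qed
  have nonzero: "u \<notin> L" if "u \<in> U" for u
  proof -
    have "\<exists>j\<in>A. \<sigma> j u = 1" using U_cases[OF that] by (elim disjE bexE) (auto simp: A_def)
    then show ?thesis unfolding L by force
  qed
  have "ray_mod L u \<in> rays_mod_lineality K" if u: "u \<in> U" for u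
    unfolding rays_mod_lineality_def Let_def L_def[symmetric] mem_Collect_eq
  proof (intro bexI[of _ u] conjI refl ballI impI)
    show "u \<in> K - L" using nonzero indicator_nonneg u by blast
    fix a b assume ab: "a \<in> K" "b \<in> K" "mod_class L (a + b) \<in> ray_mod L u"
    then obtain t where t: "a + b - t *\<^sub>R u \<in> L" unfolding mod_class_mem_ray_mod_iff[OF LS] by blast
    show "mod_class L a \<in> ray_mod L u"
      unfolding mod_class_mem_ray_mod_iff[OF LS] using extremal[OF u ab(1,2) t] .
    have "b + a - t *\<^sub>R u \<in> L" using t by (simp add: add.commute)
    from extremal[OF u ab(2,1) this]
    show "mod_class L b \<in> ray_mod L u" unfolding mod_class_mem_ray_mod_iff[OF LS] .
  qed
  moreover have "R \<in> ray_mod L ` U" if "R \<in> rays_mod_lineality K" for R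
  proof -
    from that obtain a where a: "a \<in> K" "a \<notin> L" "R = ray_mod L a" and
      ext: "\<And>b c. b \<in> K \<Longrightarrow> c \<in> K \<Longrightarrow> mod_class L (b + c) \<in> R \<Longrightarrow> mod_class L b \<in> R"
      unfolding rays_mod_lineality_def Let_def L_def[symmetric] by blast
    have V_a: "a \<in> V" using a by (simp add: K)
    have "\<exists>u\<in>U. \<exists>\<tau>>0. a - \<tau> *\<^sub>R u \<in> K"
    proof (cases "\<exists>i\<in>SI. \<sigma> i a > 0")
      case True
      then obtain i where i: "i \<in> SI" "\<sigma> i a > 0" by blast
      from U_single[OF i(1)] obtain u where u: "u \<in> U" "\<forall>j\<in>A. \<sigma> j u = (if j = i then 1 else 0)" by blast
      have "a - \<sigma> i a *\<^sub>R u \<in> K"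
        using a u U V_a by (auto simp: K diff scale intro!: subspace_diff[OF V] subspace_scale[OF V])
      with u i show ?thesis by blast
    next
      case False
      obtain i where "i \<in> A" "\<sigma> i a \<noteq> 0" using a V_a by (auto simp: L)
      moreover have "\<sigma> i a \<ge> 0" using a \<open>i \<in> A\<close> by (simp add: K)
      ultimately have i: "i \<in> GI \<union> HI" "\<sigma> i a > 0" using False by (auto simp: A_def)
      have nonneg: "\<forall>j\<in>GI. \<sigma> j a \<ge> 0" "\<forall>j\<in>HI. \<sigma> j a \<ge> 0" using a by (auto simp: K A_def)
      have "(\<Sum>j\<in>GI. \<sigma> j a) > 0 \<or> (\<Sum>j\<in>HI. \<sigma> j a) > 0"
        using i nonneg finite by (auto intro!: sum_pos2[of _ i])
      \<comment> \<open>By \<open>balance\<close>, a positive slack in one family forces one in the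
        other, so that there is a pair to split off.\<close>
      then have "(\<Sum>j\<in>GI. \<sigma> j a) > 0" "(\<Sum>j\<in>HI. \<sigma> j a) > 0" using balance[OF V_a] by auto
      then obtain g h where gh: "g \<in> GI" "\<sigma> g a > 0" "h \<in> HI" "\<sigma> h a > 0"
        by (metis not_le sum_nonpos)
      from U_pair[OF gh(1,3)] obtain u where u: "u \<in> U" "\<forall>j\<in>A. \<sigma> j u = (if j = g \<or> j = h then 1 else 0)" by blast
      \<comment> \<open>The smaller of the two slacks is the largest multiple that leaves both
        nonnegative.\<close>
      have "a - min (\<sigma> g a) (\<sigma> h a) *\<^sub>R u \<in> K"
        using a u U V_a gh by (auto simp: K diff scale intro!: subspace_diff[OF V] subspace_scale[OF V])
      with u gh show ?thesis by (intro bexI[of _ u] exI[of _ "min (\<sigma> g a) (\<sigma> h a)"]) auto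
    qed
    then obtain u \<tau> where u: "u \<in> U" "\<tau> > 0" "a - \<tau> *\<^sub>R u \<in> K" by blast
    have uK: "\<tau> *\<^sub>R u \<in> K"
      using indicator_nonneg[OF u(1)] u(2) V by (auto simp: K scale subspace_scale)
    have "mod_class L (\<tau> *\<^sub>R u + (a - \<tau> *\<^sub>R u)) \<in> R"
      unfolding a(3) mod_class_mem_ray_mod_iff[OF LS]
      using subspace_0[OF LS] by (intro exI[of _ 1]) simp
    from ext[OF uK u(3) this] obtain t where t: "t \<ge> 0" "\<tau> *\<^sub>R u - t *\<^sub>R a \<in> L"
      unfolding a(3) mod_class_mem_ray_mod_iff[OF LS] by blast
    have "inverse \<tau> *\<^sub>R (\<tau> *\<^sub>R u - t *\<^sub>R a) \<in> L" using subspace_scale[OF LS t(2)] .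
    then have d: "u - (inverse \<tau> * t) *\<^sub>R a \<in> L" using u(2) by (simp add: algebra_simps)
    have "t \<noteq> 0" using d nonzero[OF u(1)] by auto
    then have "ray_mod L u = ray_mod L a" using d t(1) u(2) by (intro ray_mod_eqI[OF LS]) auto
    then show ?thesis using a(3) u(1) by auto
  qed
  ultimately show ?thesis unfolding L_def by blast
qed

section \<open>Consequences of the facet inequalities\<close>

text \<open>The period is \<open>n\<close>, not \<open>2 n\<close>, because antipodal chords carry
  the same variable. Since \<open>D a (a + n)\<close> adds both colors, the case
  \<open>c = a + n - 1\<close> of \<open>square\<close> reflects the exchange relation that contains
  both colors of one diameter.\<close>

locale strict_weight =
  fixes n :: int and D :: "int \<Rightarrow> int \<Rightarrow> real" and \<beta> \<rho> :: "int \<Rightarrow> real"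
  assumes n: "2 \<le> n"
    and D_shift: "D (a + n) (c + n) = D a c"
    and \<beta>_shift: "\<beta> (a + n) = \<beta> a" and \<rho>_shift: "\<rho> (a + n) = \<rho> a"
    and D_diameter: "D a (a + n) = \<beta> a + \<rho> a"
    and square: "a + 2 \<le> c \<Longrightarrow> c < a + n \<Longrightarrow> D a (c + 1) + D (a + 1) c < D a c + D (a + 1) (c + 1)"
    and blue_red: "D (a + 1) (a + n) < \<beta> a + \<rho> (a + 1)"
    and red_blue: "D (a + 1) (a + n) < \<rho> a + \<beta> (a + 1)"
begin

lemma quad_row:
  assumes "a + 2 \<le> c" "c < d" "d \<le> a + n"
  shows "D a d + D (a + 1) c < D a c + D (a + 1) d"
  using assms(2) assms(3)
proof (induction d rule: int_gr_induct)
  case base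
  then show ?case using square[of a c] assms by simp
next
  case (step d)
  then show ?case using square[of a d] assms by simp
qed

text \<open>The inequalities \<open>square\<close> telescope over all \<open>(i, j)\<close> with
  \<open>a \<le> i\<close>, \<open>i < b\<close>, \<open>c \<le> j\<close>, \<open>j < d\<close>;
  \<open>quad_row\<close> sums one row.\<close>

lemma quad_crossing:
  assumes "a < b" "b < c" "c < d" "d \<le> a + n"
  shows "D a d + D b c < D a c + D b d"
  using assms(1) assms(2)
proof (induction b rule: int_gr_induct)
  case base
  then show ?case using quad_row[of a c d] assms by simp
next
  case (step b)
  then show ?case using quad_row[of b c d] assms by simp
qed

text \<open>This is \<open>quad_crossing\<close> for \<open>c - n\<close>, \<open>a\<close>,
  \<open>b\<close>, \<open>c\<close>, where \<open>[c - n, c]\<close> is a diameter; it degenerates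
  to an equality for \<open>a = c - n\<close>.\<close>

lemma right_end:
  assumes "a < b" "b < c" "c \<le> a + n"
  shows "\<beta> c + \<rho> c - D c (b + n) \<le> D a c - D a b"
proof (cases "c = a + n")
  case True
  then show ?thesis using D_diameter[of a] D_shift[of a b] \<beta>_shift[of a] \<rho>_shift[of a] by simp
next
  case False
  then show ?thesis
    using quad_crossing[of "c - n" a b c] D_diameter[of "c - n"] \<beta>_shift[of "c - n"] \<rho>_shift[of "c - n"]
      D_shift[of "c - n" b] assms by simp
qed

lemma left_end:
  assumes "b < c" "c < d" "d \<le> b + n"
  shows "\<beta> b + \<rho> b - D c (b + n) \<le> D b d - D c d"
  using assms D_diameter[of b] quad_crossing[of b c d "b + n"] by (cases "d = b + n") auto

text \<open>In the induction step \<open>blue_red\<close> at \<open>c\<close> is added to the bound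
  for \<open>c\<close>, and \<open>left_end\<close> supplies exactly the
  \<open>\<beta> c + \<rho> c\<close> that has to cancel.\<close>

lemma blue_red_far:
  assumes "a < c" "c < a + n"
  shows "D c (a + n) < \<beta> a + \<rho> c"
  using assms
proof (induction c rule: int_gr_induct)
  case base
  then show ?case using blue_red[of a] by simp
next
  case (step c)
  then show ?case using left_end[of c "c + 1" "a + n"] blue_red[of c] by simp
qed

text \<open>All hypotheses are symmetric in the two colors, so a mixed bound has to be proved for
  one coloring only.\<close>

lemma swap: "strict_weight n D \<rho> \<beta>"
  by unfold_locales
    (use n D_shift \<beta>_shift \<rho>_shift D_diameter square blue_red red_blue in \<open>auto simp: add.commute\<close>)

lemmas red_blue_far = strict_weight.blue_red_far[OF swap]

lemma blue_red_near:
  assumes "a < c" "c < a + n"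
  shows "D a c < \<beta> a + \<rho> c"
  using red_blue_far[of c "a + n"] assms D_shift[of a c] \<beta>_shift[of a] by simp

text \<open>The sum of \<open>right_end\<close> and \<open>left_end\<close> compares twice
  \<open>D c (b + n)\<close> with both colors of the diameters at \<open>b\<close> and
  \<open>c\<close>; the two colorings of \<open>blue_red_far\<close> account for one copy
  each.\<close>

lemma quad_parallel:
  assumes "a < b" "b < c" "c < d" "c \<le> a + n" "d \<le> b + n"
  shows "D a b + D c d < D a c + D b d"
  using right_end[of a b c] left_end[of b c d] blue_red_far[of b c] red_blue_far[of b c] assms by simp

lemma diameter_crossing:
  assumes "c < a" "a < b" "b < c + n"
  shows "D a b + \<beta> c < \<beta> a + D c b" "D c a + \<beta> b < \<beta> a + D c b"
  using left_end[of c a b] right_end[of c a b] red_blue_far[of c a] blue_red_far[of a b] assms by simp_all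

text \<open>These chords cross twice up to antipodes and are not exchanged by a single relation. The
  left sides are the monomials obtained by resolving both crossings; the first three bounds pass
  through a product in which one crossing has been resolved.\<close>

lemma double_crossing:
  assumes "a < b" "b < c" "c < d" "d < a + n"
  shows "D b c + D d (a + n) < D a d + D c (b + n)"
    and "D a b + D d (c + n) < D a d + D c (b + n)"
    and "D c d + D b (a + n) < D a d + D c (b + n)"
    and "D a b + D c d < D a d + D c (b + n)"
proof -
  have cross: "D a c + D d (b + n) < D a d + D c (b + n)"
    using quad_parallel[of a c d "b + n"] assms by simp
  have shift: "D (d - n) a = D d (a + n)" "D (d - n) b = D d (b + n)" "D (d - n) c = D d (c + n)"
    using D_shift[of "d - n"] by (metis diff_add_cancel)+
  show "D b c + D d (a + n) < D a d + D c (b + n)"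
    using quad_parallel[of "d - n" a b c] cross assms by (simp add: shift)
  show "D a b + D d (c + n) < D a d + D c (b + n)"
    using quad_crossing[of "d - n" a b c] cross assms by (simp add: shift)
  have cross': "D c (a + n) + D b d < D a d + D c (b + n)"
    using quad_parallel[of c "a + n" "b + n" "d + n"] D_shift[of a d] D_shift[of b d] assms by simp
  show "D c d + D b (a + n) < D a d + D c (b + n)"
    using quad_crossing[of b c d "a + n"] cross' assms by simp
  show "D a b + D c d < D a d + D c (b + n)"
    using right_end[of a b d] left_end[of b c "b + n"] blue_red_far[of b d] blue_red_near[of b d]
      left_end[of b c d] red_blue_far[of b d] quad_crossing[of b c d "b + n"] D_diameter[of b] assms by simp
qed

end

section \<open>Chords and labels\<close>

lemma mult_bounded_eq_0:
  fixes M t :: int assumes "\<bar>M * t\<bar> < M" shows "t = 0"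
proof (rule ccontr)
  assume "t \<noteq> 0"
  then have "1 \<le> \<bar>t\<bar>" by simp
  have "0 < M" using assms by linarith
  then have "M * 1 \<le> M * \<bar>t\<bar>" using \<open>1 \<le> \<bar>t\<bar>\<close> by (intro mult_left_mono) auto
  then show False using assms \<open>0 < M\<close> by (simp add: abs_mult)
qed

lemma vertex_eq_iff: "vertex n i = vertex n j \<longleftrightarrow> (\<exists>k. i = j + 2 * int n * k)"
  unfolding vertex_def mod_eq_dvd_iff dvd_def by (simp add: algebra_simps)

lemma vertex_shift [simp]: "vertex n (i + 2 * int n) = vertex n i"
  by (simp add: vertex_def)

lemma chord_commute: "chord n i j = chord n j i"
  by (auto simp: chord_def)

lemma chord_shift_right: "chord n i (j + 2 * int n) = chord n i j"
  and chord_shift_left: "chord n (i + 2 * int n) j = chord n i j"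
  by (auto simp: chord_def)

lemma vertex_vertex_add: "vertex n (vertex n i + j) = vertex n (i + j)"
  by (simp add: vertex_def mod_add_left_eq)

lemma antipode_chord: "antipode n (chord n i j) = chord n (i + int n) (j + int n)"
  by (auto simp: antipode_def chord_def vertex_vertex_add)

lemma chord_double_shift: "chord n (i + int n + int n) (j + int n + int n) = chord n i j"
  using chord_shift_right[of n "i + 2 * int n" j] chord_shift_left[of n i j] by (simp only: add.assoc mult_2)

text \<open>An unordered pair of vertices has two families of integer lifts, one for each arc
  between them; passing to the other arc exchanges the ends and adds a full turn to one of
  them.\<close>

lemma chord_eqE:
  assumes eq: "chord n a c = chord n a' c'"
    and ac: "a < c" "c < a + 2 * int n" and ac': "a' < c'" "c' < a' + 2 * int n"
  obtains k where "a' = a + 2 * int n * k" "c' = c + 2 * int n * k"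
  | k where "a' = c + 2 * int n * k" "c' = a + 2 * int n + 2 * int n * k"
proof -
  from eq have "vertex n a' = vertex n a \<and> vertex n c' = vertex n c \<or>
      vertex n a' = vertex n c \<and> vertex n c' = vertex n a"
    unfolding chord_def doubleton_eq_iff by auto
  then show thesis
  proof
    assume "vertex n a' = vertex n a \<and> vertex n c' = vertex n c"
    then obtain k l where kl: "a' = a + 2 * int n * k" "c' = c + 2 * int n * l"
      unfolding vertex_eq_iff by blast
    then have "\<bar>2 * int n * (l - k)\<bar> < 2 * int n" using ac ac' by (simp add: algebra_simps)
    then have "l = k" using mult_bounded_eq_0 by fastforce
    with kl that(1) show thesis by blast
  next
    assume "vertex n a' = vertex n c \<and> vertex n c' = vertex n a"
    then obtain k l where kl: "a' = c + 2 * int n * k" "c' = a + 2 * int n * l"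
      unfolding vertex_eq_iff by blast
    then have "\<bar>2 * int n * (l - (k + 1))\<bar> < 2 * int n" using ac ac' by (simp add: algebra_simps)
    then have "l = k + 1" using mult_bounded_eq_0 by fastforce
    with kl that(2)[of k] show thesis by (simp add: algebra_simps)
  qed
qed

text \<open>Both lifts follow arcs shorter than a half turn, which rules out the complementary
  arc.\<close>

lemma chord_eq_iff_minor:
  assumes ac: "a < c" "c < a + int n" and ac': "a' < c'" "c' < a' + int n"
  shows "chord n a c = chord n a' c' \<longleftrightarrow> (\<exists>k. a' = a + 2 * int n * k \<and> c' = c + 2 * int n * k)"
proof
  assume "chord n a c = chord n a' c'"
  then show "\<exists>k. a' = a + 2 * int n * k \<and> c' = c + 2 * int n * k"
    by (rule chord_eqE) (use assms in auto)
next
  assume "\<exists>k. a' = a + 2 * int n * k \<and> c' = c + 2 * int n * k"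
  then have "vertex n a' = vertex n a" "vertex n c' = vertex n c" unfolding vertex_eq_iff by blast+
  then show "chord n a c = chord n a' c'" by (simp add: chord_def)
qed

lemma lab_commute: "lab n a c = lab n c a"
  by (simp add: chord_commute)

lemma lab_shift: "lab n (a + int n) (c + int n) = lab n a c"
proof (cases "chord n (a + int n) (c + int n) = chord n a c")
  case True
  then show ?thesis by simp
next
  case False
  then have "chord n a c \<noteq> chord n (a + int n) (c + int n)" by (rule not_sym)
  with False show ?thesis
    unfolding chord_label_def antipode_chord chord_double_shift by (simp only: if_False insert_commute)
qed

lemma lab_shift_right: "lab n a (c + int n + int n) = lab n a c"
  using chord_shift_right[of n a c] by (simp only: add.assoc mult_2)

lemma diameter_shift: "chord n (a + int n) (a + int n + int n) = chord n a (a + int n)"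
proof -
  have "vertex n (a + int n + int n) = vertex n a"
    using vertex_shift[of n a] by (simp only: add.assoc mult_2)
  then show ?thesis by (simp add: chord_def insert_commute)
qed

lemma blue_shift: "blue n (a + int n) = blue n a"
  and red_shift: "red n (a + int n) = red n a"
  by (simp_all only: diameter_shift)

lemma shift_multiple:
  fixes f :: "int \<Rightarrow> 'a" and n k :: int
  assumes "\<And>a. f (a + n) = f a" shows "f (a + n * k) = f a"
proof (induction k rule: int_induct[of _ 0])
  case (step1 i)
  then show ?case using assms[of "a + n * i"] by (simp add: algebra_simps)
next
  case (step2 i)
  then show ?case using assms[of "a + n * (i - 1)"] by (simp add: algebra_simps)
qed simp

lemma shift_multiple2:
  fixes f :: "int \<Rightarrow> int \<Rightarrow> 'a" and n k :: int
  assumes "\<And>a c. f (a + n) (c + n) = f a c" shows "f (a + n * k) (c + n * k) = f a c"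
proof -
  have "(\<lambda>t. f (a + t) (c + t)) (0 + n * k) = (\<lambda>t. f (a + t) (c + t)) 0"
    by (rule shift_multiple) (use assms[of "a + t" "c + t" for t] in \<open>simp add: algebra_simps\<close>)
  then show ?thesis by simp
qed

lemma lab_diameter: "lab n a (a + int n) = blue n a"
  unfolding chord_label_def antipode_chord diameter_shift by (rule if_P) (rule refl)

text \<open>If the half turn fixed the chord, then \<open>n * (1 + 2 * k) = 0\<close>, which parity
  excludes.\<close>

lemma lab_minor:
  assumes "a < c" "c < a + int n"
  shows "lab n a c = Sym {chord n a c, chord n (a + int n) (c + int n)}"
proof -
  have "chord n (a + int n) (c + int n) \<noteq> chord n a c"
  proof
    assume eq: "chord n (a + int n) (c + int n) = chord n a c"
    have "a + int n < c + int n" "c + int n < a + int n + int n" using assms by simp_all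
    from chord_eq_iff_minor[OF this assms] eq obtain k where "a = a + int n + 2 * int n * k" by blast
    then have "int n * (1 + 2 * k) = 0" by (simp add: algebra_simps)
    moreover have "int n \<noteq> 0" using assms by linarith
    moreover have "1 + 2 * k \<noteq> 0" by presburger
    ultimately show False by simp
  qed
  then show ?thesis by (simp add: chord_label_def antipode_chord)
qed

lemma lab_minor_neq:
  assumes "a < c" "c < a + int n"
  shows "lab n a c \<noteq> Blue d" "Blue d \<noteq> lab n a c" "lab n a c \<noteq> Red d" "Red d \<noteq> lab n a c"
  using assms by (simp_all add: lab_minor)

lemma chord_diameter_eq_iff:
  assumes "0 < n"
  shows "chord n a (a + int n) = chord n b (b + int n) \<longleftrightarrow> (\<exists>k. b = a + int n * k)"
proof
  assume "chord n a (a + int n) = chord n b (b + int n)"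
  then show "\<exists>k. b = a + int n * k"
  proof (rule chord_eqE)
    fix k assume "b = a + 2 * int n * k"
    then show ?thesis by (intro exI[of _ "2 * k"]) simp
  next
    fix k assume "b = a + int n + 2 * int n * k"
    then show ?thesis by (intro exI[of _ "2 * k + 1"]) (simp add: algebra_simps)
  qed (use assms in auto)
next
  assume "\<exists>k. b = a + int n * k"
  then obtain k where "b = a + int n * k" by blast
  then show "chord n a (a + int n) = chord n b (b + int n)"
    using shift_multiple[of "blue n" "int n" a k, OF blue_shift] by simp
qed

text \<open>Translation by an even multiple of \<open>n\<close> fixes a chord, by an odd multiple it
  gives the antipode, which has the same label.\<close>

lemma lab_eq_iff_minor:
  assumes ac: "a < c" "c < a + int n" and ac': "a' < c'" "c' < a' + int n"
  shows "lab n a c = lab n a' c' \<longleftrightarrow> (\<exists>k. a' = a + int n * k \<and> c' = c + int n * k)"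
proof
  assume "lab n a c = lab n a' c'"
  then have "chord n a' c' \<in> {chord n a c, chord n (a + int n) (c + int n)}"
    using assms by (auto simp: lab_minor)
  then consider "chord n a c = chord n a' c'" | "chord n (a + int n) (c + int n) = chord n a' c'" by auto
  then show "\<exists>k. a' = a + int n * k \<and> c' = c + int n * k"
  proof cases
    case 1
    then obtain k where "a' = a + 2 * int n * k" "c' = c + 2 * int n * k"
      using assms by (auto simp: chord_eq_iff_minor)
    then show ?thesis by (intro exI[of _ "2 * k"]) simp
  next
    case 2
    then obtain k where "a' = a + int n + 2 * int n * k" "c' = c + int n + 2 * int n * k"
      using assms by (subst (asm) chord_eq_iff_minor) auto
    then show ?thesis by (intro exI[of _ "2 * k + 1"]) (simp add: algebra_simps)
  qed
next
  assume "\<exists>k. a' = a + int n * k \<and> c' = c + int n * k"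
  then show "lab n a c = lab n a' c'" using shift_multiple2[of "lab n", OF lab_shift] by auto
qed

lemma chord_crossing_commute: "chord_crossing n c d \<Longrightarrow> chord_crossing n d c"
proof -
  assume "chord_crossing n c d"
  then obtain i p j q where ij: "i < p" "p < j" "j < q" "q < i + 2 * int n"
    and c: "c = chord n i j" and d: "d = chord n p q"
    unfolding chord_crossing_def by blast
  have "c = chord n j (i + 2 * int n)" using c by (simp add: chord_shift_right chord_commute)
  then show "chord_crossing n d c"
    unfolding chord_crossing_def using ij d
    by (intro exI[of _ p] exI[of _ j] exI[of _ q] exI[of _ "i + 2 * int n"]) auto
qed

lemma label_crossing_commute: "label_crossing n k l \<Longrightarrow> label_crossing n l k"
  by (cases k; cases l) (auto dest: chord_crossing_commute)

lemma label_crossing_labI: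
  assumes "a < b" "b < c" "c < d" "d < a + 2 * int n" "c < a + int n" "d < b + int n"
  shows "label_crossing n (lab n a c) (lab n b d)"
proof -
  have "chord_crossing n (chord n a c) (chord n b d)"
    unfolding chord_crossing_def using assms by blast
  then show ?thesis using assms by (simp add: lab_minor)
qed

lemma label_crossing_diameterI:
  assumes "a < e" "e < c" "c < a + int n"
  shows "label_crossing n (blue n e) (lab n a c)" "label_crossing n (red n e) (lab n a c)"
proof -
  have "chord_crossing n (chord n a c) (chord n e (e + int n))"
    unfolding chord_crossing_def
    by (rule exI[of _ a], rule exI[of _ e], rule exI[of _ c], rule exI[of _ "e + int n"]) (use assms in auto)
  then have "chord_crossing n (chord n e (e + int n)) (chord n a c)" by (rule chord_crossing_commute)
  then show "label_crossing n (blue n e) (lab n a c)" "label_crossing n (red n e) (lab n a c)"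
    using assms by (simp_all add: lab_minor)
qed

text \<open>The lifts witnessing a crossing may run along the longer arcs. Replacing such a lift by
  the complementary one keeps the ends interleaved but may exchange the roles of the two chords,
  hence the two outcomes.\<close>

lemma label_crossing_lab_labE:
  assumes cross: "label_crossing n (lab n a c) (lab n b d)"
    and ac: "a < c" "c < a + int n" and bd: "b < d" "d < b + int n"
  obtains p q r s where "p < q" "q < r" "r < s" "r < p + int n" "s < q + int n"
    "lab n a c = lab n p r" "lab n b d = lab n q s"
  | p q r s where "p < q" "q < r" "r < s" "r < p + int n" "s < q + int n"
    "lab n b d = lab n p r" "lab n a c = lab n q s"
proof -
  have mem: "lab n i j = lab n a c"
    if "chord n i j \<in> {chord n a c, chord n (a + int n) (c + int n)}" for i j a c
    using that lab_shift[of n a c] by auto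
  from cross obtain i p j q where ij: "i < p" "p < j" "j < q" "q < i + 2 * int n"
    and "chord n i j \<in> {chord n a c, chord n (a + int n) (c + int n)}"
      "chord n p q \<in> {chord n b d, chord n (b + int n) (d + int n)}"
    unfolding lab_minor[OF ac] lab_minor[OF bd] by (auto simp: chord_crossing_def)
  then have lij: "lab n i j = lab n a c" and lpq: "lab n p q = lab n b d" using mem by blast+
  have "j - i \<noteq> int n"
  proof
    assume "j - i = int n"
    then have "j = i + int n" by simp
    with lij show False using ac by (simp add: lab_diameter lab_minor del: chord_label_def)
  qed
  moreover have "q - p \<noteq> int n"
  proof
    assume "q - p = int n"
    then have "q = p + int n" by simp
    with lpq show False using bd by (simp add: lab_diameter lab_minor)
  qed
  moreover have ij': "lab n j (i + 2 * int n) = lab n a c" "lab n q (p + 2 * int n) = lab n b d"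
     "lab n (q - 2 * int n) p = lab n b d"
    using lij lpq chord_shift_left[of n "q - 2 * int n" p] by (simp_all add: chord_shift_right chord_commute)
  ultimately consider "j - i < int n" "q - p < int n" | "j - i < int n" "int n < q - p"
    | "int n < j - i" "q - p < int n" | "int n < j - i" "int n < q - p" by linarith
  then show thesis
  proof cases
    case 1 then show thesis using that(1)[of i p j q] ij lij lpq by auto
  next
    case 2 then show thesis using that(2)[of "q - 2 * int n" i p j] ij lij ij' by auto
  next
    case 3 then show thesis using that(2)[of p j q "i + 2 * int n"] ij lpq ij' by auto
  next
    case 4 then show thesis using that(1)[of j q "i + 2 * int n" "p + 2 * int n"] ij ij' by auto
  qed
qed

text \<open>The minor arc of the chord contains one of the two ends of the diameter, and these
  differ by \<open>n\<close>; \<open>k\<close> records which lift of \<open>e\<close> it is.\<close>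

lemma chord_crossing_diameterE:
  assumes cross: "chord_crossing n (chord n e (e + int n)) (chord n b d)"
    and bd: "b < d" "d < b + int n"
  obtains p f q k where "p < f" "f < q" "q < p + int n" "f = e + int n * k" "lab n b d = lab n p q"
proof -
  from cross obtain i p j q where ij: "i < p" "p < j" "j < q" "q < i + 2 * int n"
    and dia: "chord n e (e + int n) = chord n i j" and lpq: "chord n b d = chord n p q"
    unfolding chord_crossing_def by auto
  have n: "0 < n" using bd by linarith
  have j: "j = i + int n \<and> (\<exists>k. i = e + int n * k)"
    using dia
  proof (rule chord_eqE)
    fix k assume "i = e + 2 * int n * k" "j = e + int n + 2 * int n * k"
    then show ?thesis by (intro conjI exI[of _ "2 * k"]) simp_all
  next
    fix k assume "i = e + int n + 2 * int n * k" "j = e + 2 * int n + 2 * int n * k"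
    then show ?thesis by (intro conjI exI[of _ "2 * k + 1"]) (simp_all add: algebra_simps)
  qed (use ij n in auto)
  then obtain k where k: "i = e + int n * k" by blast
  then have k': "j = e + int n * (k + 1)" using j by (simp add: algebra_simps)
  have "q - p \<noteq> int n"
  proof
    assume "q - p = int n"
    then have "q = p + int n" by simp
    with lpq show False using lab_minor[OF bd] by (simp add: lab_diameter)
  qed
  moreover have "lab n b d = lab n (q - 2 * int n) p"
    using lpq chord_shift_left[of n "q - 2 * int n" p] by (simp add: chord_commute)
  ultimately show thesis
    using that[of p j q "k + 1"] that[of "q - 2 * int n" i p k] ij j k k' lpq by (cases "q - p < int n") auto
qed

section \<open>Canonical representatives\<close>

text \<open>Labels are sets with many integer lifts; a member of \<open>sides n\<close> is the lift
  whose left end lies in \<open>{0..<int n}\<close>, while its right end may pass \<open>n\<close>.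
  The same names later index the facet inequalities.\<close>

datatype side = Chord int int | BlueDiam int | RedDiam int

fun label_of :: "nat \<Rightarrow> side \<Rightarrow> label" where
  "label_of n (Chord a c) = lab n a c"
| "label_of n (BlueDiam a) = blue n a"
| "label_of n (RedDiam a) = red n a"

definition sides :: "nat \<Rightarrow> side set" where
  "sides n = {Chord a c | a c. 0 \<le> a \<and> a < int n \<and> a < c \<and> c < a + int n}
     \<union> BlueDiam ` {0..<int n} \<union> RedDiam ` {0..<int n}"

lemma finite_sides: "finite (sides n)"
proof -
  have "{Chord a c | a c. 0 \<le> a \<and> a < int n \<and> a < c \<and> c < a + int n}
      \<subseteq> (\<lambda>(a, c). Chord a c) ` ({0..<int n} \<times> {0..<2 * int n})" by force
  then have "finite {Chord a c | a c. 0 \<le> a \<and> a < int n \<and> a < c \<and> c < a + int n}"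
    by (rule finite_subset) simp
  then show ?thesis by (simp add: sides_def)
qed

lemma residue_unique:
  fixes a b n :: int
  assumes "0 \<le> a + n * k" "a + n * k < n" "0 \<le> a" "a < n" shows "k = 0"
  by (rule mult_bounded_eq_0[of n]) (use assms in auto)

lemma inj_on_label_of: "inj_on (label_of n) (sides n)"
proof
  fix s t assume st: "s \<in> sides n" "t \<in> sides n" "label_of n s = label_of n t"
  have n: "0 < n" using st(1) by (auto simp: sides_def)
  have lab: "a = a' \<and> c = c'"
    if "lab n a c = lab n a' c'" "0 \<le> a" "a < int n" "0 \<le> a'" "a' < int n"
      "a < c" "c < a + int n" "a' < c'" "c' < a' + int n" for a c a' c'
  proof -
    from that obtain k where k: "a' = a + int n * k" "c' = c + int n * k" by (auto simp: lab_eq_iff_minor)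
    then have "k = 0" using that by (intro residue_unique[of a "int n" k]) auto
    with k show ?thesis by simp
  qed
  have diameter: "a = b" if "chord n a (a + int n) = chord n b (b + int n)"
    "0 \<le> a" "a < int n" "0 \<le> b" "b < int n" for a b
  proof -
    from that n obtain k where k: "b = a + int n * k" by (auto simp: chord_diameter_eq_iff)
    then have "k = 0" using that by (intro residue_unique[of a "int n" k]) auto
    with k show ?thesis by simp
  qed
  show "s = t"
    using st unfolding sides_def by (elim UnE) (auto simp: lab_minor_neq dest: lab diameter)
qed

lemma canonical_residue:
  fixes a n :: int assumes "0 < n"
  obtains k where "0 \<le> a + n * k" "a + n * k < n"
proof
  show "0 \<le> a + n * (- (a div n))" "a + n * (- (a div n)) < n"
    using assms pos_mod_sign[of n a] pos_mod_bound[of n a] by (simp_all add: minus_mult_div_eq_mod)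
qed

lemma lab_minor_mem:
  assumes "a < c" "c < a + int n" shows "lab n a c \<in> label_of n ` sides n"
proof -
  have "0 < int n" using assms by linarith
  then obtain k where k: "0 \<le> a + int n * k" "a + int n * k < int n" by (rule canonical_residue)
  have "lab n a c = label_of n (Chord (a + int n * k) (c + int n * k))"
    using shift_multiple2[of "lab n", OF lab_shift] by simp
  moreover have "Chord (a + int n * k) (c + int n * k) \<in> sides n" using k assms by (auto simp: sides_def)
  ultimately show ?thesis by blast
qed

lemma blue_mem: "0 < n \<Longrightarrow> blue n a \<in> label_of n ` sides n"
  and red_mem: "0 < n \<Longrightarrow> red n a \<in> label_of n ` sides n"
proof -
  assume "0 < n"
  then have "0 < int n" by simp
  then obtain k where k: "0 \<le> a + int n * k" "a + int n * k < int n" by (rule canonical_residue)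
  have "blue n a = label_of n (BlueDiam (a + int n * k))" "red n a = label_of n (RedDiam (a + int n * k))"
    using shift_multiple[of "blue n", OF blue_shift] shift_multiple[of "red n", OF red_shift] by simp_all
  moreover have "BlueDiam (a + int n * k) \<in> sides n" "RedDiam (a + int n * k) \<in> sides n"
    using k by (auto simp: sides_def)
  ultimately show "blue n a \<in> label_of n ` sides n" "red n a \<in> label_of n ` sides n" by blast+
qed

lemma chord_representative:
  assumes "0 < n" "vertex n i \<noteq> vertex n j"
  obtains a c where "chord n i j = chord n a c" "a < c" "c \<le> a + int n"
proof -
  define t where "t = (j - i) mod (2 * int n)"
  have t: "0 \<le> t" "t < 2 * int n" using assms by (simp_all add: t_def)
  have vt: "vertex n (i + t) = vertex n j" by (simp add: t_def vertex_def mod_add_right_eq)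
  have "t \<noteq> 0" using vt assms by auto
  show thesis
  proof (cases "t \<le> int n")
    case True
    with \<open>t \<noteq> 0\<close> t vt show thesis by (intro that[of i "i + t"]) (auto simp: chord_def)
  next
    case False
    have "chord n i j = chord n (i + t) (i + 2 * int n)" using vt by (auto simp: chord_def)
    with False t show thesis by (intro that[of "i + t" "i + 2 * int n"]) auto
  qed
qed

lemma chord_not_edge:
  assumes "2 \<le> n" "a + 2 \<le> c" "c \<le> a + int n"
  shows "chord n a c \<in> diagonals n"
proof -
  have "vertex n a \<noteq> vertex n c"
  proof
    assume "vertex n a = vertex n c"
    then obtain k where k: "a = c + 2 * int n * k" unfolding vertex_eq_iff by blast
    then have "\<bar>2 * int n * k\<bar> < 2 * int n" using assms by simp
    then have "k = 0" by (rule mult_bounded_eq_0)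
    with k assms show False by simp
  qed
  moreover have "chord n a c \<noteq> chord n i (i + 1)" for i
  proof
    assume "chord n a c = chord n i (i + 1)"
    then show False by (rule chord_eqE) (use assms in auto)
  qed
  ultimately show ?thesis by (auto simp: diagonals_def chords_def edges_def)
qed

lemma diagonal_labels_eq:
  assumes n: "2 \<le> n"
  shows "diagonal_labels n =
     {lab n a c | a c. a + 2 \<le> c \<and> c < a + int n} \<union> range (blue n) \<union> range (red n)"
proof -
  have "l \<in> {lab n a c | a c. a + 2 \<le> c \<and> c < a + int n} \<union> range (blue n)"
    if l: "l \<in> chord_label n ` diagonals n" for l
  proof -
    from l obtain i j where ij: "l = lab n i j" "vertex n i \<noteq> vertex n j" "chord n i j \<notin> edges n"
      by (auto simp: diagonals_def chords_def)
    obtain a c where ac: "chord n i j = chord n a c" "a < c" "c \<le> a + int n"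
      using chord_representative[of n i j] ij(2) n by auto
    have "c \<noteq> a + 1" using ij(3) ac(1) by (auto simp: edges_def)
    then have "a + 2 \<le> c" "l = lab n a c" using ac ij(1) by auto
    show ?thesis
    proof (cases "c = a + int n")
      case True
      with \<open>l = lab n a c\<close> lab_diameter[of n a] show ?thesis by blast
    next
      case False
      with ac(3) have "c < a + int n" by simp
      with \<open>a + 2 \<le> c\<close> \<open>l = lab n a c\<close> show ?thesis by blast
    qed
  qed
  moreover have "lab n a c \<in> chord_label n ` diagonals n" if "a + 2 \<le> c" "c < a + int n" for a c
    using chord_not_edge[OF n that(1)] that(2) by auto
  moreover have "blue n a \<in> chord_label n ` diagonals n" for a
    using chord_not_edge[OF n, of a "a + int n"] n lab_diameter[of n a, symmetric] by (intro image_eqI) auto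
  ultimately show ?thesis unfolding diagonal_labels_def by blast
qed

lemma edge_labels_eq: "edge_labels n = range (\<lambda>i. lab n i (i + 1))"
  by (auto simp: edge_labels_def edges_def)

lemma labels_eq:
  assumes n: "2 \<le> n" shows "diagonal_labels n \<union> edge_labels n = label_of n ` sides n"
proof
  show "diagonal_labels n \<union> edge_labels n \<subseteq> label_of n ` sides n"
    using n blue_mem red_mem by (auto simp: diagonal_labels_eq edge_labels_eq intro!: lab_minor_mem)
  have "label_of n s \<in> diagonal_labels n \<union> edge_labels n" if s: "s \<in> sides n" for s
  proof (cases s)
    case (Chord a c)
    then have "a + 2 \<le> c \<and> c < a + int n \<or> c = a + 1" using s by (auto simp: sides_def)
    then show ?thesis using n Chord by (auto simp: diagonal_labels_eq edge_labels_eq)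
  qed (use n in \<open>auto simp: diagonal_labels_eq\<close>)
  then show "label_of n ` sides n \<subseteq> diagonal_labels n \<union> edge_labels n" by blast
qed

lemma finite_diagonal_labels:
  assumes "2 \<le> n" shows "finite (diagonal_labels n)"
  by (rule finite_subset[OF _ finite_imageI[OF finite_sides]]) (use labels_eq[OF assms] in blast)

section \<open>Coordinates of the vectors\<close>

lemma vertex_eq_self: "0 \<le> i \<Longrightarrow> i < 2 * int n \<Longrightarrow> vertex n i = i"
  by (simp add: vertex_def)

lemma minor_arc_eq:
  assumes "p < q" "q < p + int n" shows "minor_arc n p q = vertex n ` {p..q}"
proof -
  have q: "vertex n (q - p) = q - p" using assms by (intro vertex_eq_self) auto
  have "vertex n (p - q) = vertex n (p - q + 2 * int n)" by simp
  also have "\<dots> = p - q + 2 * int n" using assms by (intro vertex_eq_self) auto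
  finally have "minor_arc n p q = arc n p q" using assms q by (simp add: minor_arc_def)
  also have "\<dots> = vertex n ` {p..q}"
  proof
    show "arc n p q \<subseteq> vertex n ` {p..q}" by (auto simp: arc_def q)
    show "vertex n ` {p..q} \<subseteq> arc n p q"
    proof
      fix v assume "v \<in> vertex n ` {p..q}"
      then obtain i where "v = vertex n (p + (i - p))" "0 \<le> i - p" "i - p \<le> q - p" by auto
      then show "v \<in> arc n p q" unfolding arc_def q by blast
    qed
  qed
  finally show ?thesis .
qed

text \<open>An arc shorter than a half turn lifts injectively to \<open>{p..q}\<close>, so its
  chords correspond to the pairs of integers in this interval.\<close>

lemma v_vec_minor:
  assumes pq: "p < q" "q < p + int n"
  shows "v_vec n x p q = - (\<Sum>(a, c) | p \<le> a \<and> a < c \<and> c \<le> q. unit_vec x (lab n a c))"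
proof -
  let ?S = "{(a, c). p \<le> a \<and> a < c \<and> c \<le> q}"
  have short: "k = 0" if "a' = a + 2 * int n * k" "a \<in> {p..q}" "a' \<in> {p..q}" for a a' k
    using that pq by (intro mult_bounded_eq_0[of "2 * int n"]) auto
  have "{c \<in> chords n. c \<subseteq> minor_arc n p q} = (\<lambda>(a, c). chord n a c) ` ?S"
  proof
    show "(\<lambda>(a, c). chord n a c) ` ?S \<subseteq> {c \<in> chords n. c \<subseteq> minor_arc n p q}"
    proof clarify
      fix a c assume ac: "p \<le> a" "a < c" "c \<le> q"
      have "vertex n a \<noteq> vertex n c"
      proof
        assume "vertex n a = vertex n c"
        then obtain k where "a = c + 2 * int n * k" unfolding vertex_eq_iff by blast
        with short[OF this] ac show False by auto
      qed
      then have "chord n a c \<in> chords n" unfolding chords_def by blast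
      moreover have "chord n a c \<subseteq> minor_arc n p q" unfolding minor_arc_eq[OF pq] chord_def using ac by auto
      ultimately show "chord n a c \<in> chords n \<and> chord n a c \<subseteq> minor_arc n p q" ..
    qed
    show "{c \<in> chords n. c \<subseteq> minor_arc n p q} \<subseteq> (\<lambda>(a, c). chord n a c) ` ?S"
    proof clarify
      fix d assume "d \<in> chords n" "d \<subseteq> minor_arc n p q"
      then obtain i j where "d = chord n i j" "vertex n i \<noteq> vertex n j"
        "vertex n i \<in> vertex n ` {p..q}" "vertex n j \<in> vertex n ` {p..q}"
        unfolding minor_arc_eq[OF pq] chords_def by (auto simp: chord_def)
      moreover from this obtain a c where "vertex n i = vertex n a" "a \<in> {p..q}" "vertex n j = vertex n c" "c \<in> {p..q}"
        by blast
      ultimately have ac: "d = chord n a c" "a \<noteq> c" "a \<in> {p..q}" "c \<in> {p..q}"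
        by (auto simp: chord_def)
      then show "d \<in> (\<lambda>(a, c). chord n a c) ` ?S"
        by (cases "a < c") (auto intro: image_eqI[of _ _ "(a, c)"] image_eqI[of _ _ "(c, a)"] simp: chord_commute)
    qed
  qed
  moreover have "inj_on (\<lambda>(a, c). chord n a c) ?S"
  proof (rule inj_onI, clarify)
    fix a c a' c' assume ac: "p \<le> a" "a < c" "c \<le> q" "p \<le> a'" "a' < c'" "c' \<le> q"
      and "chord n a c = chord n a' c'"
    then obtain k where "a' = a + 2 * int n * k" "c' = c + 2 * int n * k"
      using pq by (subst (asm) chord_eq_iff_minor) auto
    with short[OF this(1)] ac show "a = a' \<and> c = c'" by auto
  qed
  ultimately show ?thesis
    unfolding v_vec_def by (simp add: sum.reindex case_prod_unfold)
qed

lemma v_vec_chord_length: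
  assumes "1 \<le> chord_length n i j" "chord_length n i j \<le> int n - 2"
  obtains p q where "p < q" "q \<le> p + int n - 2" "v_vec n x i j = v_vec n x p q"
proof -
  have *: "v_vec n x i' j' = v_vec n x i' (i' + vertex n (j' - i'))"
    if "vertex n (j' - i') \<le> vertex n (i' - j')" "1 \<le> vertex n (j' - i')" "vertex n (j' - i') \<le> int n - 2" for i' j'
  proof -
    let ?q = "i' + vertex n (j' - i')"
    have v: "vertex n (?q - i') = vertex n (j' - i')" using that by (simp add: vertex_eq_self)
    have "minor_arc n i' ?q = vertex n ` {i'..?q}" using that by (intro minor_arc_eq) auto
    also have "\<dots> = {vertex n (i' + t) | t. 0 \<le> t \<and> t \<le> vertex n (j' - i')}"
    proof (intro set_eqI iffI)
      fix y assume "y \<in> vertex n ` {i'..?q}"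
      then obtain i where "y = vertex n (i' + (i - i'))" "0 \<le> i - i'" "i - i' \<le> vertex n (j' - i')" by auto
      then show "y \<in> {vertex n (i' + t) | t. 0 \<le> t \<and> t \<le> vertex n (j' - i')}" by blast
    qed auto
    also have "\<dots> = minor_arc n i' j'" using that(1) by (simp add: minor_arc_def arc_def)
    finally show ?thesis by (simp add: v_vec_def)
  qed
  show thesis
  proof (cases "vertex n (j - i) \<le> vertex n (i - j)")
    case True
    with * assms that[of i "i + vertex n (j - i)"] show thesis by (simp add: chord_length_def)
  next
    case False
    then have "minor_arc n i j = minor_arc n j i" by (simp add: minor_arc_def)
    then have "v_vec n x i j = v_vec n x j i" by (simp add: v_vec_def)
    with False *[of i j] assms that[of j "j + vertex n (i - j)"] show thesis by (simp add: chord_length_def)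
  qed
qed

locale labelling =
  fixes n :: nat and x :: "label \<Rightarrow> 'f"
  assumes n: "2 \<le> n" and inj_x: "inj_on x (label_of n ` sides n)"
begin

lemma x_eq_iff:
  "l \<in> label_of n ` sides n \<Longrightarrow> l' \<in> label_of n ` sides n \<Longrightarrow> x l = x l' \<longleftrightarrow> l = l'"
  using inj_x by (auto dest: inj_onD)

lemma n_pos: "0 < n" using n by simp

lemmas label_mems = blue_mem[OF n_pos] red_mem[OF n_pos] lab_minor_mem

lemma lookup_unit_vec:
  assumes "l \<in> label_of n ` sides n" "l' \<in> label_of n ` sides n"
  shows "lookup (unit_vec x l) (x l') = (if l = l' then 1 else 0)"
  using x_eq_iff[OF assms] by (simp add: unit_vec_def lookup_single when_def)

text \<open>No antipodal pair fits into a minor arc, so every nonzero entry is \<open>- 1\<close>.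
  The range of \<open>a\<close> is one period with both ends included, because a slack at
  \<open>b\<close> involves \<open>b\<close> and \<open>b + 1\<close>; both lifts of the repeated
  residue give \<open>0\<close>.\<close>

lemma lookup_v_vec_lab:
  assumes pq: "p < q" "q < p + int n" and a: "p - 1 \<le> a" "a \<le> p + int n - 1" and ac: "a < c" "c < a + int n"
  shows "lookup (v_vec n x p q) (x (lab n a c)) = (if p \<le> a \<and> c \<le> q then - 1 else 0)"
proof -
  let ?S = "{(a, c). p \<le> a \<and> a < c \<and> c \<le> q}"
  have "?S \<subseteq> {p..q} \<times> {p..q}" by auto
  then have fin: "finite ?S" by (rule finite_subset) simp
  have "lookup (v_vec n x p q) (x (lab n a c))
      = - (\<Sum>s\<in>?S. lookup (unit_vec x (lab n (fst s) (snd s))) (x (lab n a c)))"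
    unfolding v_vec_minor[OF pq] by (simp add: lookup_sum case_prod_unfold)
  also have "(\<Sum>s\<in>?S. lookup (unit_vec x (lab n (fst s) (snd s))) (x (lab n a c)))
      = (\<Sum>s\<in>?S. if s = (a, c) then 1 else 0)"
  proof (rule sum.cong)
    fix s assume "s \<in> ?S"
    then obtain a' c' where s: "s = (a', c')" "p \<le> a'" "a' < c'" "c' \<le> q" by auto
    have "lab n a' c' = lab n a c \<longleftrightarrow> a' = a \<and> c' = c"
    proof
      assume "lab n a' c' = lab n a c"
      then obtain k where k: "a = a' + int n * k" "c = c' + int n * k"
        using s pq ac by (subst (asm) lab_eq_iff_minor) auto
      have "k \<le> 0"
      proof (rule ccontr)
        assume "\<not> k \<le> 0"
        then have "int n * 1 \<le> int n * k" by (intro mult_left_mono) auto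
        then show False using k s a by simp
      qed
      moreover have "0 \<le> k"
      proof (rule ccontr)
        assume "\<not> 0 \<le> k"
        then have "int n * k \<le> int n * (-1)" by (intro mult_left_mono) auto
        then show False using k s a pq by simp
      qed
      ultimately show "a' = a \<and> c' = c" using k by simp
    qed auto
    then show "lookup (unit_vec x (lab n (fst s) (snd s))) (x (lab n a c)) = (if s = (a, c) then 1 else 0)"
      using s pq ac by (subst lookup_unit_vec) (auto intro!: lab_minor_mem)
  qed simp
  also have "\<dots> = (if p \<le> a \<and> c \<le> q then 1 else 0)" using fin ac by simp
  finally show ?thesis by simp
qed

lemma lookup_v_vec_eq_0:
  assumes pq: "p < q" "q < p + int n"
    and y: "\<And>a c. p \<le> a \<Longrightarrow> a < c \<Longrightarrow> c \<le> q \<Longrightarrow> x (lab n a c) \<noteq> y"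
  shows "lookup (v_vec n x p q) y = 0"
proof -
  have "lookup (v_vec n x p q) y =
      - (\<Sum>s\<in>{(a, c). p \<le> a \<and> a < c \<and> c \<le> q}. lookup (unit_vec x (lab n (fst s) (snd s))) y)"
    unfolding v_vec_minor[OF pq] by (simp add: lookup_sum case_prod_unfold)
  also have "(\<Sum>s\<in>{(a, c). p \<le> a \<and> a < c \<and> c \<le> q}. lookup (unit_vec x (lab n (fst s) (snd s))) y)
      = (\<Sum>s\<in>{(a, c). p \<le> a \<and> a < c \<and> c \<le> q}. 0)"
    by (rule sum.cong[OF refl]) (use y in \<open>force simp: unit_vec_def lookup_single\<close>)
  finally show ?thesis by simp
qed

lemma lookup_v_vec_diameter:
  assumes pq: "p < q" "q < p + int n"
  shows "lookup (v_vec n x p q) (x (blue n e)) = 0"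
    and "lookup (v_vec n x p q) (x (red n e)) = 0"
proof -
  have "x (lab n a c) \<noteq> x (blue n e)" "x (lab n a c) \<noteq> x (red n e)"
    if "p \<le> a" "a < c" "c \<le> q" for a c
  proof -
    have ac: "a < c" "c < a + int n" using that pq by linarith+
    show "x (lab n a c) \<noteq> x (blue n e)" "x (lab n a c) \<noteq> x (red n e)"
      using x_eq_iff[OF lab_minor_mem[OF ac] blue_mem[OF n_pos, of e]]
        x_eq_iff[OF lab_minor_mem[OF ac] red_mem[OF n_pos, of e]] lab_minor_neq[OF ac] by blast+
  qed
  then show "lookup (v_vec n x p q) (x (blue n e)) = 0"
    and "lookup (v_vec n x p q) (x (red n e)) = 0"
    by (intro lookup_v_vec_eq_0[OF pq]; blast)+
qed

lemma keys_v_vec: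
  assumes pq: "p < q" "q < p + int n"
  shows "keys (v_vec n x p q) \<subseteq> x ` label_of n ` sides n"
proof (rule subsetI, rule ccontr)
  fix y assume y: "y \<in> keys (v_vec n x p q)" "y \<notin> x ` label_of n ` sides n"
  have "x (lab n a c) \<noteq> y" if "p \<le> a" "a < c" "c \<le> q" for a c
  proof -
    have "c < a + int n" using that pq by linarith
    then show ?thesis using y(2) lab_minor_mem[OF that(2)] by blast
  qed
  then have "lookup (v_vec n x p q) y = 0" by (rule lookup_v_vec_eq_0[OF pq])
  with y(1) show False by (simp add: in_keys_iff)
qed

end

section \<open>Seeds\<close>

lemma alg_indep_nonzero:
  assumes "coeff_hom \<iota>" "alg_indep \<iota> Y" "y \<in> Y" shows "y \<noteq> 0"
proof
  interpret coeff_hom \<iota> by fact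
  assume "y = 0"
  then have "poly_eval \<iota> (var y) = 0" by (simp add: poly_eval_eq_peval)
  then have "(var y :: ('b, 'a) mpoly) = 0" using assms by (auto simp: alg_indep_def intro: polys_var)
  then have "lookup (var y :: ('b, 'a) mpoly) (single y 1) = 0" by simp
  then show False by (simp add: var_def)
qed

lemma prod_var_power:
  "(\<Prod>i\<in>A. var (f i) ^ e i :: ('v, 'k::comm_ring_1) mpoly) = single (\<Sum>i\<in>A. single (f i) (e i)) 1"
proof (induction A rule: infinite_finite_induct)
  case (insert a A)
  then show ?case by (simp add: var_power mult_single)
qed simp_all

lemma skew_symmetrizable_diagonal:
  assumes "skew_symmetrizable I B" "k \<in> I" shows "B k k = 0"
proof -
  obtain d :: "'a \<Rightarrow> int" where "0 < d k" "d k * B k k = - (d k * B k k)"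
    using assms unfolding skew_symmetrizable_def by blast
  then show ?thesis by simp
qed

text \<open>The same \<open>d\<close> works for the mutated matrix: \<open>B i k * B k j\<close> and
  \<open>B j k * B k i\<close> agree up to positive factors, so both maxima are active together,
  with opposite signs in front.\<close>

lemma skew_symmetrizable_mutate_matrix:
  assumes "skew_symmetrizable I B" "k \<in> I"
  shows "skew_symmetrizable I (mutate_matrix k B)"
proof -
  obtain d :: "'a \<Rightarrow> int" where pos: "\<And>i. i \<in> I \<Longrightarrow> 0 < d i"
    and skew: "\<And>i j. i \<in> I \<Longrightarrow> j \<in> I \<Longrightarrow> d i * B i j = - (d j * B j i)"
    using assms(1) unfolding skew_symmetrizable_def by blast
  have sgn: "sgn (B i j) = - sgn (B j i)" if "i \<in> I" "j \<in> I" for i j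
  proof -
    have "sgn (d i * B i j) = - sgn (d j * B j i)" using skew[OF that] by (simp add: sgn_minus)
    then show ?thesis using pos that by (simp add: sgn_mult)
  qed
  have part: "d i * (sgn (B i k) * max (B i k * B k j) 0) = - (d j * (sgn (B j k) * max (B j k * B k i) 0))"
    if ij: "i \<in> I" "j \<in> I" for i j
  proof -
    \<comment> \<open>The extra factor \<open>d k\<close> makes skew-symmetry applicable to both
      entries through \<open>k\<close>; it is positive and cancels.\<close>
    have "d k * (d i * (B i k * B k j)) = (d i * B i k) * (d k * B k j)" by (simp add: algebra_simps)
    also have "\<dots> = (d k * B k i) * (d j * B j k)"
      using skew[OF ij(1) assms(2)] skew[OF assms(2) ij(2)] by simp
    also have "\<dots> = d k * (d j * (B j k * B k i))" by (simp add: algebra_simps)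
    finally have eq: "d i * (B i k * B k j) = d j * (B j k * B k i)" using pos[OF assms(2)] by simp
    show ?thesis
    proof (cases "B i k * B k j > 0")
      case True
      then have "d j * (B j k * B k i) > 0" using eq pos[OF ij(1)] by (metis mult_pos_pos)
      then have "B j k * B k i > 0" using pos[OF ij(2)] by (simp add: zero_less_mult_iff)
      moreover have "sgn (B i k) = - sgn (B j k)"
        using True sgn[OF ij(2) assms(2)] by (auto simp: zero_less_mult_iff)
      ultimately show ?thesis using True eq by simp
    next
      case False
      then have "\<not> d j * (B j k * B k i) > 0" using eq pos[OF ij(1)]
        by (metis zero_less_mult_iff less_le_not_le)
      then have "\<not> B j k * B k i > 0" using pos[OF ij(2)] by (simp add: zero_less_mult_iff)
      then show ?thesis using False by simp
    qed
  qed
  have "d i * mutate_matrix k B i j = - (d j * mutate_matrix k B j i)" if ij: "i \<in> I" "j \<in> I" for i j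
  proof (cases "i = k \<or> j = k")
    case True
    then have "mutate_matrix k B i j = - B i j" "mutate_matrix k B j i = - B j i"
      by (auto simp: mutate_matrix_def)
    then show ?thesis using skew[OF ij] by simp
  next
    case False
    then show ?thesis using skew[OF ij] part[OF ij] by (simp add: mutate_matrix_def distrib_left)
  qed
  with pos show ?thesis unfolding skew_symmetrizable_def by blast
qed

text \<open>Translates the multiset encoding of monomials in \<open>exchange_relations\<close> into
  exponent vectors.\<close>

definition exponent :: "'v multiset \<Rightarrow> 'v \<Rightarrow>\<^sub>0 nat" where
  "exponent A = (\<Sum>v\<in>#A. single v 1)"

lemma exponent_simps [simp]:
  "exponent {#} = 0" "exponent (add_mset v A) = single v 1 + exponent A"
  by (simp_all add: exponent_def)

lemma keys_exponent: "keys (exponent A) \<subseteq> set_mset A"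
proof (induction A)
  case (add v A)
  then show ?case using Poly_Mapping.keys_add[of "single v (1::nat)" "exponent A"] by auto
qed simp

lemma eval_mon_exponent: "eval_mon \<phi> (exponent A) = (\<Prod>v\<in>#A. \<phi> v)"
  by (induction A) (simp_all add: eval_mon_add)

lemma weight_exponent: "weight \<omega> (exponent A) = (\<Sum>v\<in>#A. lookup \<omega> v)"
  by (induction A) (simp_all add: weight_add)

lemma divisible_pair_in_keys:
  assumes "divisible R m" obtains v w where "R v w" "v \<in> keys m" "w \<in> keys m"
  using assms by (rule divisibleE) (auto simp: in_keys_iff lookup_add lookup_single)

context cluster_algebra
begin

lemma coeff_hom: "coeff_hom \<iota>"
  by unfold_locales (use \<iota>_one \<iota>_add \<iota>_mult in auto)

text \<open>Independence survives by \<open>alg_indep_exchange\<close>: mutation replaces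
  \<open>y\<close> by \<open>Q / y\<close>, where \<open>Q\<close> involves the other variables only
  because the diagonal entry at \<open>k\<close> is zero by skew-symmetrizability.\<close>

lemma seed_invariants:
  assumes "s \<in> seeds"
  shows "skew_symmetrizable I (snd s)" "inj_on (fst s) (I \<union> J)" "alg_indep \<iota> (fst s ` (I \<union> J))"
    "\<forall>j\<in>J. fst s j = fst s\<^sub>0 j"
  using assms
proof (induction s)
  case initial
  {
    case 1 show ?case by (rule skew)
  next
    case 2 show ?case by (rule inj_seed)
  next
    case 3 show ?case using free_seed by (auto simp: free_generating_set_def alg_indep_def)
  next
    case 4 show ?case by simp
  }
next
  case (mutation s k)
  interpret coeff_hom \<iota> by (rule coeff_hom)
  let ?A = "I \<union> J - {k}"
  let ?y = "mutate_var I J k s"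
  define Q :: "('f, 'k) mpoly" where
    "Q = (\<Prod>i\<in>?A. var (fst s i) ^ nat (snd s i k)) + (\<Prod>i\<in>?A. var (fst s i) ^ nat (- snd s i k))"
  have k: "k \<in> I" by fact
  have fin: "finite (I \<union> J)" using finite_indices by simp
  have A: "I \<union> J = insert k ?A" using k by blast
  have B0: "snd s k k = 0" using skew_symmetrizable_diagonal[OF mutation.IH(1) k] .
  have ys: "fst s k \<notin> fst s ` ?A" using mutation.IH(2) k by (auto dest: inj_onD)
  have indep: "alg_indep \<iota> (insert (fst s k) (fst s ` ?A))"
    using mutation.IH(3) A by (metis image_insert)
  have Q: "Q \<in> polys (fst s ` ?A)"
    unfolding Q_def by (intro polys_add polys_prod polys_power polys_var) auto
  have Q0: "Q \<noteq> 0"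
  proof
    assume Q0: "Q = 0"
    let ?m = "\<lambda>e. \<Sum>i\<in>?A. single (fst s i) (nat (e i))"
    \<comment> \<open>The two monomials of \<open>Q\<close> might coincide; the coefficient is then
      \<open>2\<close>, nonzero in characteristic zero.\<close>
    have "lookup Q (?m (\<lambda>i. snd s i k)) = 1 + (if ?m (\<lambda>i. snd s i k) = ?m (\<lambda>i. - snd s i k) then 1 else 0)"
      unfolding Q_def prod_var_power lookup_add lookup_single by (auto simp: when_def)
    then show False using Q0 by (auto split: if_splits)
  qed
  have "(\<Prod>i\<in>I \<union> J. fst s i ^ nat (e i)) = (\<Prod>i\<in>?A. fst s i ^ nat (e i))" if "e k = 0" for e
    using that fin k by (subst A, subst prod.insert) auto
  then have "?y = poly_eval \<iota> Q / fst s k"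
    using B0 by (simp add: mutate_var_def Q_def poly_eval_eq_peval peval_add peval_prod peval_power)
  from alg_indep_exchange[OF coeff_hom indep ys Q Q0 this]
  have y: "?y \<notin> fst s ` ?A" and indep': "alg_indep \<iota> (insert ?y (fst s ` ?A))" .
  have image: "fst (mutate I J k s) ` (I \<union> J) = insert ?y (fst s ` ?A)"
    by (subst A) (auto simp: mutate_def)
  {
    case 1 show ?case using skew_symmetrizable_mutate_matrix[OF mutation.IH(1) k] by (simp add: mutate_def)
  next
    case 2
    have "inj_on ((fst s)(k := ?y)) ?A" using mutation.IH(2) by (auto simp: inj_on_def)
    moreover have "?y \<notin> ((fst s)(k := ?y)) ` (?A - {k})" using y by auto
    ultimately have "inj_on ((fst s)(k := ?y)) (insert k ?A)" unfolding inj_on_insert by simp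
    moreover have "fst (mutate I J k s) = (fst s)(k := ?y)" by (simp add: mutate_def)
    ultimately show ?case unfolding A[symmetric] by (simp only:)
  next
    case 3 show ?case unfolding image by (rule indep')
  next
    case 4 show ?case using mutation.IH(4) k disjoint_indices by (auto simp: mutate_def)
  }
qed

lemma cluster_variable_iff: "v \<in> cluster_variables \<longleftrightarrow> (\<exists>s\<in>seeds. v \<in> fst s ` I)"
  by (auto simp: cluster_variables_def clusters_def)

text \<open>Every seed lists its variables injectively and contains all frozen variables
  unchanged.\<close>

lemma cluster_variables_not_frozen: "cluster_variables \<inter> frozen_variables = {}"
proof -
  have False if v: "v \<in> cluster_variables" "v \<in> frozen_variables" for v
  proof -
    from v(1) obtain s i where s: "s \<in> seeds" "i \<in> I" "v = fst s i" by (auto simp: cluster_variable_iff)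
    from v(2) obtain j where j: "j \<in> J" "v = fst s\<^sub>0 j" by (auto simp: frozen_variables_def)
    have "fst s i = fst s j" using seed_invariants(4)[OF s(1)] s j by simp
    then have "i = j" using seed_invariants(2)[OF s(1)] s(2) j(1) by (auto dest: inj_onD)
    then show False using disjoint_indices s(2) j(1) by blast
  qed
  then show ?thesis by blast
qed

lemma seed_subset_generators:
  assumes "s \<in> seeds" shows "fst s ` (I \<union> J) \<subseteq> generators"
proof (rule image_subsetI)
  fix i assume "i \<in> I \<union> J"
  then show "fst s i \<in> generators"
  proof
    assume "i \<in> I"
    then have "fst s i \<in> cluster_variables" using assms unfolding cluster_variable_iff by blast
    then show ?thesis ..
  next
    assume "i \<in> J"
    then have "fst s i \<in> frozen_variables"
      using seed_invariants(4)[OF assms] by (simp add: frozen_variables_def)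
    then show ?thesis ..
  qed
qed

definition incompatible :: "'f \<Rightarrow> 'f \<Rightarrow> bool" where
  "incompatible v w \<longleftrightarrow> v \<in> cluster_variables \<and> w \<in> cluster_variables \<and> \<not> (\<exists>c\<in>clusters. v \<in> c \<and> w \<in> c)"

lemma monomial_ideal_eq: "monomial_ideal = ideal_gen generators (pair_products incompatible)"
  by (simp add: monomial_ideal_def pair_products_def incompatible_def)

lemma incompatible_generators: "incompatible v w \<Longrightarrow> v \<in> generators \<and> w \<in> generators"
  by (simp add: incompatible_def)

lemma seed_compatible:
  assumes s: "s \<in> seeds" and vw: "v \<in> fst s ` (I \<union> J)" "w \<in> fst s ` (I \<union> J)"
  shows "\<not> incompatible v w"
proof
  assume inc: "incompatible v w"
  have "u \<in> fst s ` I" if "u \<in> fst s ` (I \<union> J)" "u \<in> cluster_variables" for u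
    using that cluster_variables_not_frozen seed_invariants(4)[OF s] by (auto simp: frozen_variables_def)
  then have "v \<in> fst s ` I" "w \<in> fst s ` I" using inc vw by (auto simp: incompatible_def)
  then show False using inc s by (auto simp: incompatible_def clusters_def)
qed

lemma exchange_relation_seed:
  assumes "(A, B) \<in> exchange_relations" "M \<in># B"
  obtains s where "s \<in> seeds" "set_mset M \<subseteq> fst s ` (I \<union> J)"
proof -
  have sub: "set_mset (\<Sum>i\<in>I \<union> J. replicate_mset (e i) (f i)) \<subseteq> f ` (I \<union> J)"
    for e and f :: "'i \<Rightarrow> 'f"
    using finite_indices by (auto simp: set_mset_sum split: if_splits)
  from assms obtain s k where "s \<in> seeds"
    "M = (\<Sum>i\<in>I \<union> J. replicate_mset (nat (snd s i k)) (fst s i)) \<or>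
     M = (\<Sum>i\<in>I \<union> J. replicate_mset (nat (- snd s i k)) (fst s i))"
    by (auto simp: exchange_relations_def)
  then have "set_mset M \<subseteq> fst s ` (I \<union> J)" by (elim disjE) (simp_all only: sub)
  with \<open>s \<in> seeds\<close> show thesis by (rule that)
qed

lemma exchange_relation_lhs:
  assumes "(A, B) \<in> exchange_relations" shows "set_mset A \<subseteq> generators"
proof -
  from assms obtain s k where sk: "s \<in> seeds" "k \<in> I" "A = {# fst s k, mutate_var I J k s #}"
    by (auto simp: exchange_relations_def)
  have "mutate_var I J k s = fst (mutate I J k s) k" by (simp add: mutate_def)
  then have "mutate_var I J k s \<in> cluster_variables"
    using seeds.mutation[OF sk(1,2)] sk(2) unfolding cluster_variable_iff by blast
  then show ?thesis using sk by (auto simp: cluster_variable_iff)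
qed

lemma exchange_relation_product:
  assumes "(A, B) \<in> exchange_relations"
  shows "prod_mset A = (\<Sum>M\<in>#B. prod_mset M)"
proof -
  have prod: "prod_mset (\<Sum>i\<in>K. replicate_mset (e i) (f i)) = (\<Prod>i\<in>K. f i ^ e i)"
    for K :: "'i set" and e and f :: "'i \<Rightarrow> 'f"
    by (induction K rule: infinite_finite_induct) auto
  from assms obtain s k where sk: "s \<in> seeds" "k \<in> I"
    and A: "A = {# fst s k, mutate_var I J k s #}"
    and B: "B = {# (\<Sum>i\<in>I \<union> J. replicate_mset (nat (snd s i k)) (fst s i)),
          (\<Sum>i\<in>I \<union> J. replicate_mset (nat (- snd s i k)) (fst s i)) #}"
    by (auto simp: exchange_relations_def)
  have "fst s k \<noteq> 0" using alg_indep_nonzero[OF coeff_hom seed_invariants(3)[OF sk(1)]] sk(2) by blast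
  then show ?thesis by (simp add: A B prod mutate_var_def)
qed

lemma exchange_relation_weight_le:
  assumes \<omega>: "initial_ideal generators \<omega> relation_ideal = monomial_ideal"
    and rel: "(A, {# M, M' #}) \<in> exchange_relations"
  shows "(\<Sum>v\<in>#M. lookup \<omega> v) \<le> (\<Sum>v\<in>#A. lookup \<omega> v)"
proof -
  interpret coeff_hom \<iota> by (rule coeff_hom)
  have std: "\<not> divisible incompatible (exponent N) \<and> keys (exponent N) \<subseteq> generators" if N: "N \<in># {# M, M' #}" for N
  proof -
    obtain s where s: "s \<in> seeds" "set_mset N \<subseteq> fst s ` (I \<union> J)"
      using exchange_relation_seed[OF rel N] by blast
    have sub: "keys (exponent N) \<subseteq> fst s ` (I \<union> J)" using keys_exponent s(2) by (rule subset_trans)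
    have "\<not> divisible incompatible (exponent N)"
    proof
      assume "divisible incompatible (exponent N)"
      then obtain v w where "incompatible v w" "v \<in> keys (exponent N)" "w \<in> keys (exponent N)"
        by (rule divisible_pair_in_keys)
      then show False using seed_compatible[OF s(1)] subsetD[OF sub] by auto
    qed
    moreover have "keys (exponent N) \<subseteq> generators"
      using sub seed_subset_generators[OF s(1)] by (rule subset_trans)
    ultimately show ?thesis ..
  qed
  have A: "keys (exponent A) \<subseteq> generators"
    using keys_exponent exchange_relation_lhs[OF rel] by (rule subset_trans)
  let ?f = "single (exponent A) 1 - (single (exponent M) 1 + single (exponent M') 1) :: ('f, 'k) mpoly"
  have "?f \<in> polys generators" using A std by (intro polys_diff polys_add polys_single) auto
  moreover have "poly_eval \<iota> ?f = 0"
    using exchange_relation_product[OF rel]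
    by (simp add: poly_eval_eq_peval peval_diff peval_add eval_mon_exponent one)
  ultimately have "?f \<in> relation_ideal" by (simp add: relation_ideal_def)
  moreover have "initial_ideal generators \<omega> relation_ideal = ideal_gen generators (pair_products incompatible)"
    using \<omega> by (simp add: monomial_ideal_eq)
  ultimately have "weight \<omega> (exponent M) \<le> weight \<omega> (exponent A)"
    using std incompatible_generators by (intro weight_le_of_initial_ideal_eq) auto
  then show ?thesis by (simp add: weight_exponent)
qed

end

section \<open>Non-crossing multisets are determined by their digits\<close>

text \<open>
  Position \<open>j < n\<close> counts the sides at vertex \<open>j\<close>. The positions from \<open>n\<close> on record the leading
  variable of a side, in the parametrization used below: \<open>2n - 1\<close> for the
  chords that pass the cut between \<open>n - 1\<close> and \<open>n\<close> and for the red diameters, and \<open>2n - 2 - a\<close> for the other chords starting at \<open>a\<close>.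
\<close>

fun digit :: "nat \<Rightarrow> side \<Rightarrow> int \<Rightarrow> nat" where
  "digit n (Chord a c) j = of_bool (j = a) + of_bool (j = c mod int n)
     + of_bool (j = (if c < int n then 2 * int n - 2 - a else 2 * int n - 1))"
| "digit n (BlueDiam a) j = of_bool (j = a)"
| "digit n (RedDiam a) j = of_bool (j = a) + of_bool (j = 2 * int n - 1)"

definition noncrossing :: "nat \<Rightarrow> side multiset \<Rightarrow> bool" where
  "noncrossing n M \<longleftrightarrow> set_mset M \<subseteq> sides n \<and>
     (\<forall>s\<in>#M. \<forall>t\<in>#M. \<not> label_crossing n (label_of n s) (label_of n t))"

lemma sum_mset_pos_iff:
  fixes f :: "'a \<Rightarrow> nat"
  shows "0 < (\<Sum>s\<in>#M. f s) \<longleftrightarrow> (\<exists>s\<in>#M. 0 < f s)"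
  by (induction M) auto

lemma sides_simps:
  "Chord a c \<in> sides n \<longleftrightarrow> 0 \<le> a \<and> a < int n \<and> a < c \<and> c < a + int n"
  "BlueDiam a \<in> sides n \<longleftrightarrow> 0 \<le> a \<and> a < int n"
  "RedDiam a \<in> sides n \<longleftrightarrow> 0 \<le> a \<and> a < int n"
  by (auto simp: sides_def)

lemma wrap_mod:
  fixes n c :: int assumes "n \<le> c" "c < 2 * n" shows "c mod n = c - n"
proof -
  have "c mod n = (c - n) mod n" by simp
  also have "\<dots> = c - n" using assms by (intro mod_pos_pos_trivial) auto
  finally show ?thesis .
qed

section \<open>Which sides can occur together in a noncrossing multiset\<close>

context
  fixes n :: nat and M :: "side multiset"
  assumes M: "noncrossing n M"
begin

lemma noncrossing_sides: "s \<in># M \<Longrightarrow> s \<in> sides n"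
  using M by (auto simp: noncrossing_def)

lemma noncrossing_pair:
  "s \<in># M \<Longrightarrow> t \<in># M \<Longrightarrow> \<not> label_crossing n (label_of n s) (label_of n t)"
  using M by (auto simp: noncrossing_def)

text \<open>In the names below a chord is plain if its right end is less than \<open>n\<close>, and
  wraps if it is at least \<open>n\<close>, that is, if the chord passes the cut.\<close>

lemma noncrossing_plain_plain:
  assumes "Chord a b \<in># M" "Chord a' b' \<in># M" "a < a'" "a' < b" "b < int n"
  shows "b' \<le> b"
  using noncrossing_pair[OF assms(1,2)] noncrossing_sides[OF assms(1)] noncrossing_sides[OF assms(2)]
    label_crossing_labI[of a a' b b' n] assms by (force simp: sides_simps)

lemma noncrossing_plain_diameter:
  assumes "Chord a b \<in># M" "BlueDiam e \<in># M \<or> RedDiam e \<in># M" "a < e" shows "b \<le> e"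
  using noncrossing_pair[OF _ assms(1)] noncrossing_sides[OF assms(1)]
    label_crossing_diameterI[of a e b n] assms by (force simp: sides_simps)

lemma noncrossing_wrap_diameter:
  assumes "Chord p q \<in># M" "int n \<le> q" "BlueDiam e \<in># M \<or> RedDiam e \<in># M"
  shows "q - int n \<le> e" "e \<le> p"
proof -
  have pq: "p < q" "q < p + int n" "0 \<le> p" "p < int n" using noncrossing_sides[OF assms(1)] by (auto simp: sides_simps)
  have e: "0 \<le> e" "e < int n" using noncrossing_sides[of "BlueDiam e"] noncrossing_sides[of "RedDiam e"] assms(3)
    by (auto simp: sides_simps)
  show "e \<le> p" using noncrossing_plain_diameter[OF assms(1,3)] e assms(2) by force
  show "q - int n \<le> e"
  proof (rule ccontr)
    assume "\<not> q - int n \<le> e"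
    \<comment> \<open>Translation by \<open>- n\<close> passes to the antipodal chord, hence keeps
      the label, and puts \<open>e\<close> between the two ends.\<close>
    then have "label_crossing n (blue n e) (lab n (p - int n) (q - int n))"
      "label_crossing n (red n e) (lab n (p - int n) (q - int n))"
      using pq e by (auto intro!: label_crossing_diameterI)
    moreover have "lab n (p - int n) (q - int n) = lab n p q"
      using lab_shift[of n "p - int n" "q - int n"] by simp
    ultimately show False
      using noncrossing_pair[of "BlueDiam e", OF _ assms(1)] noncrossing_pair[of "RedDiam e", OF _ assms(1)]
        assms(3) by auto
  qed
qed

lemma noncrossing_plain_wrap:
  assumes "Chord a b \<in># M" "b < int n" "Chord p q \<in># M" "int n \<le> q"
  shows "a < p \<Longrightarrow> b \<le> p" "a < q - int n \<Longrightarrow> b \<le> q - int n"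
proof -
  have ab: "a < b" "0 \<le> a" using noncrossing_sides[OF assms(1)] by (auto simp: sides_simps)
  have pq: "p < q" "q < p + int n" "0 \<le> p" "p < int n" using noncrossing_sides[OF assms(3)] by (auto simp: sides_simps)
  show "b \<le> p" if "a < p"
    using noncrossing_plain_plain[OF assms(1,3) that] assms by force
  show "b \<le> q - int n" if "a < q - int n"
  proof (rule ccontr)
    assume "\<not> b \<le> q - int n"
    then have "label_crossing n (lab n (p - int n) (q - int n)) (lab n a b)"
      using that ab pq assms by (intro label_crossing_labI) auto
    moreover have "lab n (p - int n) (q - int n) = lab n p q"
      using lab_shift[of n "p - int n" "q - int n"] by simp
    ultimately show False using noncrossing_pair[OF assms(3,1)] by simp
  qed
qed

lemma noncrossing_wrap_wrap:
  assumes "Chord p q \<in># M" "int n \<le> q" "Chord p' q' \<in># M" "int n \<le> q'" "p < p'"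
  shows "q' \<le> q"
proof (rule ccontr)
  have pq: "p < q" "q < p + int n" "0 \<le> p" "p < int n" using noncrossing_sides[OF assms(1)] by (auto simp: sides_simps)
  have pq': "p' < q'" "q' < p' + int n" "0 \<le> p'" "p' < int n" using noncrossing_sides[OF assms(3)] by (auto simp: sides_simps)
  assume "\<not> q' \<le> q"
  then have "label_crossing n (lab n p q) (lab n p' q')"
    using pq pq' assms by (intro label_crossing_labI) auto
  then show False using noncrossing_pair[OF assms(1,3)] by simp
qed

lemma noncrossing_colors:
  assumes "BlueDiam a \<in># M" "RedDiam b \<in># M" shows "a = b"
proof (rule ccontr)
  assume "a \<noteq> b"
  have ab: "0 \<le> a" "a < int n" "0 \<le> b" "b < int n"
    using noncrossing_sides[OF assms(1)] noncrossing_sides[OF assms(2)] by (auto simp: sides_simps)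
  have "chord n a (a + int n) \<noteq> chord n b (b + int n)"
  proof
    assume "chord n a (a + int n) = chord n b (b + int n)"
    moreover have "0 < n" using ab by linarith
    ultimately obtain k where "b = a + int n * k" using chord_diameter_eq_iff by blast
    with residue_unique[of a "int n" k] ab \<open>a \<noteq> b\<close> show False by simp
  qed
  then show False using noncrossing_pair[OF assms] by simp
qed

text \<open>Let \<open>i\<close> be the largest left end of a plain chord. The shortest plain chord
  at \<open>i\<close> stops at the first occupied vertex after \<open>i\<close>: a side touching an
  earlier one would cross it, or be a plain chord that starts after \<open>i\<close> or is shorter.
  So this chord can be read off from the digits.\<close>

lemma last_plain_chord:
  assumes i: "Chord i c \<in># M" "c < int n"
    and last: "\<And>a b. Chord a b \<in># M \<Longrightarrow> b < int n \<Longrightarrow> a \<le> i"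
  shows "\<exists>b. Chord i b \<in># M \<and> i < b \<and> b < int n \<and> (\<exists>s\<in>#M. 0 < digit n s b) \<and>
      (\<forall>e. i < e \<and> e < b \<longrightarrow> \<not> (\<exists>s\<in>#M. 0 < digit n s e))"
proof -
  have "finite {b. Chord i b \<in># M}"
    by (rule finite_subset[of _ "(\<lambda>s. case s of Chord a b \<Rightarrow> b | _ \<Rightarrow> 0) ` set_mset M"]) (force split: side.splits)+
  define b where "b = Min {b. Chord i b \<in># M}"
  have b: "Chord i b \<in># M" "b \<le> c" and bmin: "\<And>d. Chord i d \<in># M \<Longrightarrow> b \<le> d"
    using Min_in[OF \<open>finite _\<close>] i(1) Min_le[OF \<open>finite _\<close>] unfolding b_def by auto
  have ib: "0 \<le> i" "i < b" "b < int n" using noncrossing_sides[OF b(1)] b(2) i(2) by (auto simp: sides_simps)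
  have "0 < digit n (Chord i b) b" using ib by simp
  moreover have False if e: "i < e" "e < b" and s: "s \<in># M" "0 < digit n s e" for s e
  proof (cases s)
    case (Chord a d)
    have ad: "0 \<le> a" "a < int n" "a < d" "d < a + int n"
      using noncrossing_sides[OF s(1)] Chord by (auto simp: sides_simps)
    have sM: "Chord a d \<in># M" using s Chord by simp
    show False
    proof (cases "d < int n")
      case True
      then have "e = a \<or> e = d" using s(2) Chord ad e ib by (auto split: if_splits)
      moreover have "a \<le> i" using last[OF sM True] .
      ultimately have "e = d" "a \<le> i" using e by auto
      moreover have "a \<noteq> i" using bmin[of d] sM e \<open>e = d\<close> by auto
      ultimately show False using noncrossing_plain_plain[OF sM b(1)] e ib by auto
    next
      case False
      then have "e = a \<or> e = d - int n" using s(2) Chord ad e ib wrap_mod[of "int n" d] by (auto split: if_splits)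
      then show False using noncrossing_plain_wrap[OF b(1) ib(3) sM] False e by auto
    qed
  next
    case (BlueDiam a)
    then show False using noncrossing_plain_diameter[OF b(1), of a] s e ib by (auto split: if_splits)
  next
    case (RedDiam a)
    then show False using noncrossing_plain_diameter[OF b(1), of a] s e ib by (auto split: if_splits)
  qed
  ultimately show ?thesis using b(1) ib by blast
qed

text \<open>Without plain chords, all wrapping arcs are nested around the cut and every side lies
  between the extreme occupied vertices \<open>e\<close> and \<open>f\<close>. Some wrapping chord
  starts at \<open>f\<close> and some ends at \<open>e + n\<close>; by nesting the shortest arc does
  both.\<close>

lemma outermost_chord:
  assumes wrap: "\<And>a c. Chord a c \<in># M \<Longrightarrow> int n \<le> c"
    and ends: "0 \<le> e" "e < f" "f < int n" "\<exists>s\<in>#M. 0 < digit n s e" "\<exists>s\<in>#M. 0 < digit n s f"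
    and bounds: "\<And>s d. s \<in># M \<Longrightarrow> 0 \<le> d \<Longrightarrow> d < int n \<Longrightarrow> 0 < digit n s d \<Longrightarrow> e \<le> d \<and> d \<le> f"
    and top: "s \<in># M" "0 < digit n s (2 * int n - 1)"
    and nonred: "t \<in># M" "\<And>a. t \<noteq> RedDiam a"
  shows "Chord f (e + int n) \<in># M"
proof -
  have chord: "e \<le> c - int n \<and> c - int n < a \<and> a \<le> f \<and> a < int n \<and> int n \<le> c"
    if c: "Chord a c \<in># M" for a c
  proof -
    have ac: "0 \<le> a" "a < int n" "a < c" "c < a + int n" "int n \<le> c"
      using noncrossing_sides[OF c] wrap[OF c] by (auto simp: sides_simps)
    have "0 < digit n (Chord a c) a" by simp
    moreover have "0 < digit n (Chord a c) (c - int n)" using ac by (simp add: wrap_mod)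
    ultimately show ?thesis using bounds[OF c, of a] bounds[OF c, of "c - int n"] ac by auto
  qed
  have touch: "s = BlueDiam d \<or> s = RedDiam d \<or> (\<exists>c. s = Chord d c) \<or> (\<exists>a. s = Chord a (d + int n))"
    if s: "s \<in># M" "0 < digit n s d" "0 \<le> d" "d < int n" for s d
  proof (cases s)
    case (Chord a c)
    then have "int n \<le> c" "c < 2 * int n" using chord[of a c] s by auto
    then show ?thesis using Chord s by (auto simp: wrap_mod split: if_splits)
  qed (use s in \<open>auto split: if_splits\<close>)
  have n: "0 \<le> e" "e < int n" "0 \<le> f" "f < int n" using ends by auto
  obtain se where se: "se \<in># M" "0 < digit n se e" using ends by blast
  obtain sf where sf: "sf \<in># M" "0 < digit n sf f" using ends by blast
  \<comment> \<open>With diameters only, \<open>top\<close> would give a red one and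
    \<open>nonred\<close> a blue one; opposite colors must share their ends, so all would sit at one
    vertex, against \<open>e < f\<close>.\<close>
  have "\<exists>p q. Chord p q \<in># M"
  proof (rule ccontr)
    assume no: "\<nexists>p q. Chord p q \<in># M"
    have "s \<noteq> BlueDiam d" for d using top n noncrossing_sides[OF top(1)] by (auto simp: sides_simps)
    then obtain a where a: "RedDiam a \<in># M" using no top by (cases s) auto
    obtain b where b: "BlueDiam b \<in># M" using no nonred by (cases t) auto
    have "\<exists>d. se = BlueDiam d \<or> se = RedDiam d" "\<exists>d. sf = BlueDiam d \<or> sf = RedDiam d"
      using no se sf by (cases se; cases sf; auto)+
    moreover have "se = BlueDiam e \<or> se = RedDiam e" "sf = BlueDiam f \<or> sf = RedDiam f"
      using touch[OF se] touch[OF sf] n no se(1) sf(1) by auto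
    ultimately have "e = f" using noncrossing_colors[OF b] noncrossing_colors[OF _ a] a b se(1) sf(1) by metis
    then show False using ends by simp
  qed
  then obtain p q where pq: "Chord p q \<in># M" by blast
  \<comment> \<open>If \<open>e\<close> is touched by a diameter, noncrossing gives
    \<open>q - n \<le> e\<close> for the wrapping chord found above, and \<open>e\<close> is
    minimal.\<close>
  have "\<exists>p. Chord p (e + int n) \<in># M"
    using touch[OF se n(1,2)]
  proof (elim disjE exE)
    assume "se = BlueDiam e"
    then have "q - int n \<le> e" using noncrossing_wrap_diameter[OF pq] chord[OF pq] se by auto
    then have "q = e + int n" using chord[OF pq] by auto
    then show ?thesis using pq by auto
  next
    assume "se = RedDiam e"
    then have "q - int n \<le> e" using noncrossing_wrap_diameter[OF pq] chord[OF pq] se by auto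
    then have "q = e + int n" using chord[OF pq] by auto
    then show ?thesis using pq by auto
  next
    fix c assume "se = Chord e c"
    then show ?thesis using chord[of e c] se by auto
  next
    fix a assume "se = Chord a (e + int n)"
    then show ?thesis using se by auto
  qed
  then obtain p1 where p1: "Chord p1 (e + int n) \<in># M" by blast
  have "\<exists>q. Chord f q \<in># M"
    using touch[OF sf n(3,4)]
  proof (elim disjE exE)
    assume "sf = BlueDiam f"
    then have "f \<le> p" using noncrossing_wrap_diameter[OF pq] chord[OF pq] sf by auto
    then have "p = f" using chord[OF pq] by auto
    then show ?thesis using pq by auto
  next
    assume "sf = RedDiam f"
    then have "f \<le> p" using noncrossing_wrap_diameter[OF pq] chord[OF pq] sf by auto
    then have "p = f" using chord[OF pq] by auto
    then show ?thesis using pq by auto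
  next
    fix c assume "sf = Chord f c"
    then show ?thesis using sf by auto
  next
    fix a assume "sf = Chord a (f + int n)"
    then show ?thesis using chord[of a "f + int n"] sf by auto
  qed
  then obtain q2 where q2: "Chord f q2 \<in># M" by blast
  show ?thesis
  proof (cases "p1 = f")
    case True then show ?thesis using p1 by simp
  next
    case False
    then have "p1 < f" using chord[OF p1] by auto
    then have "q2 \<le> e + int n" using noncrossing_wrap_wrap[OF p1 _ q2] chord[OF p1] chord[OF q2] by auto
    then have "q2 = e + int n" using chord[OF q2] by auto
    then show ?thesis using q2 by simp
  qed
qed

end

lemma digit_pos:
  assumes "s \<in> sides n" obtains j where "0 \<le> j" "j < int n" "0 < digit n s j"
  using assms by (cases s) (auto simp: sides_simps)

lemma digit_middle:
  assumes "s \<in> sides n" "int n \<le> j" "j < 2 * int n - 1" "0 < digit n s j"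
  shows "\<exists>b. s = Chord (2 * int n - 2 - j) b \<and> b < int n"
proof (cases s)
  case (Chord a c)
  then have "0 \<le> a" "a < int n" using assms(1) by (simp_all add: sides_simps)
  then have "a \<noteq> j" "c mod int n \<noteq> j" using assms(2) pos_mod_bound[of "int n" c] by linarith+
  then show ?thesis using Chord assms by (auto split: if_splits)
qed (use assms in \<open>auto simp: sides_simps split: if_splits\<close>)

lemma digit_plain:
  assumes "Chord a b \<in> sides n" "b < int n"
  shows "int n \<le> 2 * int n - 2 - a" "2 * int n - 2 - a < 2 * int n - 1" "0 < digit n (Chord a b) (2 * int n - 2 - a)"
  using assms by (auto simp: sides_simps)

text \<open>The common side is described in terms of the digit sums alone. With plain chords present
  it is the one of \<open>last_plain_chord\<close>; otherwise only wrapping chords and diameters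
  remain, and the digits at the vertices and at \<open>2 n - 1\<close> decide.\<close>

lemma common_side:
  assumes M: "noncrossing n M" and M': "noncrossing n M'" and ne: "M \<noteq> {#}"
    and eq: "\<And>j. 0 \<le> j \<Longrightarrow> j < 2 * int n \<Longrightarrow> (\<Sum>s\<in>#M. digit n s j) = (\<Sum>s\<in>#M'. digit n s j)"
  shows "\<exists>s. s \<in># M \<and> s \<in># M'"
proof -
  let ?N = "int n"
  let ?D = "\<lambda>j. \<Sum>s\<in>#M. digit n s j"
  have pos: "(\<exists>s\<in>#M. 0 < digit n s j) \<longleftrightarrow> 0 < ?D j" "(\<exists>s\<in>#M'. 0 < digit n s j) \<longleftrightarrow> 0 < ?D j"
    if "0 \<le> j" "j < 2 * ?N" for j
    using sum_mset_pos_iff[of "\<lambda>s. digit n s j" M] sum_mset_pos_iff[of "\<lambda>s. digit n s j" M'] eq[OF that] by auto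
  show ?thesis
  proof (cases "\<exists>a b. Chord a b \<in># M \<and> b < ?N")
    case True
    have plain_iff: "(\<exists>b. Chord a b \<in># K \<and> b < ?N) \<longleftrightarrow> int n \<le> 2 * ?N - 2 - a \<and> 0 \<le> a \<and> 0 < ?D (2 * ?N - 2 - a)"
      if K: "K = M \<or> K = M'" for K a
    proof -
      have ncK: "noncrossing n K" using K M M' by blast
      show ?thesis
      proof
        assume "\<exists>b. Chord a b \<in># K \<and> b < ?N"
        then obtain b where b: "Chord a b \<in># K" "b < ?N" by blast
        have s: "Chord a b \<in> sides n" using noncrossing_sides[OF ncK b(1)] .
        note d = digit_plain[OF s b(2)]
        moreover have "0 \<le> a" using s by (simp add: sides_simps)
        moreover have "\<exists>s\<in>#K. 0 < digit n s (2 * ?N - 2 - a)" using d(3) b(1) by blast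
        ultimately show "int n \<le> 2 * ?N - 2 - a \<and> 0 \<le> a \<and> 0 < ?D (2 * ?N - 2 - a)"
          using pos[of "2 * ?N - 2 - a"] K by auto
      next
        assume a: "int n \<le> 2 * ?N - 2 - a \<and> 0 \<le> a \<and> 0 < ?D (2 * ?N - 2 - a)"
        then obtain s where s: "s \<in># K" "0 < digit n s (2 * ?N - 2 - a)"
          using pos[of "2 * ?N - 2 - a"] K by auto
        then show "\<exists>b. Chord a b \<in># K \<and> b < ?N"
          using digit_middle[OF noncrossing_sides[OF ncK s(1)] _ _ s(2)] a by auto
      qed
    qed
    let ?P = "{a. \<exists>b. Chord a b \<in># M \<and> b < ?N}"
    have fin: "finite ?P"
      by (rule finite_subset[of _ "{0..?N}"]) (use plain_iff in auto)
    define i where "i = Max ?P"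
    have "i \<in> ?P" unfolding i_def by (rule Max_in[OF fin]) (use True in blast)
    then obtain c where c: "Chord i c \<in># M" "c < ?N" by blast
    then obtain c' where c': "Chord i c' \<in># M'" "c' < ?N" using plain_iff[of M i] plain_iff[of M' i] by blast
    have last: "a \<le> i" if "Chord a b \<in># M" "b < ?N" for a b
      unfolding i_def by (rule Max_ge[OF fin]) (use that in blast)
    have last': "a \<le> i" if "Chord a b \<in># M'" "b < ?N" for a b
    proof -
      have "\<exists>b. Chord a b \<in># M \<and> b < ?N" using that plain_iff[of M a] plain_iff[of M' a] by blast
      then show ?thesis using last by blast
    qed
    have "\<exists>b. Chord i b \<in># M \<and> i < b \<and> b < ?N \<and> (\<exists>s\<in>#M. 0 < digit n s b) \<and>
        (\<forall>e. i < e \<and> e < b \<longrightarrow> \<not> (\<exists>s\<in>#M. 0 < digit n s e))"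
      by (rule last_plain_chord[OF M c]) (rule last)
    then obtain b where b: "Chord i b \<in># M" "i < b" "b < ?N" "\<exists>s\<in>#M. 0 < digit n s b"
      "\<And>e. i < e \<Longrightarrow> e < b \<Longrightarrow> \<not> (\<exists>s\<in>#M. 0 < digit n s e)" by blast
    have "\<exists>b. Chord i b \<in># M' \<and> i < b \<and> b < ?N \<and> (\<exists>s\<in>#M'. 0 < digit n s b) \<and>
        (\<forall>e. i < e \<and> e < b \<longrightarrow> \<not> (\<exists>s\<in>#M'. 0 < digit n s e))"
      by (rule last_plain_chord[OF M' c']) (rule last')
    then obtain b' where b': "Chord i b' \<in># M'" "i < b'" "b' < ?N" "\<exists>s\<in>#M'. 0 < digit n s b'"
      "\<And>e. i < e \<Longrightarrow> e < b' \<Longrightarrow> \<not> (\<exists>s\<in>#M'. 0 < digit n s e)" by blast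
    have "0 \<le> i" using noncrossing_sides[OF M c(1)] by (simp add: sides_simps)
    then have "b = b'" using b b' pos[of b] pos[of b'] by (cases b b' rule: linorder_cases) auto
    then show ?thesis using b(1) b'(1) by blast
  next
    case False
    have noplain: "int n \<le> c" if c: "Chord a c \<in># K" and K: "K = M \<or> K = M'" for K a c
    proof (rule ccontr)
      assume "\<not> int n \<le> c"
      then have cn: "c < ?N" by simp
      have s: "Chord a c \<in> sides n" using noncrossing_sides[of n K] c K M M' by blast
      note d = digit_plain[OF s cn]
      have "\<exists>s\<in>#K. 0 < digit n s (2 * ?N - 2 - a)" using d(3) c by blast
      then have "\<exists>s\<in>#M. 0 < digit n s (2 * ?N - 2 - a)" using pos[of "2 * ?N - 2 - a"] d(1,2) K by auto
      then obtain s where "s \<in># M" "0 < digit n s (2 * ?N - 2 - a)" by blast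
      then show False using digit_middle[OF noncrossing_sides[OF M] d(1,2)] False by blast
    qed
    have sides: "s \<in> sides n" if "s \<in># K" "K = M \<or> K = M'" for s K
      using that noncrossing_sides M M' by blast
    obtain s0 where s0: "s0 \<in># M" using ne by blast
    have n: "0 < n" using sides[OF s0] by (cases n) (auto simp: sides_def)
    \<comment> \<open>A wrapping chord has two vertex digits and a diameter one; the top digit
      counts wrapping chords and red diameters. The difference is the number of sides that are not
      red, which is therefore the same for both multisets.\<close>
    define nonred where "nonred s = (if \<exists>a. s = RedDiam a then 0 else 1 :: nat)" for s
    have tot: "(\<Sum>j\<in>{0..<?N}. digit n s j) = digit n s (2 * ?N - 1) + nonred s" if s: "s \<in># K" "K = M \<or> K = M'" for s K
    proof (cases s)
      case (Chord a c)
      have ac: "0 \<le> a" "a < ?N" "a < c" "c < a + ?N" "?N \<le> c"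
        using sides[OF s] noplain[of a c K] s Chord by (auto simp: sides_simps)
      then have "(\<Sum>j\<in>{0..<?N}. digit n s j) = (\<Sum>j\<in>{0..<?N}. of_bool (j = a)) + (\<Sum>j\<in>{0..<?N}. of_bool (j = c - ?N))"
        unfolding Chord sum.distrib[symmetric] by (intro sum.cong refl) (auto simp: wrap_mod)
      then show ?thesis using ac Chord by (simp add: wrap_mod of_bool_def nonred_def)
    next
      case (BlueDiam a)
      then show ?thesis using sides[OF s] by (simp add: sides_simps of_bool_def nonred_def)
    next
      case (RedDiam a)
      then have a: "0 \<le> a" "a < ?N" using sides[OF s] by (auto simp: sides_simps)
      then have "(\<Sum>j\<in>{0..<?N}. digit n s j) = (\<Sum>j\<in>{0..<?N}. of_bool (j = a))"
        unfolding RedDiam by (intro sum.cong refl) auto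
      then show ?thesis using a RedDiam by (simp add: of_bool_def nonred_def)
    qed
    have total: "(\<Sum>j\<in>{0..<?N}. \<Sum>s\<in>#K. digit n s j) = (\<Sum>s\<in>#K. digit n s (2 * ?N - 1)) + (\<Sum>s\<in>#K. nonred s)"
      if K: "K = M \<or> K = M'" for K
    proof -
      have "(\<Sum>j\<in>{0..<?N}. \<Sum>s\<in>#L. digit n s j) = (\<Sum>s\<in>#L. digit n s (2 * ?N - 1)) + (\<Sum>s\<in>#L. nonred s)"
        if "set_mset L \<subseteq> set_mset K" for L
        using that by (induction L) (auto simp: sum.distrib tot[OF _ K])
      then show ?thesis by blast
    qed
    have "(\<Sum>j\<in>{0..<?N}. \<Sum>s\<in>#M. digit n s j) = (\<Sum>j\<in>{0..<?N}. \<Sum>s\<in>#M'. digit n s j)"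
      using eq by (intro sum.cong) auto
    then have E: "(\<Sum>s\<in>#M. nonred s) = (\<Sum>s\<in>#M'. nonred s)" using total[of M] total[of M'] eq[of "2 * ?N - 1"] n by simp
    \<comment> \<open>Without top digits all sides are blue, without nonred sides all are red; in
      both cases one vertex digit names a common side.\<close>
    consider "?D (2 * ?N - 1) = 0" | "(\<Sum>s\<in>#M. nonred s) = 0"
      | "0 < ?D (2 * ?N - 1)" "0 < (\<Sum>s\<in>#M. nonred s)" by linarith
    then show ?thesis
    proof cases
      case 1
      have blue: "\<exists>a. s = BlueDiam a" if s: "s \<in># K" "K = M \<or> K = M'" for s K
      proof -
        have "digit n s (2 * ?N - 1) = 0"
          using pos[of "2 * ?N - 1"] 1 s n by force
        then show ?thesis
        proof (cases s)
          case (Chord a c)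
          then have "int n \<le> c" using noplain[of a c K] s by simp
          then show ?thesis using Chord \<open>digit n s (2 * ?N - 1) = 0\<close> by simp
        qed (use \<open>digit n s (2 * ?N - 1) = 0\<close> in auto)
      qed
      obtain a where a: "s0 = BlueDiam a" using blue s0 by blast
      have a0: "0 \<le> a" "a < ?N" using sides[OF s0] a by (auto simp: sides_simps)
      have "0 < digit n s0 a" using a by simp
      then obtain s where s: "s \<in># M'" "0 < digit n s a" using pos[of a] a0 s0 by auto
      then have "s = s0" using blue[OF s(1)] a by (auto split: if_splits)
      then show ?thesis using s s0 by blast
    next
      case 2
      have red: "\<exists>a. s = RedDiam a" if s: "s \<in># K" "K = M \<or> K = M'" for s K
      proof -
        have "(\<Sum>s\<in>#K. nonred s) = 0" using 2 E s(2) by metis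
        then have "\<not> 0 < nonred s" using sum_mset_pos_iff[of nonred K] s(1) by auto
        then show ?thesis by (simp add: nonred_def split: if_splits)
      qed
      obtain a where a: "s0 = RedDiam a" using red s0 by blast
      have a0: "0 \<le> a" "a < ?N" using sides[OF s0] a by (auto simp: sides_simps)
      have "0 < digit n s0 a" using a by simp
      then obtain s where s: "s \<in># M'" "0 < digit n s a" using pos[of a] a0 s0 by auto
      then obtain b where b: "s = RedDiam b" using red by blast
      then have "s = s0" using s a a0 by (auto split: if_splits)
      then show ?thesis using s s0 by blast
    next
      case 3
      let ?S = "{j. 0 \<le> j \<and> j < ?N \<and> 0 < ?D j}"
      have fin: "finite ?S" by (rule finite_subset[of _ "{0..<?N}"]) auto
      obtain j where "0 \<le> j" "j < ?N" "0 < digit n s0 j" using sides[OF s0] by (auto elim: digit_pos)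
      then have "?S \<noteq> {}" using pos[of j] s0 by auto
      define e f where "e = Min ?S" and "f = Max ?S"
      have "e \<in> ?S" "f \<in> ?S" unfolding e_def f_def
        using Min_in[OF fin \<open>?S \<noteq> {}\<close>] Max_in[OF fin \<open>?S \<noteq> {}\<close>] by blast+
      then have ef: "0 \<le> e" "e < ?N" "0 < ?D e" "0 \<le> f" "f < ?N" "0 < ?D f" by auto
      have bounds: "e \<le> d \<and> d \<le> f" if d: "s \<in># K" "0 \<le> d" "d < ?N" "0 < digit n s d" "K = M \<or> K = M'" for K s d
      proof -
        have "0 < ?D d" using pos[of d] d by auto
        then have "d \<in> ?S" using d by simp
        then show ?thesis unfolding e_def f_def using Min_le[OF fin] Max_ge[OF fin] by blast
      qed
      have member: "(if e = f then RedDiam e else Chord f (e + ?N)) \<in># K" if K: "K = M \<or> K = M'" for K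
      proof -
        have ncK: "noncrossing n K" using K M M' by blast
        obtain s where s: "s \<in># K" "0 < digit n s (2 * ?N - 1)"
          using pos[of "2 * ?N - 1"] 3(1) n K by auto
        have "0 < (\<Sum>s\<in>#K. nonred s)" using 3(2) E K by auto
        then have "\<exists>t\<in>#K. 0 < nonred t" unfolding sum_mset_pos_iff .
        then obtain t where t: "t \<in># K" "0 < nonred t" by blast
        show ?thesis
        proof (cases "e = f")
          case True
          have d: "d = e" if "0 < digit n s d" "0 \<le> d" "d < ?N" for d
            using bounds[OF s(1) that(2,3,1) K] True by simp
          \<comment> \<open>Only one vertex is occupied, while a wrapping chord has two different
            ends modulo \<open>n\<close>; so the side with a top digit is red.\<close>
          have "s = RedDiam e"
          proof (cases s)
            case (Chord a c)
            have ac: "0 \<le> a" "a < ?N" "a < c" "c < a + ?N" "?N \<le> c"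
              using sides[OF s(1) K] noplain[of a c K] s K Chord by (auto simp: sides_simps)
            then show ?thesis using d[of a] d[of "c - ?N"] Chord by (simp add: wrap_mod)
          next
            case (BlueDiam a)
            then show ?thesis using s sides[OF s(1) K] by (auto simp: sides_simps split: if_splits)
          next
            case (RedDiam a)
            then show ?thesis using d[of a] sides[OF s(1) K] by (auto simp: sides_simps)
          qed
          then show ?thesis using s True by simp
        next
          case False
          have "e \<le> f" using Min_le[OF fin \<open>f \<in> ?S\<close>] by (simp add: e_def)
          have "Chord f (e + ?N) \<in># K"
          proof (rule outermost_chord[OF ncK _ ef(1) _ ef(5) _ _ _ s t(1)])
            show "int n \<le> c" if "Chord a c \<in># K" for a c using noplain[OF that K] .
            show "e < f" using False \<open>e \<le> f\<close> by simp
            show "\<exists>s\<in>#K. 0 < digit n s e" "\<exists>s\<in>#K. 0 < digit n s f"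
              using pos[of e] pos[of f] ef K by auto
            show "e \<le> d \<and> d \<le> f" if "s \<in># K" "0 \<le> d" "d < ?N" "0 < digit n s d" for s d
              using bounds[OF that K] .
            show "t \<noteq> RedDiam a" for a using t(2) by (auto simp: nonred_def)
          qed
          then show ?thesis using False by simp
        qed
      qed
      then show ?thesis by blast
    qed
  qed
qed

theorem noncrossing_eqI:
  assumes "noncrossing n M" "noncrossing n M'"
    and "\<And>j. 0 \<le> j \<Longrightarrow> j < 2 * int n \<Longrightarrow> (\<Sum>s\<in>#M. digit n s j) = (\<Sum>s\<in>#M'. digit n s j)"
  shows "M = M'"
  using assms
proof (induction "size M" arbitrary: M M')
  case 0
  then have "M = {#}" by simp
  moreover have False if "s \<in># M'" for s
  proof -
    from noncrossing_sides[OF 0(3) that] obtain j where j: "0 \<le> j" "j < int n" "0 < digit n s j"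
      by (rule digit_pos)
    have "0 < (\<Sum>s\<in>#M'. digit n s j)" unfolding sum_mset_pos_iff using that j(3) by blast
    also have "\<dots> = (\<Sum>s\<in>#M. digit n s j)" using 0(4)[of j] j by simp
    also have "\<dots> = 0" by (simp add: \<open>M = {#}\<close>)
    finally show False by simp
  qed
  ultimately show ?case by (metis multiset_nonemptyE)
next
  case (Suc k)
  then have "M \<noteq> {#}" by auto
  then obtain s where s: "s \<in># M" "s \<in># M'" using common_side[OF Suc.prems(1,2) _ Suc.prems(3)] by blast
  then obtain L L' where L: "M = add_mset s L" "M' = add_mset s L'" by (metis multi_member_split)
  have "L = L'"
  proof (rule Suc.hyps(1))
    show "k = size L" using Suc.hyps(2) L by simp
    show "noncrossing n L" "noncrossing n L'" using Suc.prems(1,2) L by (auto simp: noncrossing_def)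
    show "(\<Sum>s\<in>#L. digit n s j) = (\<Sum>s\<in>#L'. digit n s j)" if "0 \<le> j" "j < 2 * int n" for j
      using Suc.prems(3)[OF that] L by simp
  qed
  then show ?case using L by simp
qed

section \<open>The algebra in the polygon model\<close>

text \<open>A crossing needs a vertex strictly inside the minor arc, and the arc of an edge has
  none.\<close>

lemma crossing_not_edge:
  assumes "2 \<le> n" "k \<in> label_of n ` sides n" "label_crossing n (lab n i (i + 1)) k"
  shows False
proof -
  have i: "i < i + 1" "i + 1 < i + int n" using assms(1) by simp_all
  have no_inner: "\<not> (p < q \<and> q < r)" if eq: "lab n i (i + 1) = lab n p r" and pr: "p < r" "r < p + int n" for p q r
  proof -
    from eq obtain k where "p = i + int n * k" "r = i + 1 + int n * k"
      using lab_eq_iff_minor[OF i pr] by blast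
    then show ?thesis by linarith
  qed
  have diam: False if "chord_crossing n (chord n a (a + int n)) c" "c \<in> {chord n i (i + 1), chord n (i + int n) (i + 1 + int n)}" for a c
  proof -
    have "\<exists>j. c = chord n j (j + 1) \<and> lab n j (j + 1) = lab n i (i + 1)"
    proof -
      from that(2) consider "c = chord n i (i + 1)" | "c = chord n (i + int n) (i + 1 + int n)" by blast
      then show ?thesis
      proof cases
        case 2
        then have "c = chord n (i + int n) (i + int n + 1)" by (simp only: ac_simps)
        moreover have "lab n (i + int n) (i + int n + 1) = lab n i (i + 1)"
          using lab_shift[of n i "i + 1"] by (simp only: ac_simps)
        ultimately show ?thesis by blast
      qed blast
    qed
    then obtain j where j: "c = chord n j (j + 1)" "lab n j (j + 1) = lab n i (i + 1)" by blast
    have "j < j + 1" "j + 1 < j + int n" using assms(1) by simp_all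
    with that(1)[unfolded j(1)] obtain p f q k where "p < f" "f < q" "q < p + int n" "lab n j (j + 1) = lab n p q"
      by (rule chord_crossing_diameterE)
    then show False using no_inner[of p q f] j(2) by auto
  qed
  obtain s where s: "s \<in> sides n" "k = label_of n s" using assms(2) by blast
  show False
  proof (cases s)
    case (Chord b d)
    then have bd: "b < d" "d < b + int n" using s by (auto simp: sides_simps)
    have "label_crossing n (lab n i (i + 1)) (lab n b d)" using assms(3) s Chord by simp
    then show False
    proof (rule label_crossing_lab_labE[OF _ i bd])
      fix p q r s' assume "p < q" "q < r" "r < p + int n" "lab n i (i + 1) = lab n p r"
      then show False using no_inner[of p r q] by auto
    next
      fix p q r s' assume "q < r" "r < s'" "s' < q + int n" "lab n i (i + 1) = lab n q s'"
      then show False using no_inner[of q s' r] by auto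
    qed
  next
    case (BlueDiam a)
    then have "label_crossing n (blue n a) (lab n i (i + 1))"
      using assms(3) s label_crossing_commute by simp
    then show False using diam[of a] by (auto simp: lab_minor[OF i])
  next
    case (RedDiam a)
    then have "label_crossing n (red n a) (lab n i (i + 1))"
      using assms(3) s label_crossing_commute by simp
    then show False using diam[of a] by (auto simp: lab_minor[OF i])
  qed
qed

text \<open>Maximality: the blue diameter at \<open>a + 1\<close> crosses the red diameter at
  \<open>a\<close> and every nondiameter diagonal \<open>[a, c]\<close>.\<close>

lemma blue_triangulation:
  assumes "2 \<le> n" shows "range (blue n) \<in> colored_triangulations n"
proof -
  have "\<exists>k\<in>range (blue n). label_crossing n k l" if l: "l \<in> diagonal_labels n" "l \<notin> range (blue n)" for l
  proof -
    from l assms consider a c where "a + 2 \<le> c" "c < a + int n" "l = lab n a c" | a where "l = red n a"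
      by (auto simp: diagonal_labels_eq)
    then show ?thesis
    proof cases
      case 1
      then have "label_crossing n (blue n (a + 1)) (lab n a c)" by (intro label_crossing_diameterI) auto
      then show ?thesis using 1 by blast
    next
      case 2
      have "chord n (a + 1) (a + 1 + int n) \<noteq> chord n a (a + int n)"
      proof
        assume "chord n (a + 1) (a + 1 + int n) = chord n a (a + int n)"
        then obtain k where "a = a + 1 + int n * k" using assms chord_diameter_eq_iff[of n "a + 1" a] by auto
        then have "int n * (- k) = 1" by (simp add: algebra_simps)
        then have "int n dvd 1" by (metis dvd_triv_left)
        then show False using assms by simp
      qed
      then have "label_crossing n (blue n (a + 1)) (red n a)" by simp
      then show ?thesis using 2 by blast
    qed
  qed
  moreover have "range (blue n) \<subseteq> diagonal_labels n" using diagonal_labels_eq[OF assms] by blast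
  ultimately show ?thesis unfolding colored_triangulations_def by auto
qed

text \<open>The definition of \<open>colored_triangulations\<close> also compares a label with
  itself, so enlarging a set by \<open>l\<close> uses \<open>self\<close>. It is obtained later from
  the fact that every diagonal lies in some triangulation.\<close>

lemma extend_to_triangulation:
  assumes "2 \<le> n" "S \<subseteq> diagonal_labels n" "\<And>k l. k \<in> S \<Longrightarrow> l \<in> S \<Longrightarrow> \<not> label_crossing n k l"
    and self: "\<And>l. l \<in> diagonal_labels n \<Longrightarrow> \<not> label_crossing n l l"
  obtains T where "T \<in> colored_triangulations n" "S \<subseteq> T"
proof -
  let ?F = "{T. T \<subseteq> diagonal_labels n \<and> (\<forall>k\<in>T. \<forall>l\<in>T. \<not> label_crossing n k l)}"
  have "finite ?F"
    by (rule finite_subset[of _ "Pow (diagonal_labels n)"]) (use finite_diagonal_labels[OF assms(1)] in auto)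
  moreover have "S \<in> ?F" using assms(2,3) by blast
  ultimately have "\<exists>T\<in>?F. S \<subseteq> T \<and> (\<forall>T'\<in>?F. T \<subseteq> T' \<longrightarrow> T = T')" by (rule finite_has_maximal2)
  then obtain T where T: "T \<in> ?F" "S \<subseteq> T" and max: "\<And>T'. T' \<in> ?F \<Longrightarrow> T \<subseteq> T' \<Longrightarrow> T = T'"
    by (elim bexE conjE) simp
  have "\<exists>k\<in>T. label_crossing n k l" if l: "l \<in> diagonal_labels n - T" for l
  proof (rule ccontr)
    assume no: "\<not> (\<exists>k\<in>T. label_crossing n k l)"
    then have "insert l T \<in> ?F" using T(1) l self label_crossing_commute by blast
    then show False using max[of "insert l T"] l by blast
  qed
  then have "T \<in> colored_triangulations n" using T(1) unfolding colored_triangulations_def by blast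
  then show thesis using T(2) that by blast
qed

locale polygon_model = polygon_model_D \<iota> I J s\<^sub>0 n x
  for \<iota> :: "'k::field_char_0 \<Rightarrow> 'f::field" and I J :: "'i set" and s\<^sub>0 :: "('i, 'f) seed"
    and n :: nat and x :: "label \<Rightarrow> 'f" +
  assumes n3: "3 \<le> n"
begin

lemma n2: "2 \<le> n" using n3 by simp

lemma generators_eq: "generators = x ` label_of n ` sides n"
proof -
  have "x ` (diagonal_labels n \<union> edge_labels n) = generators"
    using bij_cluster_variables bij_frozen_variables by (simp add: bij_betw_def image_Un)
  then show ?thesis by (simp only: labels_eq[OF n2])
qed

sublocale labelling n x
proof
  show "2 \<le> n" by (rule n2)
  have "inj_on x (diagonal_labels n)" "inj_on x (edge_labels n)"
    "x ` diagonal_labels n \<inter> x ` edge_labels n = {}"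
    using bij_cluster_variables bij_frozen_variables cluster_variables_not_frozen by (auto simp: bij_betw_def)
  then have "inj_on x (diagonal_labels n \<union> edge_labels n)" unfolding inj_on_Un by blast
  then show "inj_on x (label_of n ` sides n)" by (simp add: labels_eq[OF n2])
qed

section \<open>Coordinates relative to the cluster of blue diameters\<close>

definition B :: "int \<Rightarrow> 'f" where "B a = x (blue n a)"
definition R :: "int \<Rightarrow> 'f" where "R a = x (red n a)"
definition X :: "int \<Rightarrow> int \<Rightarrow> 'f" where "X a c = x (lab n a c)"

lemma B_shift: "B (a + int n) = B a" and R_shift: "R (a + int n) = R a"
  and X_shift: "X (a + int n) (c + int n) = X a c"
  unfolding B_def R_def X_def blue_shift red_shift lab_shift by (rule refl)+

lemma X_antipodal: "X a (c + int n) = X c (a + int n)"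
proof -
  have "lab n a (c + int n) = lab n (a + int n) (c + int n + int n)" by (simp only: lab_shift)
  also have "\<dots> = lab n c (a + int n)" by (simp only: lab_shift_right lab_commute)
  finally show ?thesis by (simp add: X_def)
qed

lemma generator_mems: "B a \<in> generators" "R a \<in> generators"
  "a < c \<Longrightarrow> c < a + int n \<Longrightarrow> X a c \<in> generators"
  unfolding generators_eq B_def R_def X_def using label_mems by blast+

lemma polygon_relation_exchange:
  assumes "(L, {# P, Q #}) \<in> polygon_relations n"
  shows "(image_mset x L, {# image_mset x P, image_mset x Q #}) \<in> exchange_relations"
  unfolding exchange_relations_eq using assms by (intro image_eqI[of _ _ "(L, {# P, Q #})"]) auto

lemma polygon_relation_product:
  assumes "(L, {# P, Q #}) \<in> polygon_relations n"
  shows "(\<Prod>l\<in>#L. x l) = (\<Prod>l\<in>#P. x l) + (\<Prod>l\<in>#Q. x l)"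
  using exchange_relation_product[OF polygon_relation_exchange[OF assms]] by simp

lemma blue_red_relation:
  assumes "a < b" "b < a + int n"
  shows "B a * R b = X a b + X b (a + int n)"
proof -
  have "({# blue n a, red n b #}, {# {# lab n a b #}, {# lab n a (b + int n) #} #}) \<in> polygon_relations n"
    unfolding polygon_relations_def using assms by blast
  from polygon_relation_product[OF this] show ?thesis
    using X_antipodal[of a b] by (simp add: B_def R_def X_def)
qed

lemma blue_chord_relation:
  assumes "a < b" "b < c" "c < a + int n"
  shows "B a * X c (b + int n) = X a b * B c + X c (a + int n) * B b"
proof -
  have "({# blue n a, lab n b (c + int n) #},
       {# {# lab n a b, blue n c #}, {# lab n a (c + int n), blue n b #} #}) \<in> polygon_relations n"
    unfolding polygon_relations_def using assms by blast
  from polygon_relation_product[OF this] show ?thesis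
    using X_antipodal[of b c] X_antipodal[of a c] by (simp add: B_def X_def)
qed

definition base :: "'f set" where "base = range B \<union> range (\<lambda>i. X i (i + 1))"

lemma base_indep: "alg_indep \<iota> base"
proof -
  have "x ` range (blue n) \<in> clusters" unfolding clusters_eq using blue_triangulation[OF n2] by blast
  then obtain s where s: "s \<in> seeds" "x ` range (blue n) = fst s ` I" by (auto simp: clusters_def)
  have "fst s ` J = frozen_variables" using seed_invariants(4)[OF s(1)] by (simp add: frozen_variables_def)
  moreover have "frozen_variables = range (\<lambda>i. X i (i + 1))"
    using bij_frozen_variables by (auto simp: bij_betw_def edge_labels_eq X_def)
  moreover have "x ` range (blue n) = range B" by (auto simp: B_def)
  ultimately have "base = fst s ` (I \<union> J)" using s(2) by (simp add: base_def image_Un)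
  then show ?thesis using seed_invariants(3)[OF s(1)] by simp
qed

lemma base_nonzero: "y \<in> base \<Longrightarrow> y \<noteq> 0"
  using alg_indep_nonzero[OF coeff_hom base_indep] .

lemma B_nonzero: "B a \<noteq> 0" and X_edge_nonzero: "X i (i + 1) \<noteq> 0"
  using base_nonzero by (auto simp: base_def)

text \<open>Dividing the polygon by the half turn gives an \<open>n\<close>-gon with a puncture, and
  blue diameters become arcs to the puncture. In terms of lambda lengths, \<delta> i is the length
  of the horocycle at the puncture inside the triangle with opposite side \<open>[i, i + 1]\<close>;
  such lengths add up.\<close>

definition \<delta> :: "int \<Rightarrow> 'f" where "\<delta> i = X i (i + 1) / (B i * B (i + 1))"

definition S :: "int \<Rightarrow> int \<Rightarrow> 'f" where "S a c = (\<Sum>i\<in>{a..<c}. \<delta> i)"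

lemma \<delta>_shift: "\<delta> (i + int n) = \<delta> i"
  using X_shift[of i "i + 1"] B_shift[of i] B_shift[of "i + 1"] by (simp add: \<delta>_def ac_simps)

lemma \<delta>_nonzero: "\<delta> i \<noteq> 0"
  by (simp add: \<delta>_def B_nonzero X_edge_nonzero)

lemma S_add: "a \<le> b \<Longrightarrow> b \<le> c \<Longrightarrow> S a c = S a b + S b c"
  unfolding S_def by (subst sum.union_disjoint[symmetric]) (auto simp: ivl_disj_un)

lemma S_shift: "S (a + int n) (c + int n) = S a c"
  unfolding S_def
  by (rule sum.reindex_bij_witness[of _ "\<lambda>i. i + int n" "\<lambda>i. i - int n"])
    (use \<delta>_shift[of "i - int n" for i] in auto)

lemma S_single: "S a (a + 1) = \<delta> a"
proof -
  have "{a..<a + 1} = {a}" by auto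
  then show ?thesis by (simp add: S_def)
qed

lemma X_eq: "a < c \<Longrightarrow> c < a + int n \<Longrightarrow> X a c = B a * B c * S a c"
proof (induction c rule: int_gr_induct)
  case base
  then show ?case using B_nonzero by (simp add: S_single \<delta>_def)
next
  case (step c)
  \<comment> \<open>The relation between the blue diameter at \<open>c\<close> and the chord
    \<open>[a, c + 1]\<close>; the shift by \<open>- n\<close> brings the ends into the order
    required by \<open>blue_chord_relation\<close>.\<close>
  have "B c * X a (c + 1) = X c (c + 1) * B a + X a c * B (c + 1)"
    using blue_chord_relation[of "c - int n" "c + 1 - int n" a] step B_shift[of "c - int n"]
      B_shift[of "c + 1 - int n"] X_shift[of "c - int n" "c + 1 - int n"] by (simp add: algebra_simps)
  also have "X a c = B a * B c * S a c" using step by simp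
  also have "X c (c + 1) = B c * B (c + 1) * S c (c + 1)" using B_nonzero by (simp add: S_single \<delta>_def)
  finally have "B c * X a (c + 1) = B c * (B a * B (c + 1) * (S a c + S c (c + 1)))"
    by (simp add: algebra_simps)
  then show ?case using B_nonzero[of c] S_add[of a c "c + 1"] step by simp
qed

lemma R_eq: "R a = B a * S a (a + int n)"
proof -
  have n: "1 < int n" using n3 by simp
  \<comment> \<open>The blue diameter at \<open>a - 1\<close> splits the full turn starting at
    \<open>a\<close> into its last gap and the rest.\<close>
  have "B (a - 1) * R a = X (a - 1) a + X a (a - 1 + int n)"
    using blue_red_relation[of "a - 1" a] n by simp
  also have "X (a - 1) a = B (a - 1) * B a * S (a - 1) a" using X_eq[of "a - 1" a] n by simp
  also have "S (a - 1) a = S (a - 1 + int n) (a + int n)" using S_shift[of "a - 1" a] by simp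
  also have "X a (a - 1 + int n) = B a * B (a - 1) * S a (a - 1 + int n)"
    using X_eq[of a "a - 1 + int n"] n B_shift[of "a - 1"] by simp
  finally have "B (a - 1) * R a = B (a - 1) * (B a * (S a (a - 1 + int n) + S (a - 1 + int n) (a + int n)))"
    by (simp add: algebra_simps)
  then show ?thesis using B_nonzero[of "a - 1"] S_add[of a "a - 1 + int n" "a + int n"] n by simp
qed

section \<open>Crossing products as sums of lighter monomials\<close>

definition D :: "('f \<Rightarrow>\<^sub>0 real) \<Rightarrow> int \<Rightarrow> int \<Rightarrow> real" where
  "D \<omega> a c = (if c = a + int n then lookup \<omega> (B a) + lookup \<omega> (R a) else lookup \<omega> (X a c))"

abbreviation strict :: "('f \<Rightarrow>\<^sub>0 real) \<Rightarrow> bool" where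
  "strict \<omega> \<equiv> strict_weight (int n) (D \<omega>) (\<lambda>a. lookup \<omega> (B a)) (\<lambda>a. lookup \<omega> (R a))"

text \<open>One expression serves all strict weights, since it is used both for the given weight and
  for the integral weight that makes rewriting stop. The outer multiset allows the coefficient
  \<open>2\<close> that occurs for doubly crossing chords.\<close>

definition lower_expression :: "'f \<Rightarrow> 'f \<Rightarrow> 'f multiset multiset \<Rightarrow> bool" where
  "lower_expression v w E \<longleftrightarrow> (\<forall>e\<in>#E. set_mset e \<subseteq> generators) \<and> v * w = (\<Sum>e\<in>#E. prod_mset e) \<and>
     (\<forall>\<omega>. strict \<omega> \<longrightarrow> (\<forall>e\<in>#E. (\<Sum>u\<in>#e. lookup \<omega> u) < lookup \<omega> v + lookup \<omega> w))"

lemma lower_expressionI: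
  assumes "\<And>e. e \<in># E \<Longrightarrow> set_mset e \<subseteq> generators" "v * w = (\<Sum>e\<in>#E. prod_mset e)"
    and "\<And>\<omega> e. strict \<omega> \<Longrightarrow> e \<in># E \<Longrightarrow> (\<Sum>u\<in>#e. lookup \<omega> u) < lookup \<omega> v + lookup \<omega> w"
  shows "\<exists>E. lower_expression v w E"
  using assms unfolding lower_expression_def by blast

lemma lower_expression_commute: "lower_expression v w E \<Longrightarrow> lower_expression w v E"
  by (simp add: lower_expression_def mult.commute add.commute)

lemma chord_chord_expression:
  assumes "a < b" "b < c" "c < d" "c < a + int n" "d < b + int n"
  shows "\<exists>E. lower_expression (X a c) (X b d) E"
proof -
  have eqs: "X a c = B a * B c * (S a b + S b c)" "X b d = B b * B d * (S b c + S c d)"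
    "X a b = B a * B b * S a b" "X b c = B b * B c * S b c" "X c d = B c * B d * S c d"
    using X_eq[of a c] X_eq[of b d] X_eq[of a b] X_eq[of b c] X_eq[of c d] S_add[of a b c] S_add[of b c d] assms
    by simp_all
  consider "d < a + int n" | "d = a + int n" | "a + int n < d" by linarith
  then show ?thesis
  proof cases
    case 1
    have "X a d = B a * B d * (S a b + S b c + S c d)"
      using X_eq[of a d] S_add[of a b d] S_add[of b c d] assms 1 by (simp add: add.assoc)
    then have prod: "X a c * X b d = X a b * X c d + X a d * X b c" by (simp add: eqs algebra_simps)
    have mems: "X a b \<in> generators" "X c d \<in> generators" "X a d \<in> generators" "X b c \<in> generators"
      using assms 1 by (simp_all add: generator_mems(3) del: Un_iff)
    show ?thesis
    proof (rule lower_expressionI[of "{# {# X a b, X c d #}, {# X a d, X b c #} #}"])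
      fix \<omega> e assume "strict \<omega>"
      note sw = strict_weight.quad_crossing[OF this, of a b c d] strict_weight.quad_parallel[OF this, of a b c d]
      assume "e \<in># {# {# X a b, X c d #}, {# X a d, X b c #} #}"
      then show "(\<Sum>u\<in>#e. lookup \<omega> u) < lookup \<omega> (X a c) + lookup \<omega> (X b d)"
        using sw assms 1 by (auto simp: D_def)
    qed (use mems prod in auto)
  next
    case 2
    have Ra: "R a = B a * (S a b + S b c + S c d)"
      using R_eq[of a] S_add[of a b d] S_add[of b c d] assms 2 by (simp add: add.assoc)
    have "B d = B a" using 2 B_shift[of a] by simp
    then have prod: "X a c * X b d = X a b * X c d + B a * (R a * X b c)"
      by (simp only: eqs Ra) (simp add: algebra_simps)
    have mems: "X a b \<in> generators" "X c d \<in> generators" "X b c \<in> generators"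
      using assms 2 by (simp_all add: generator_mems(3) del: Un_iff)
    show ?thesis
    proof (rule lower_expressionI[of "{# {# X a b, X c d #}, {# B a, R a, X b c #} #}"])
      fix \<omega> e assume "strict \<omega>"
      note sw = strict_weight.quad_crossing[OF this, of a b c d] strict_weight.quad_parallel[OF this, of a b c d]
      assume "e \<in># {# {# X a b, X c d #}, {# B a, R a, X b c #} #}"
      then show "(\<Sum>u\<in>#e. lookup \<omega> u) < lookup \<omega> (X a c) + lookup \<omega> (X b d)"
        using sw assms 2 by (auto simp: D_def)
    qed (use mems generator_mems(1,2)[of a] prod in auto)
  next
    case 3
    \<comment> \<open>The chords cross twice here: the lift \<open>e\<close> antipodal to
      \<open>d\<close> falls between \<open>a\<close> and \<open>b\<close>.\<close>
    define e where "e = d - int n"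
    have d: "d = e + int n" by (simp add: e_def)
    have e: "a < e" "e < b" using assms 3 by (simp_all add: e_def)
    have sums: "S a c = S a e + S e b + S b c" "S b (e + int n) = S b c + S c (a + int n) + S a e"
      "S c (b + int n) = S c (a + int n) + S a e + S e b" "S e (a + int n) = S e b + S b c + S c (a + int n)"
      using S_add[of a e c] S_add[of e b c] S_add[of b c "e + int n"] S_add[of c "a + int n" "e + int n"]
        S_add[of c "a + int n" "b + int n"] S_add[of "a + int n" "e + int n" "b + int n"]
        S_add[of e b "a + int n"] S_add[of b c "a + int n"] S_shift[of a e] S_shift[of e b] e assms
      by (simp_all add: algebra_simps)
    have eqs: "X a c = B a * B c * (S a e + S e b + S b c)"
      "X b (e + int n) = B b * B e * (S b c + S c (a + int n) + S a e)"
      "X c (b + int n) = B c * B b * (S c (a + int n) + S a e + S e b)"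
      "X e (a + int n) = B e * B a * (S e b + S b c + S c (a + int n))"
      "X e b = B e * B b * S e b" "X c (a + int n) = B c * B a * S c (a + int n)"
      "X a e = B a * B e * S a e" "X b c = B b * B c * S b c"
      using X_eq[of a c] X_eq[of b "e + int n"] X_eq[of c "b + int n"] X_eq[of e "a + int n"]
        X_eq[of e b] X_eq[of c "a + int n"] X_eq[of a e] X_eq[of b c] e assms
        B_shift[of e] B_shift[of b] B_shift[of a] unfolding sums by simp_all
    \<comment> \<open>Expansion of the product of two sums of gaps; the monomial
      \<open>X a e * X b c\<close> arises twice.\<close>
    have prod: "X a c * X b d = X e b * X c (a + int n) + X a e * X c (b + int n) + X b c * X e (a + int n)
       + X a e * X b c + X a e * X b c"
      unfolding d eqs by (simp add: algebra_simps)
    have mems: "X e b \<in> generators" "X c (a + int n) \<in> generators" "X a e \<in> generators"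
      "X c (b + int n) \<in> generators" "X b c \<in> generators" "X e (a + int n) \<in> generators"
      using e assms by (simp_all add: generator_mems(3) del: Un_iff)
    let ?E = "{# {# X e b, X c (a + int n) #}, {# X a e, X c (b + int n) #}, {# X b c, X e (a + int n) #},
          {# X a e, X b c #}, {# X a e, X b c #} #}"
    show ?thesis
    proof (rule lower_expressionI[of ?E])
      fix \<omega> f assume "strict \<omega>"
      note sw = strict_weight.double_crossing[OF this e assms(2) assms(4)]
      assume "f \<in># ?E"
      then show "(\<Sum>u\<in>#f. lookup \<omega> u) < lookup \<omega> (X a c) + lookup \<omega> (X b d)"
        using sw assms e by (auto simp: D_def d)
    qed (use mems prod in \<open>auto simp: add.assoc\<close>)
  qed
qed

lemma blue_chord_expression:
  assumes "c < a" "a < b" "b < c + int n"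
  shows "\<exists>E. lower_expression (B a) (X c b) E"
proof -
  have mems: "X a b \<in> generators" "X c a \<in> generators" using assms by (simp_all add: generator_mems(3) del: Un_iff)
  have prod: "B a * X c b = X a b * B c + X c a * B b"
    using assms X_eq[of c b] X_eq[of a b] X_eq[of c a] S_add[of c a b] by (simp add: algebra_simps)
  show ?thesis
  proof (rule lower_expressionI[of "{# {# X a b, B c #}, {# X c a, B b #} #}"])
    fix \<omega> e assume "strict \<omega>"
    note sw = strict_weight.diameter_crossing[OF this assms]
    assume "e \<in># {# {# X a b, B c #}, {# X c a, B b #} #}"
    then show "(\<Sum>u\<in>#e. lookup \<omega> u) < lookup \<omega> (B a) + lookup \<omega> (X c b)"
      using sw assms by (auto simp: D_def)
  qed (use mems generator_mems(1)[of b] generator_mems(1)[of c] prod in auto)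
qed

text \<open>The total length around the puncture does not depend on the starting point. So red
  diameters are blue ones times a common factor, and the red chord relation is a multiple of the
  blue one.\<close>

lemma S_period:
  assumes "c \<le> a" "a \<le> c + int n" shows "S a (a + int n) = S c (c + int n)"
  using S_add[of c a "c + int n"] S_add[of a "c + int n" "a + int n"] S_shift[of c a] assms by simp

lemma red_chord_expression:
  assumes "c < a" "a < b" "b < c + int n"
  shows "\<exists>E. lower_expression (R a) (X c b) E"
proof -
  have R: "R a = B a * S c (c + int n)" "R b = B b * S c (c + int n)" "R c = B c * S c (c + int n)"
    using R_eq[of a] R_eq[of b] R_eq[of c] S_period[of c a] S_period[of c b] assms by simp_all
  have mems: "X a b \<in> generators" "X c a \<in> generators" using assms by (simp_all add: generator_mems(3) del: Un_iff)
  have prod: "R a * X c b = X a b * R c + X c a * R b"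
    using assms X_eq[of c b] X_eq[of a b] X_eq[of c a] S_add[of c a b] by (simp add: R algebra_simps)
  show ?thesis
  proof (rule lower_expressionI[of "{# {# X a b, R c #}, {# X c a, R b #} #}"])
    fix \<omega> e assume "strict \<omega>"
    note sw = strict_weight.diameter_crossing[OF strict_weight.swap[OF this] assms]
    assume "e \<in># {# {# X a b, R c #}, {# X c a, R b #} #}"
    then show "(\<Sum>u\<in>#e. lookup \<omega> u) < lookup \<omega> (R a) + lookup \<omega> (X c b)"
      using sw assms by (auto simp: D_def)
  qed (use mems generator_mems(2)[of b] generator_mems(2)[of c] prod in auto)
qed

lemma blue_red_expression:
  assumes "a < b" "b < a + int n"
  shows "\<exists>E. lower_expression (B a) (R b) E"
proof -
  have mems: "X a b \<in> generators" "X b (a + int n) \<in> generators"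
    using assms by (simp_all add: generator_mems(3) del: Un_iff)
  show ?thesis
  proof (rule lower_expressionI[of "{# {# X a b #}, {# X b (a + int n) #} #}"])
    fix \<omega> e assume "strict \<omega>"
    note sw = strict_weight.blue_red_near[OF this assms] strict_weight.blue_red_far[OF this assms]
    assume "e \<in># {# {# X a b #}, {# X b (a + int n) #} #}"
    then show "(\<Sum>u\<in>#e. lookup \<omega> u) < lookup \<omega> (B a) + lookup \<omega> (R b)"
      using sw assms by (auto simp: D_def)
  qed (use mems blue_red_relation[OF assms] in auto)
qed

section \<open>Compatibility\<close>

text \<open>Every cluster variable lies in a cluster and \<open>x\<close> is injective on diagonals.
  In particular no diagonal crosses itself.\<close>

lemma diagonal_in_triangulation:
  assumes "l \<in> diagonal_labels n" obtains T where "T \<in> colored_triangulations n" "l \<in> T"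
proof -
  have "x l \<in> cluster_variables" using bij_cluster_variables assms by (auto simp: bij_betw_def)
  then obtain T where T: "T \<in> colored_triangulations n" "x l \<in> x ` T"
    unfolding cluster_variables_def clusters_eq by blast
  then have "T \<subseteq> diagonal_labels n" by (auto simp: colored_triangulations_def)
  then have "l \<in> T"
    using T(2) assms bij_cluster_variables by (auto simp: bij_betw_def dest: inj_onD)
  with T(1) show thesis by (rule that)
qed

text \<open>Clusters correspond to the maximal sets of pairwise noncrossing labels, and every
  noncrossing pair extends to such a set.\<close>

lemma incompatible_iff:
  assumes kl: "k \<in> diagonal_labels n" "l \<in> diagonal_labels n"
  shows "incompatible (x k) (x l) \<longleftrightarrow> label_crossing n k l"
proof -
  have mem: "x m \<in> x ` T \<longleftrightarrow> m \<in> T" if "m \<in> diagonal_labels n" "T \<in> colored_triangulations n" for m T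
  proof -
    have "T \<subseteq> diagonal_labels n" using that(2) by (auto simp: colored_triangulations_def)
    then show ?thesis using that(1) bij_cluster_variables by (auto simp: bij_betw_def dest: inj_onD)
  qed
  have CV: "x k \<in> cluster_variables" "x l \<in> cluster_variables"
    using bij_cluster_variables kl by (auto simp: bij_betw_def)
  have self: "\<not> label_crossing n m m" if m: "m \<in> diagonal_labels n" for m
  proof -
    obtain T where "T \<in> colored_triangulations n" "m \<in> T" using diagonal_in_triangulation[OF m] .
    then show ?thesis unfolding colored_triangulations_def by blast
  qed
  have "(\<exists>c\<in>clusters. x k \<in> c \<and> x l \<in> c) \<longleftrightarrow> (\<exists>T\<in>colored_triangulations n. k \<in> T \<and> l \<in> T)"
    unfolding clusters_eq using mem[OF kl(1)] mem[OF kl(2)] by auto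
  also have "\<dots> \<longleftrightarrow> \<not> label_crossing n k l"
  proof
    assume "\<exists>T\<in>colored_triangulations n. k \<in> T \<and> l \<in> T"
    then show "\<not> label_crossing n k l" by (auto simp: colored_triangulations_def)
  next
    assume nc: "\<not> label_crossing n k l"
    then have nc': "\<not> label_crossing n l k" using label_crossing_commute by blast
    have "\<not> label_crossing n p q" if "p \<in> {k, l}" "q \<in> {k, l}" for p q
      using that nc nc' self kl by auto
    then obtain T where "T \<in> colored_triangulations n" "{k, l} \<subseteq> T"
      using extend_to_triangulation[OF n2, of "{k, l}"] kl self by auto
    then show "\<exists>T\<in>colored_triangulations n. k \<in> T \<and> l \<in> T" by blast
  qed
  finally show ?thesis using CV by (auto simp: incompatible_def)
qed

lemma lab_lab_expression:
  assumes "label_crossing n (lab n a c) (lab n b d)" "a < c" "c < a + int n" "b < d" "d < b + int n"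
  shows "\<exists>E. lower_expression (X a c) (X b d) E"
  using assms
proof (rule label_crossing_lab_labE)
  fix p q r s assume "p < q" "q < r" "r < s" "r < p + int n" "s < q + int n"
    "lab n a c = lab n p r" "lab n b d = lab n q s"
  then show ?thesis using chord_chord_expression[of p q r s] by (simp add: X_def)
next
  fix p q r s assume "p < q" "q < r" "r < s" "r < p + int n" "s < q + int n"
    "lab n b d = lab n p r" "lab n a c = lab n q s"
  then show ?thesis using chord_chord_expression[of p q r s] lower_expression_commute by (auto simp: X_def)
qed

lemma diameter_lab_expression:
  assumes cross: "label_crossing n (blue n e) (lab n b d) \<or> label_crossing n (red n e) (lab n b d)"
    and bd: "b < d" "d < b + int n"
  shows "\<exists>E. lower_expression (B e) (X b d) E" "\<exists>E. lower_expression (R e) (X b d) E"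
proof -
  from cross obtain c where c: "c \<in> {chord n b d, chord n (b + int n) (d + int n)}"
    "chord_crossing n (chord n e (e + int n)) c"
    by (auto simp: lab_minor[OF bd])
  have "\<exists>p f q k. p < f \<and> f < q \<and> q < p + int n \<and> f = e + int n * k \<and> lab n b d = lab n p q"
  proof -
    consider "c = chord n b d" | "c = chord n (b + int n) (d + int n)" using c(1) by auto
    then show ?thesis
    proof cases
      case 1
      with c(2) show ?thesis using bd chord_crossing_diameterE[of n e b d] by metis
    next
      case 2
      with c(2) have "chord_crossing n (chord n e (e + int n)) (chord n (b + int n) (d + int n))" by simp
      moreover have "b + int n < d + int n" "d + int n < b + int n + int n" using bd by simp_all
      ultimately obtain p f q k where "p < f" "f < q" "q < p + int n" "f = e + int n * k"
        "lab n (b + int n) (d + int n) = lab n p q"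
        by (rule chord_crossing_diameterE)
      then show ?thesis unfolding lab_shift by blast
    qed
  qed
  then obtain p f q k where f: "p < f" "f < q" "q < p + int n" "f = e + int n * k" "lab n b d = lab n p q" by blast
  have "B f = B e" "R f = R e" unfolding f(4)
    using shift_multiple[of B "int n" e k] shift_multiple[of R "int n" e k] B_shift R_shift by blast+
  moreover have "X b d = X p q" using f(5) by (simp add: X_def)
  ultimately show "\<exists>E. lower_expression (B e) (X b d) E" "\<exists>E. lower_expression (R e) (X b d) E"
    using blue_chord_expression[OF f(1-3)] red_chord_expression[OF f(1-3)] by simp_all
qed

lemma blue_red_crossing_expression:
  assumes "label_crossing n (blue n a) (red n b)"
  shows "\<exists>E. lower_expression (B a) (R b) E"
proof -
  have "0 < int n" using n3 by simp
  \<comment> \<open>\<open>k\<close> moves \<open>b\<close> to its lift in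
    \<open>{a..<a + n}\<close>; the value \<open>a\<close> itself is excluded by the
    crossing.\<close>
  then obtain k where k: "0 \<le> (b - a) + int n * k" "(b - a) + int n * k < int n" by (rule canonical_residue)
  define b' where "b' = b + int n * k"
  have R: "R b' = R b" unfolding b'_def by (rule shift_multiple) (rule R_shift)
  have "b' \<noteq> a"
  proof
    assume "b' = a"
    then have "chord n b (b + int n) = chord n a (a + int n)"
      using chord_diameter_eq_iff[of n b a] n3 unfolding b'_def by auto
    then show False using assms by simp
  qed
  then show ?thesis using blue_red_expression[of a b'] k R by (simp add: b'_def)
qed

lemma incompatible_expression:
  assumes "incompatible v w" shows "\<exists>E. lower_expression v w E"
proof -
  have "cluster_variables = x ` diagonal_labels n"
    using bij_cluster_variables by (simp add: bij_betw_def)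
  then have "v \<in> x ` diagonal_labels n" "w \<in> x ` diagonal_labels n"
    using assms by (simp_all add: incompatible_def)
  then obtain k l where kl: "k \<in> diagonal_labels n" "l \<in> diagonal_labels n" "v = x k" "w = x l"
    by blast
  then have cross: "label_crossing n k l" using assms incompatible_iff[OF kl(1,2)] by (simp only:)
  then have cross': "label_crossing n l k" by (rule label_crossing_commute)
  have cases: "(\<exists>a c. a < c \<and> c < a + int n \<and> m = lab n a c) \<or> (\<exists>a. m = blue n a) \<or> (\<exists>a. m = red n a)"
    if m: "m \<in> diagonal_labels n" for m
    using m unfolding diagonal_labels_eq[OF n2]
  proof (elim UnE)
    assume "m \<in> {lab n a c | a c. a + 2 \<le> c \<and> c < a + int n}"
    then obtain a c where "a + 2 \<le> c" "c < a + int n" "m = lab n a c" by blast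
    then have "a < c \<and> c < a + int n \<and> m = lab n a c" by simp
    then show ?thesis by blast
  qed blast+
  note defs = B_def[symmetric] R_def[symmetric] X_def[symmetric]
  show ?thesis
    using cases[OF kl(1)] cases[OF kl(2)]
  proof (elim disjE exE conjE)
    fix a c b d assume "a < c" "c < a + int n" "k = lab n a c" "b < d" "d < b + int n" "l = lab n b d"
    then show ?thesis using lab_lab_expression[of a c b d] cross kl by (simp add: defs)
  next
    fix a c e assume "a < c" "c < a + int n" "k = lab n a c" "l = blue n e"
    then show ?thesis using diameter_lab_expression(1)[of e a c] cross' kl lower_expression_commute by (auto simp: defs)
  next
    fix a c e assume "a < c" "c < a + int n" "k = lab n a c" "l = red n e"
    then show ?thesis using diameter_lab_expression(2)[of e a c] cross' kl lower_expression_commute by (auto simp: defs)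
  next
    fix a c e assume "k = blue n e" "a < c" "c < a + int n" "l = lab n a c"
    then show ?thesis using diameter_lab_expression(1)[of e a c] cross kl by (auto simp: defs)
  next
    fix a c e assume "k = red n e" "a < c" "c < a + int n" "l = lab n a c"
    then show ?thesis using diameter_lab_expression(2)[of e a c] cross kl by (auto simp: defs)
  next
    fix a b assume "k = blue n a" "l = red n b"
    then show ?thesis using blue_red_crossing_expression[of a b] cross kl by (simp add: defs)
  next
    fix a b assume "k = red n a" "l = blue n b"
    then show ?thesis using blue_red_crossing_expression[of b a] cross' kl lower_expression_commute by (auto simp: defs)
  qed (use cross in auto)
qed

end

section \<open>Linear independence of compatible monomials\<close>

lemma degree_sum_monom:
  fixes c :: "'a \<Rightarrow> 'b::comm_ring_1"
  assumes fin: "finite A" and i: "i \<in> A" "c i \<noteq> 0" and less: "\<And>j. j \<in> A \<Longrightarrow> j \<noteq> i \<Longrightarrow> w j < w i"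
  shows "degree (\<Sum>j\<in>A. monom (c j) (w j)) = w i" "(\<Sum>j\<in>A. monom (c j) (w j)) \<noteq> 0"
proof -
  let ?p = "\<Sum>j\<in>A. monom (c j) (w j)"
  have "coeff ?p (w i) = (\<Sum>j\<in>A. if j = i then c j else 0)"
    unfolding coeff_sum coeff_monom using less by (intro sum.cong) force+
  also have "\<dots> = c i" using fin i(1) by simp
  finally have top: "coeff ?p (w i) \<noteq> 0" using i(2) by simp
  have le: "w j \<le> w i" if "j \<in> A" for j using less[OF that] by (cases "j = i") auto
  have "degree ?p \<le> w i"
  proof (rule degree_le, intro allI impI)
    fix k assume "w i < k"
    then show "coeff ?p k = 0"
      unfolding coeff_sum coeff_monom using le by (intro sum.neutral) fastforce
  qed
  then show "degree ?p = w i" using le_degree[OF top] by simp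
  show "?p \<noteq> 0" using top by auto
qed

lemma sum_distinct_degrees:
  fixes f :: "'a \<Rightarrow> 'b::comm_ring_1 poly"
  assumes fin: "finite A" and nz: "\<And>a. a \<in> A \<Longrightarrow> f a \<noteq> 0"
    and inj: "inj_on (\<lambda>a. degree (f a)) A" and 0: "(\<Sum>a\<in>A. f a) = 0"
  shows "A = {}"
proof (rule ccontr)
  assume "A \<noteq> {}"
  then have "Max ((\<lambda>a. degree (f a)) ` A) \<in> (\<lambda>a. degree (f a)) ` A" using fin by (intro Max_in) auto
  then obtain a where a: "a \<in> A" "degree (f a) = Max ((\<lambda>a. degree (f a)) ` A)" by force
  have "degree (f b) < degree (f a)" if "b \<in> A" "b \<noteq> a" for b
  proof -
    have "degree (f b) \<le> degree (f a)" using a fin that by simp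
    moreover have "degree (f b) \<noteq> degree (f a)" using inj_onD[OF inj _ that(1) a(1)] that(2) by blast
    ultimately show ?thesis by simp
  qed
  then have "coeff (\<Sum>a\<in>A. f a) (degree (f a)) = (\<Sum>b\<in>A. if b = a then coeff (f a) (degree (f a)) else 0)"
    unfolding coeff_sum by (intro sum.cong refl) (auto intro: coeff_eq_0)
  also have "\<dots> = coeff (f a) (degree (f a))" using fin a(1) by simp
  finally show False using 0 nz[OF a(1)] by simp
qed

lemma sum_digits_less:
  fixes q :: nat
  assumes "\<And>j. j < k \<Longrightarrow> d j < q" shows "(\<Sum>j<k. d j * q ^ j) < q ^ k"
  using assms
proof (induction k)
  case (Suc k)
  have "(\<Sum>j<k. d j * q ^ j) < q ^ k" using Suc by simp
  then have "(\<Sum>j<Suc k. d j * q ^ j) < (d k + 1) * q ^ k" by simp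
  also have "\<dots> \<le> q * q ^ k" using Suc.prems[of k] by (intro mult_right_mono) auto
  finally show ?case by simp
qed simp

lemma digits_unique:
  fixes q :: nat
  assumes "\<And>j. j < k \<Longrightarrow> d j < q" "\<And>j. j < k \<Longrightarrow> d' j < q"
    and "(\<Sum>j<k. d j * q ^ j) = (\<Sum>j<k. d' j * q ^ j)" and "j < k"
  shows "d j = d' j"
  using assms
proof (induction k arbitrary: j)
  case (Suc k)
  let ?r = "\<Sum>j<k. d j * q ^ j" and ?r' = "\<Sum>j<k. d' j * q ^ j"
  have r: "?r < q ^ k" "?r' < q ^ k" using Suc.prems by (auto intro!: sum_digits_less)
  have eq: "?r + d k * q ^ k = ?r' + d' k * q ^ k" using Suc.prems(3) by simp
  have "(u + w * b) div b = w" if "u < b" for u w b :: nat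
    using that div_mult_self1[of b u w] by simp
  then have dk: "d k = d' k" using eq r by metis
  then have "?r = ?r'" using eq by simp
  then have "d j = d' j" if "j < k" using Suc.IH[of j] Suc.prems(1,2) that by simp
  then show ?case using dk Suc.prems(4) by (cases "j = k") auto
qed simp

lemma sum_int_interval: "(\<Sum>j\<in>{0..<int k}. f j) = (\<Sum>j<k. f (int j))"
proof -
  have "{0..<int k} = int ` {..<k}" using image_int_atLeastLessThan[of 0 k] by (simp add: lessThan_atLeast0)
  then show ?thesis by (simp add: sum.reindex)
qed

lemma degree_prod_mset:
  fixes f :: "'a \<Rightarrow> 'b::field poly"
  assumes "\<And>s. s \<in># M \<Longrightarrow> f s \<noteq> 0"
  shows "(\<Prod>s\<in>#M. f s) \<noteq> 0 \<and> degree (\<Prod>s\<in>#M. f s) = (\<Sum>s\<in>#M. degree (f s))"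
  using assms by (induction M) (auto simp: degree_mult_eq)

lemma divisible_of_keys:
  assumes "R v w" "v \<noteq> w" "v \<in> keys m" "w \<in> keys m" shows "divisible R m"
proof -
  define m0 where "m0 = m - (single v 1 + single w 1)"
  have "m = m0 + (single v 1 + single w 1)"
  proof (rule poly_mapping_eqI)
    fix u
    have "lookup m v \<noteq> 0" "lookup m w \<noteq> 0" using assms by (simp_all add: in_keys_iff)
    then show "lookup m u = lookup (m0 + (single v 1 + single w 1)) u"
      using assms(2) by (auto simp: m0_def lookup_add lookup_minus lookup_single when_def)
  qed
  then show ?thesis using divisibleI[of R v w m0] assms(1) by simp
qed

lemma digit_le: "digit n s j \<le> 3"
  by (cases s) auto

context polygon_model
begin

section \<open>Sides in place of generators, and an integral strict weight\<close>

definition xs :: "side \<Rightarrow> 'f" where "xs s = x (label_of n s)"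

lemma xs_simps [simp]: "xs (Chord a c) = X a c" "xs (BlueDiam a) = B a" "xs (RedDiam a) = R a"
  by (simp_all add: xs_def X_def B_def R_def)

lemma inj_on_xs: "inj_on xs (sides n)"
  using comp_inj_on[OF inj_on_label_of inj_x] by (simp add: xs_def[abs_def] o_def)

lemma image_xs: "xs ` sides n = generators"
  unfolding generators_eq image_image xs_def ..

lemma finite_generators: "finite generators"
  using finite_sides by (metis finite_imageI image_xs)

definition side_of :: "'f \<Rightarrow> side" where "side_of = the_inv_into (sides n) xs"

lemma side_of_xs: "s \<in> sides n \<Longrightarrow> side_of (xs s) = s"
  unfolding side_of_def by (rule the_inv_into_f_f[OF inj_on_xs])

lemma int_n_pos: "0 < int n" using n3 by simp

lemma mod_mult: "a mod int n = a + int n * (- (a div int n))"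
  by (simp add: minus_mult_div_eq_mod)

lemma B_mod: "B (a mod int n) = B a" and R_mod: "R (a mod int n) = R a"
  and X_mod: "X (a mod int n) (c + (a mod int n - a)) = X a c"
proof -
  show "B (a mod int n) = B a" "R (a mod int n) = R a"
    unfolding mod_mult by (rule shift_multiple, rule B_shift) (rule shift_multiple, rule R_shift)
  have "c + (a mod int n - a) = c + int n * (- (a div int n))" unfolding mod_mult by simp
  then show "X (a mod int n) (c + (a mod int n - a)) = X a c"
    unfolding mod_mult by (simp only:) (rule shift_multiple2, rule X_shift)
qed

lemma side_of_B: "side_of (B a) = BlueDiam (a mod int n)"
  and side_of_R: "side_of (R a) = RedDiam (a mod int n)"
  using side_of_xs[of "BlueDiam (a mod int n)"] side_of_xs[of "RedDiam (a mod int n)"] int_n_pos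
  by (simp_all add: sides_simps B_mod R_mod)

lemma side_of_X:
  assumes "a < c" "c < a + int n" shows "side_of (X a c) = Chord (a mod int n) (c + (a mod int n - a))"
  using side_of_xs[of "Chord (a mod int n) (c + (a mod int n - a))"] int_n_pos assms
  by (simp add: sides_simps X_mod)

lemma strict_iff:
  "strict \<omega> \<longleftrightarrow>
     (\<forall>a c. a + 2 \<le> c \<longrightarrow> c < a + int n \<longrightarrow> D \<omega> a (c + 1) + D \<omega> (a + 1) c < D \<omega> a c + D \<omega> (a + 1) (c + 1)) \<and>
     (\<forall>a. D \<omega> (a + 1) (a + int n) < lookup \<omega> (B a) + lookup \<omega> (R (a + 1))) \<and>
     (\<forall>a. D \<omega> (a + 1) (a + int n) < lookup \<omega> (R a) + lookup \<omega> (B (a + 1)))"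
  unfolding strict_weight_def using n2 by (auto simp: D_def B_shift R_shift X_shift)

text \<open>As a function of the length \<open>t\<close>, \<open>2 t (2 n - t)\<close> has second
  difference \<open>- 4\<close>, which gives the strict chord inequalities. Its value
  \<open>2 n^2\<close> at a diameter splits evenly between the colors and exceeds the value at
  \<open>t = n - 1\<close> by \<open>2\<close>, which gives the other two families. Natural values
  make it a measure for rewriting as well.\<close>

fun side_height :: "side \<Rightarrow> nat" where
  "side_height (Chord a c) = nat (2 * (c - a) * (2 * int n - (c - a)))"
| "side_height (BlueDiam a) = n * n"
| "side_height (RedDiam a) = n * n"

definition height :: "'f \<Rightarrow> nat" where "height y = side_height (side_of y)"

definition \<omega>\<^sub>0 :: "'f \<Rightarrow>\<^sub>0 real" where "\<omega>\<^sub>0 = (\<Sum>y\<in>generators. single y (real (height y)))"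

lemma lookup_\<omega>\<^sub>0: "y \<in> generators \<Longrightarrow> lookup \<omega>\<^sub>0 y = real (height y)"
proof -
  assume y: "y \<in> generators"
  have "lookup \<omega>\<^sub>0 y = (\<Sum>z\<in>generators. if z = y then real (height z) else 0)"
    unfolding \<omega>\<^sub>0_def lookup_sum by (intro sum.cong refl) (auto simp: lookup_single when_def)
  then show ?thesis using y finite_generators by simp
qed

lemma keys_\<omega>\<^sub>0: "keys \<omega>\<^sub>0 \<subseteq> generators"
proof
  fix y assume "y \<in> keys \<omega>\<^sub>0"
  then obtain z where "z \<in> generators" "y \<in> keys (single z (real (height z)))"
    unfolding \<omega>\<^sub>0_def by (rule in_keys_sumE)
  then show "y \<in> generators" by (auto split: if_splits)
qed

lemma D_\<omega>\<^sub>0: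
  assumes "a < c" "c \<le> a + int n"
  shows "D \<omega>\<^sub>0 a c = real_of_int (2 * (c - a) * (2 * int n - (c - a)))"
proof (cases "c = a + int n")
  case True
  have "D \<omega>\<^sub>0 a c = 2 * real (n * n)"
    using True generator_mems by (simp add: D_def lookup_\<omega>\<^sub>0 height_def side_of_B side_of_R)
  also have "\<dots> = real_of_int (2 * (c - a) * (2 * int n - (c - a)))" using True by simp
  finally show ?thesis .
next
  case False
  then have c: "c < a + int n" using assms by simp
  have "D \<omega>\<^sub>0 a c = real (height (X a c))" using False assms c by (simp add: D_def lookup_\<omega>\<^sub>0[OF generator_mems(3)[OF assms(1) c]])
  also have "\<dots> = real (nat (2 * (c - a) * (2 * int n - (c - a))))"
    using assms(1) c by (simp add: height_def side_of_X)
  also have "\<dots> = real_of_int (2 * (c - a) * (2 * int n - (c - a)))" using assms by simp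
  finally show ?thesis .
qed

lemma strict_\<omega>\<^sub>0: "strict \<omega>\<^sub>0"
proof -
  have BR: "lookup \<omega>\<^sub>0 (B a) = real n * real n" "lookup \<omega>\<^sub>0 (R a) = real n * real n" for a
    using generator_mems[of a] by (simp_all add: lookup_\<omega>\<^sub>0 height_def side_of_B side_of_R)
  have "D \<omega>\<^sub>0 a (c + 1) + D \<omega>\<^sub>0 (a + 1) c < D \<omega>\<^sub>0 a c + D \<omega>\<^sub>0 (a + 1) (c + 1)"
    if "a + 2 \<le> c" "c < a + int n" for a c
    using that by (simp add: D_\<omega>\<^sub>0 algebra_simps)
  moreover have "D \<omega>\<^sub>0 (a + 1) (a + int n) < real n * real n + real n * real n" for a
    using n3 by (simp add: D_\<omega>\<^sub>0 algebra_simps)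
  ultimately show ?thesis by (intro strict_iff[THEN iffD2]) (simp add: BR)
qed

definition sides_of :: "('f \<Rightarrow>\<^sub>0 nat) \<Rightarrow> side multiset" where
  "sides_of m = (\<Sum>s\<in>sides n. replicate_mset (lookup m (xs s)) s)"

lemma count_sides_of: "count (sides_of m) s = (if s \<in> sides n then lookup m (xs s) else 0)"
proof -
  have "count (sides_of m) s = (\<Sum>t\<in>sides n. if t = s then lookup m (xs t) else 0)"
    unfolding sides_of_def count_sum by (intro sum.cong refl) auto
  then show ?thesis using finite_sides by simp
qed

lemma mem_sides_of: "s \<in># sides_of m \<longleftrightarrow> s \<in> sides n \<and> xs s \<in> keys m"
  unfolding count_greater_zero_iff[symmetric] count_sides_of by (simp add: in_keys_iff)

lemma eval_mon_sides_of:
  assumes "keys m \<subseteq> generators" shows "eval_mon \<phi> m = (\<Prod>s\<in>#sides_of m. \<phi> (xs s))"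
proof -
  have "eval_mon \<phi> m = (\<Prod>v\<in>xs ` sides n. \<phi> v ^ lookup m v)"
    unfolding image_xs by (rule eval_mon_superset[OF finite_generators assms])
  also have "\<dots> = (\<Prod>s\<in>sides n. \<phi> (xs s) ^ lookup m (xs s))"
    using inj_on_xs by (simp add: prod.reindex)
  also have "\<dots> = (\<Prod>s\<in>sides n. \<Prod>t\<in>#replicate_mset (lookup m (xs s)) s. \<phi> (xs t))" by simp
  also have "\<dots> = (\<Prod>s\<in>#sides_of m. \<phi> (xs s))"
  proof -
    have "(\<Prod>s\<in>T. \<Prod>t\<in>#replicate_mset (lookup m (xs s)) s. \<phi> (xs t))
       = (\<Prod>s\<in>#(\<Sum>s\<in>T. replicate_mset (lookup m (xs s)) s). \<phi> (xs s))" for T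
      by (induction T rule: infinite_finite_induct) simp_all
    then show ?thesis unfolding sides_of_def .
  qed
  finally show ?thesis .
qed

lemma sides_of_inj:
  assumes "keys m \<subseteq> generators" "keys m' \<subseteq> generators" "sides_of m = sides_of m'" shows "m = m'"
proof (rule poly_mapping_eqI)
  fix y
  show "lookup m y = lookup m' y"
  proof (cases "y \<in> generators")
    case True
    then obtain s where s: "s \<in> sides n" "y = xs s" using image_xs by blast
    have "count (sides_of m) s = count (sides_of m') s" using assms(3) by simp
    then show ?thesis using s by (simp add: count_sides_of)
  next
    case False
    then have "y \<notin> keys m" "y \<notin> keys m'" using assms(1,2) by blast+
    then show ?thesis by (simp add: in_keys_iff)
  qed
qed

lemma noncrossing_sides_of:
  assumes "\<not> divisible incompatible m" shows "noncrossing n (sides_of m)"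
  unfolding noncrossing_def
proof (intro conjI ballI notI)
  show "set_mset (sides_of m) \<subseteq> sides n" by (auto simp: mem_sides_of)
  fix s t assume st: "s \<in># sides_of m" "t \<in># sides_of m"
    and cross: "label_crossing n (label_of n s) (label_of n t)"
  have cross': "label_crossing n (label_of n t) (label_of n s)" using cross by (rule label_crossing_commute)
  have mem: "label_of n s \<in> label_of n ` sides n" "label_of n t \<in> label_of n ` sides n"
    using st by (auto simp: mem_sides_of)
  have "label_of n s \<notin> edge_labels n" "label_of n t \<notin> edge_labels n"
    using crossing_not_edge[OF n2 mem(2)] crossing_not_edge[OF n2 mem(1)] cross cross'
    unfolding edge_labels_eq by auto
  then have diag: "label_of n s \<in> diagonal_labels n" "label_of n t \<in> diagonal_labels n"
    using mem labels_eq[OF n2] by blast+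
  \<comment> \<open>Distinctness is essential: divisibility by a square would require exponent two,
    whereas \<open>divisible_of_keys\<close> sees only the support of \<open>m\<close>.\<close>
  have "label_of n s \<noteq> label_of n t"
  proof
    assume eq: "label_of n s = label_of n t"
    obtain T where T: "T \<in> colored_triangulations n" "label_of n s \<in> T" using diagonal_in_triangulation[OF diag(1)] .
    then have "\<not> label_crossing n (label_of n s) (label_of n s)" unfolding colored_triangulations_def by blast
    then show False using cross eq by simp
  qed
  then have "xs s \<noteq> xs t" using x_eq_iff[OF mem] by (simp add: xs_def)
  moreover have "incompatible (xs s) (xs t)" using incompatible_iff[OF diag] cross by (simp add: xs_def)
  ultimately have "divisible incompatible m"
    using st by (intro divisible_of_keys[of incompatible "xs s" "xs t"]) (auto simp: mem_sides_of)
  then show False using assms by blast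
qed

text \<open>
  The variables of \<open>base\<close> are algebraically independent, so each of them may be multiplied by an arbitrary
  power of a new variable \<open>T\<close>. With the exponents \<open>side_weight q\<close>, every side becomes a polynomial in \<open>T\<close>
  whose degree has the base \<open>q\<close> digits \<open>digit\<close>.
\<close>

definition diam_weight :: "nat \<Rightarrow> int \<Rightarrow> nat" where
  "diam_weight q a = q ^ nat (a mod int n)"

text \<open>Realises the order \<delta> (n - 1) > \<delta> 0 > \<delta> 1 > ... > \<delta> (n - 2).
  A chord passing the cut and a red diameter then have leading gap \<delta> (n - 1), any other chord
  has the gap at its left end; this is the digit of a side beyond its vertices.\<close>

definition gap_weight :: "nat \<Rightarrow> int \<Rightarrow> nat" where
  "gap_weight q i = q ^ nat (if i mod int n = int n - 1 then 2 * int n - 1 else 2 * int n - 2 - i mod int n)"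

text \<open>The value at chords is made for edges: as
  \<open>X i (i + 1) = \<delta> i * B i * B (i + 1)\<close>, it gives \<open>\<delta> i\<close> the
  exponent \<open>gap_weight q i\<close>.\<close>

fun side_weight :: "nat \<Rightarrow> side \<Rightarrow> nat" where
  "side_weight q (Chord a c) = gap_weight q a + diam_weight q a + diam_weight q (a + 1)"
| "side_weight q (BlueDiam a) = diam_weight q a"
| "side_weight q (RedDiam a) = 0"

definition lift :: "nat \<Rightarrow> 'f \<Rightarrow> 'f poly" where
  "lift q y = monom y (side_weight q (side_of y))"

lemma lift_B: "lift q (B a) = monom (B a) (diam_weight q a)"
  by (simp add: lift_def side_of_B diam_weight_def)

lemma lift_X: "lift q (X i (i + 1)) = monom (X i (i + 1)) (gap_weight q i + diam_weight q i + diam_weight q (i + 1))"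
proof -
  have "1 < int n" using n3 by simp
  then show ?thesis
    by (simp add: lift_def side_of_X diam_weight_def gap_weight_def mod_add_left_eq)
qed

section \<open>Transfer of identities from the field to polynomials in one variable\<close>

abbreviation \<kappa> :: "'k \<Rightarrow> 'f poly" where "\<kappa> c \<equiv> [:\<iota> c:]"

lemma coeff_hom_\<kappa>: "coeff_hom \<kappa>"
proof -
  interpret coeff_hom \<iota> by (rule coeff_hom)
  show ?thesis by unfold_locales (simp_all add: one add mult one_pCons)
qed

text \<open>Stands for the substitution homomorphism on fractions of polynomials in
  \<open>base\<close> whose denominators survive it. Stated as a relation, it requires no choice of
  a fraction for \<open>u\<close>; that the choice does not matter comes from
  \<open>lifted_0_imp_0\<close>.\<close>

definition lifted :: "nat \<Rightarrow> 'f \<Rightarrow> 'f poly \<Rightarrow> bool" where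
  "lifted q u U \<longleftrightarrow> (\<exists>P\<in>polys base. \<exists>Q\<in>polys base. poly_eval \<iota> Q \<noteq> 0 \<and> peval \<kappa> (lift q) Q \<noteq> 0 \<and>
     u * poly_eval \<iota> Q = poly_eval \<iota> P \<and> U * peval \<kappa> (lift q) Q = peval \<kappa> (lift q) P)"

lemma lifted_add: "lifted q u U \<Longrightarrow> lifted q v V \<Longrightarrow> lifted q (u + v) (U + V)"
  and lifted_mult: "lifted q u U \<Longrightarrow> lifted q v V \<Longrightarrow> lifted q (u * v) (U * V)"
proof -
  interpret hom: coeff_hom \<iota> by (rule coeff_hom)
  interpret hom': coeff_hom \<kappa> by (rule coeff_hom_\<kappa>)
  note ev = poly_eval_eq_peval hom.peval_mult hom'.peval_mult hom.peval_add hom'.peval_add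
  assume "lifted q u U" "lifted q v V"
  then obtain P Q P' Q' where P: "P \<in> polys base" "Q \<in> polys base" "P' \<in> polys base" "Q' \<in> polys base"
    and nz: "poly_eval \<iota> Q \<noteq> 0" "peval \<kappa> (lift q) Q \<noteq> 0" "poly_eval \<iota> Q' \<noteq> 0" "peval \<kappa> (lift q) Q' \<noteq> 0"
    and eq: "poly_eval \<iota> P = u * poly_eval \<iota> Q" "peval \<kappa> (lift q) P = U * peval \<kappa> (lift q) Q"
      "poly_eval \<iota> P' = v * poly_eval \<iota> Q'" "peval \<kappa> (lift q) P' = V * peval \<kappa> (lift q) Q'"
    unfolding lifted_def by metis
  show "lifted q (u + v) (U + V)"
    unfolding lifted_def using P nz eq
    by (intro bexI[of _ "P * Q' + P' * Q"] bexI[of _ "Q * Q'"])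
      (auto simp: ev algebra_simps intro!: polys_add polys_mult)
  show "lifted q (u * v) (U * V)"
    unfolding lifted_def using P nz eq
    by (intro bexI[of _ "P * P'"] bexI[of _ "Q * Q'"]) (auto simp: ev algebra_simps intro!: polys_mult)
qed

lemma lifted_const: "lifted q (\<iota> c) [:\<iota> c:]"
proof -
  interpret hom: coeff_hom \<iota> by (rule coeff_hom)
  interpret hom': coeff_hom \<kappa> by (rule coeff_hom_\<kappa>)
  show ?thesis
    unfolding lifted_def
    by (intro bexI[of _ "single 0 c"] bexI[of _ "1"]) (auto simp: poly_eval_eq_peval intro!: polys_single)
qed

lemma lifted_0: "lifted q 0 0" and lifted_1: "lifted q 1 1"
proof -
  interpret hom: coeff_hom \<iota> by (rule coeff_hom)
  show "lifted q 0 0" "lifted q 1 1"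
    using lifted_const[of q 0] lifted_const[of q 1] by (simp_all add: hom.one one_pCons)
qed

lemma lifted_base:
  assumes "y \<in> base" shows "lifted q y (lift q y)"
proof -
  interpret hom: coeff_hom \<iota> by (rule coeff_hom)
  interpret hom': coeff_hom \<kappa> by (rule coeff_hom_\<kappa>)
  show ?thesis
    unfolding lifted_def using assms
    by (intro bexI[of _ "var y"] bexI[of _ "1"]) (auto simp: poly_eval_eq_peval intro!: polys_var)
qed

lemma lifted_sum: "(\<And>a. a \<in> A \<Longrightarrow> lifted q (f a) (g a)) \<Longrightarrow> lifted q (sum f A) (sum g A)"
  by (induction A rule: infinite_finite_induct) (auto intro: lifted_0 lifted_add)

lemma lifted_prod_mset: "(\<And>s. s \<in># M \<Longrightarrow> lifted q (f s) (g s)) \<Longrightarrow> lifted q (\<Prod>s\<in>#M. f s) (\<Prod>s\<in>#M. g s)"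
  by (induction M) (auto intro: lifted_1 lifted_mult)

lemma lifted_divide:
  assumes "lifted q (u * v) (U * V)" "lifted q v V" "v \<noteq> 0" "V \<noteq> 0"
  shows "lifted q u U"
proof -
  interpret hom: coeff_hom \<iota> by (rule coeff_hom)
  interpret hom': coeff_hom \<kappa> by (rule coeff_hom_\<kappa>)
  note ev = poly_eval_eq_peval hom.peval_mult hom'.peval_mult
  from assms(1,2) obtain P Q P' Q' where P: "P \<in> polys base" "Q \<in> polys base" "P' \<in> polys base" "Q' \<in> polys base"
    and nz: "poly_eval \<iota> Q \<noteq> 0" "peval \<kappa> (lift q) Q \<noteq> 0" "poly_eval \<iota> Q' \<noteq> 0" "peval \<kappa> (lift q) Q' \<noteq> 0"
    and eq: "poly_eval \<iota> P = u * v * poly_eval \<iota> Q" "peval \<kappa> (lift q) P = U * V * peval \<kappa> (lift q) Q"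
      "poly_eval \<iota> P' = v * poly_eval \<iota> Q'" "peval \<kappa> (lift q) P' = V * peval \<kappa> (lift q) Q'"
    unfolding lifted_def by metis
  \<comment> \<open>From \<open>u v = P / Q\<close> and \<open>v = P' / Q'\<close> one gets the
    fraction \<open>P Q' / (Q P')\<close> for \<open>u\<close>.\<close>
  show ?thesis
    unfolding lifted_def using P nz eq assms(3,4)
    by (intro bexI[of _ "P * Q'"] bexI[of _ "Q * P'"]) (auto simp: ev algebra_simps intro!: polys_mult)
qed

text \<open>A fraction for \<open>0\<close> has a numerator that evaluates to \<open>0\<close>. By
  independence of \<open>base\<close> the numerator is the zero polynomial, so it stays
  \<open>0\<close> under the substitution.\<close>

lemma lifted_0_imp_0:
  assumes "lifted q 0 U" shows "U = 0"
proof -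
  interpret hom: coeff_hom \<iota> by (rule coeff_hom)
  interpret hom': coeff_hom \<kappa> by (rule coeff_hom_\<kappa>)
  from assms obtain P Q where "P \<in> polys base" "poly_eval \<iota> P = 0" "peval \<kappa> (lift q) Q \<noteq> 0"
    "U * peval \<kappa> (lift q) Q = peval \<kappa> (lift q) P"
    unfolding lifted_def by (metis mult_zero_left)
  moreover from this have "P = 0" using base_indep by (auto simp: alg_indep_def)
  ultimately show ?thesis by simp
qed

lemma lifted_\<delta>: "lifted q (\<delta> i) (monom (\<delta> i) (gap_weight q i))"
proof (rule lifted_divide)
  let ?V = "monom (B i) (diam_weight q i) * monom (B (i + 1)) (diam_weight q (i + 1))"
  have "lifted q (B a) (monom (B a) (diam_weight q a))" for a
    using lifted_base[of "B a" q] by (simp add: base_def lift_B)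
  then show "lifted q (B i * B (i + 1)) ?V" by (intro lifted_mult)
  have "lifted q (X i (i + 1)) (monom (X i (i + 1)) (gap_weight q i + diam_weight q i + diam_weight q (i + 1)))"
    using lifted_base[of "X i (i + 1)" q] by (simp add: base_def lift_X)
  moreover have "\<delta> i * (B i * B (i + 1)) = X i (i + 1)" using B_nonzero by (simp add: \<delta>_def)
  ultimately show "lifted q (\<delta> i * (B i * B (i + 1))) (monom (\<delta> i) (gap_weight q i) * ?V)"
    by (simp add: mult_monom add.assoc)
  show "B i * B (i + 1) \<noteq> 0" "?V \<noteq> 0" using B_nonzero by (simp_all add: mult_monom)
qed

definition gap_poly :: "nat \<Rightarrow> int \<Rightarrow> int \<Rightarrow> 'f poly" where
  "gap_poly q a c = (\<Sum>i\<in>{a..<c}. monom (\<delta> i) (gap_weight q i))"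

lemma lifted_S: "lifted q (S a c) (gap_poly q a c)"
  unfolding S_def gap_poly_def by (intro lifted_sum lifted_\<delta>)

fun side_poly :: "nat \<Rightarrow> side \<Rightarrow> 'f poly" where
  "side_poly q (Chord a c) = monom (B a) (diam_weight q a) * monom (B c) (diam_weight q c) * gap_poly q a c"
| "side_poly q (BlueDiam a) = monom (B a) (diam_weight q a)"
| "side_poly q (RedDiam a) = monom (B a) (diam_weight q a) * gap_poly q a (a + int n)"

lemma lifted_side:
  assumes "s \<in> sides n" shows "lifted q (xs s) (side_poly q s)"
proof -
  have B: "lifted q (B a) (monom (B a) (diam_weight q a))" for a
    using lifted_base[of "B a" q] by (simp add: base_def lift_B)
  show ?thesis
  proof (cases s)
    case (Chord a c)
    then show ?thesis using assms X_eq[of a c] by (auto simp: sides_simps intro!: lifted_mult B lifted_S)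
  next
    case (BlueDiam a)
    then show ?thesis by (simp add: B)
  next
    case (RedDiam a)
    then show ?thesis using R_eq[of a] by (auto intro!: lifted_mult B lifted_S)
  qed
qed

lemma gap_poly_degree:
  assumes q: "2 \<le> q" and ac: "0 \<le> a" "a < int n" "a < c" "c \<le> a + int n"
  shows "degree (gap_poly q a c) = q ^ nat (if c < int n then 2 * int n - 2 - a else 2 * int n - 1)"
    "gap_poly q a c \<noteq> 0"
proof -
  \<comment> \<open>The place of the largest gap weight in \<open>{a..<c}\<close>: the gap at the
    cut if the interval contains it, otherwise the left end.\<close>
  let ?i = "if c < int n then a else int n - 1"
  have mod: "i mod int n = (if i < int n then i else i - int n)" if "i \<in> {a..<c}" for i
    using that ac wrap_mod[of "int n" i] by (auto simp: mod_pos_pos_trivial)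
  have "gap_weight q j < gap_weight q ?i" if "j \<in> {a..<c}" "j \<noteq> ?i" for j
  proof -
    have "?i \<in> {a..<c}" using ac by auto
    then have "nat (if j mod int n = int n - 1 then 2 * int n - 1 else 2 * int n - 2 - j mod int n)
       < nat (if ?i mod int n = int n - 1 then 2 * int n - 1 else 2 * int n - 2 - ?i mod int n)"
      using that ac mod[of j] mod[of ?i] by (auto split: if_splits)
    then show ?thesis unfolding gap_weight_def using q by (intro power_strict_increasing) auto
  qed
  moreover have i: "?i \<in> {a..<c}" using ac by auto
  ultimately have "degree (gap_poly q a c) = gap_weight q ?i" and nz: "gap_poly q a c \<noteq> 0"
    unfolding gap_poly_def using degree_sum_monom[of "{a..<c}" ?i \<delta> "gap_weight q"] \<delta>_nonzero by blast+
  moreover have "gap_weight q ?i = q ^ nat (if c < int n then 2 * int n - 2 - a else 2 * int n - 1)"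
    using ac mod[OF i] by (auto simp: gap_weight_def)
  ultimately show "degree (gap_poly q a c) = q ^ nat (if c < int n then 2 * int n - 2 - a else 2 * int n - 1)"
    "gap_poly q a c \<noteq> 0" by simp_all
qed

lemma sum_of_bool_power:
  assumes "k \<in> {0..<2 * int n}"
  shows "(\<Sum>j\<in>{0..<2 * int n}. of_bool (j = k) * q ^ nat j) = (q ^ nat k :: nat)"
proof -
  have "(\<Sum>j\<in>{0..<2 * int n}. of_bool (j = k) * q ^ nat j) = (\<Sum>j\<in>{0..<2 * int n}. if j = k then q ^ nat k else 0)"
    by (intro sum.cong) auto
  then show ?thesis using assms by simp
qed

text \<open>Each blue factor contributes the digit of its vertex, and the gap polynomial contributes
  the digit of its leading gap.\<close>

lemma side_poly_degree:
  assumes q: "2 \<le> q" and s: "s \<in> sides n"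
  shows "degree (side_poly q s) = (\<Sum>j\<in>{0..<2 * int n}. digit n s j * q ^ nat j)" "side_poly q s \<noteq> 0"
proof -
  have "degree (side_poly q s) = (\<Sum>j\<in>{0..<2 * int n}. digit n s j * q ^ nat j) \<and> side_poly q s \<noteq> 0"
  proof (cases s)
    case (Chord a c)
    then have ac: "0 \<le> a" "a < int n" "a < c" "c < a + int n" using s by (auto simp: sides_simps)
    let ?k = "if c < int n then 2 * int n - 2 - a else 2 * int n - 1"
    have "0 \<le> c mod int n" "c mod int n < int n" using int_n_pos by simp_all
    then have "c mod int n \<in> {0..<2 * int n}" unfolding atLeastLessThan_iff by linarith
    moreover have "a \<in> {0..<2 * int n}" "?k \<in> {0..<2 * int n}" using ac by auto
    ultimately have "(\<Sum>j\<in>{0..<2 * int n}. digit n s j * q ^ nat j) = q ^ nat a + q ^ nat (c mod int n) + q ^ nat ?k"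
      unfolding Chord digit.simps distrib_right sum.distrib by (simp only: sum_of_bool_power)
    moreover have "gap_poly q a c \<noteq> 0" "degree (gap_poly q a c) = q ^ nat ?k"
      using gap_poly_degree[OF q, of a c] ac by auto
    ultimately show ?thesis using Chord B_nonzero ac
      by (simp add: degree_mult_eq degree_monom_eq diam_weight_def del: digit.simps)
  next
    case (BlueDiam a)
    then have "0 \<le> a" "a < int n" using s by (auto simp: sides_simps)
    then show ?thesis using BlueDiam B_nonzero sum_of_bool_power[of a q]
      by (simp add: degree_monom_eq diam_weight_def)
  next
    case (RedDiam a)
    then have a: "0 \<le> a" "a < int n" using s by (auto simp: sides_simps)
    then have "a \<in> {0..<2 * int n}" "2 * int n - 1 \<in> {0..<2 * int n}" by auto
    then have "(\<Sum>j\<in>{0..<2 * int n}. digit n s j * q ^ nat j) = q ^ nat a + q ^ nat (2 * int n - 1)"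
      unfolding RedDiam digit.simps distrib_right sum.distrib by (simp only: sum_of_bool_power)
    moreover have "gap_poly q a (a + int n) \<noteq> 0" "degree (gap_poly q a (a + int n)) = q ^ nat (2 * int n - 1)"
      using gap_poly_degree[OF q, of a "a + int n"] a by auto
    ultimately show ?thesis using RedDiam B_nonzero a
      by (simp add: degree_mult_eq degree_monom_eq diam_weight_def del: digit.simps)
  qed
  then show "degree (side_poly q s) = (\<Sum>j\<in>{0..<2 * int n}. digit n s j * q ^ nat j)" "side_poly q s \<noteq> 0"
    by blast+
qed

text \<open>Distinct standard monomials lift to polynomials of distinct degrees, so the lift of a
  nontrivial combination cannot vanish, while the lift of \<open>0\<close> is
  \<open>0\<close>.\<close>

theorem compatible_monomials_independent:
  assumes p: "p \<in> polys generators" and std: "\<forall>m\<in>keys p. \<not> divisible incompatible m"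
    and 0: "poly_eval \<iota> p = 0"
  shows "p = 0"
proof -
  interpret hom: coeff_hom \<iota> by (rule coeff_hom)
  \<comment> \<open>A digit of a side is at most \<open>3\<close>, so \<open>q\<close> exceeds all
    digit sums of the monomials of \<open>p\<close>: there are no carries, and the degree determines
    the digits.\<close>
  define q where "q = 2 + (\<Sum>m\<in>keys p. 3 * size (sides_of m))"
  have q: "2 \<le> q" by (simp add: q_def)
  have gens: "keys m \<subseteq> generators" if "m \<in> keys p" for m using p that by (auto simp: polys_def)
  define summand where "summand m = [:\<iota> (lookup p m):] * (\<Prod>s\<in>#sides_of m. side_poly q s)" for m
  define dig where "dig m j = (\<Sum>s\<in>#sides_of m. digit n s j)" for m j
  have \<iota>0: "\<iota> c \<noteq> 0" if "c \<noteq> 0" for c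
  proof
    assume "\<iota> c = 0"
    then have "\<iota> (c * inverse c) = 0" by (simp add: hom.mult)
    then show False using that by (simp add: hom.one)
  qed
  have prod: "(\<Prod>s\<in>#sides_of m. side_poly q s) \<noteq> 0 \<and>
      degree (\<Prod>s\<in>#sides_of m. side_poly q s) = (\<Sum>s\<in>#sides_of m. degree (side_poly q s))" for m
    by (rule degree_prod_mset) (use side_poly_degree(2)[OF q] in \<open>auto simp: mem_sides_of\<close>)
  have degree: "summand m \<noteq> 0" "degree (summand m) = (\<Sum>j\<in>{0..<2 * int n}. dig m j * q ^ nat j)"
    if m: "m \<in> keys p" for m
  proof -
    have c: "\<iota> (lookup p m) \<noteq> 0" using \<iota>0 m by (simp add: in_keys_iff)
    show "summand m \<noteq> 0" using prod[of m] c by (simp add: summand_def)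
    have "(\<Sum>s\<in>#M. \<Sum>j\<in>{0..<2 * int n}. digit n s j * q ^ nat j) = (\<Sum>j\<in>{0..<2 * int n}. (\<Sum>s\<in>#M. digit n s j) * q ^ nat j)"
      for M by (induction M) (simp_all add: sum.distrib distrib_right)
    moreover have "(\<Sum>s\<in>#sides_of m. degree (side_poly q s))
        = (\<Sum>s\<in>#sides_of m. \<Sum>j\<in>{0..<2 * int n}. digit n s j * q ^ nat j)"
      using side_poly_degree(1)[OF q] by (intro arg_cong[of _ _ sum_mset] image_mset_cong) (auto simp: mem_sides_of)
    ultimately show "degree (summand m) = (\<Sum>j\<in>{0..<2 * int n}. dig m j * q ^ nat j)"
      using prod[of m] c by (simp add: summand_def dig_def)
  qed
  have dig_less: "dig m j < q" if m: "m \<in> keys p" for m j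
  proof -
    have "(\<Sum>s\<in>#M. digit n s j) \<le> 3 * size M" for M
      by (induction M) (use digit_le[of n _ j] in \<open>auto intro: add_mono\<close>)
    then have "dig m j \<le> 3 * size (sides_of m)" by (simp add: dig_def)
    also have "\<dots> \<le> (\<Sum>m\<in>keys p. 3 * size (sides_of m))" using m by (intro member_le_sum) auto
    finally show ?thesis by (simp add: q_def)
  qed
  have "inj_on (\<lambda>m. degree (summand m)) (keys p)"
  proof
    fix m m' assume m: "m \<in> keys p" "m' \<in> keys p" and eq: "degree (summand m) = degree (summand m')"
    have "(\<Sum>j<2 * n. dig m (int j) * q ^ j) = (\<Sum>j<2 * n. dig m' (int j) * q ^ j)"
      using eq degree(2)[OF m(1)] degree(2)[OF m(2)] sum_int_interval[of "\<lambda>j. dig m j * q ^ nat j" "2 * n"]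
        sum_int_interval[of "\<lambda>j. dig m' j * q ^ nat j" "2 * n"] by simp
    then have "dig m (int j) = dig m' (int j)" if "j < 2 * n" for j
      by (rule digits_unique[rotated 2]) (use dig_less m that in auto)
    then have "dig m j = dig m' j" if "0 \<le> j" "j < 2 * int n" for j
      using that by (metis nat_0_le nat_less_iff of_nat_mult of_nat_numeral)
    then have "sides_of m = sides_of m'"
      using noncrossing_sides_of std m unfolding dig_def by (intro noncrossing_eqI) auto
    then show "m = m'" using sides_of_inj gens m by blast
  qed
  moreover have "(\<Sum>m\<in>keys p. summand m) = 0"
  proof (rule lifted_0_imp_0)
    have "lifted q (\<iota> (lookup p m) * eval_mon (\<lambda>v. v) m) (summand m)" if "m \<in> keys p" for m
      unfolding summand_def eval_mon_sides_of[OF gens[OF that]]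
      by (intro lifted_mult lifted_const lifted_prod_mset lifted_side) (simp add: mem_sides_of)
    then have "lifted q (poly_eval \<iota> p) (\<Sum>m\<in>keys p. summand m)"
      unfolding poly_eval_eq_peval peval_def by (intro lifted_sum)
    then show "lifted q 0 (\<Sum>m\<in>keys p. summand m)" using 0 by simp
  qed
  ultimately have "keys p = {}" using degree(1) by (intro sum_distinct_degrees[of _ "summand"]) auto
  then show ?thesis using poly_mapping_sum_singles[of p] by simp
qed

theorem initial_ideal_of_strict:
  assumes "strict \<omega>"
  shows "initial_ideal generators \<omega> relation_ideal = monomial_ideal"
proof -
  interpret hom: coeff_hom \<iota> by (rule coeff_hom)
  have "\<exists>P\<in>polys generators. poly_eval \<iota> P = v * w \<and>
      (\<forall>m\<in>keys P. weight \<omega> m < lookup \<omega> v + lookup \<omega> w \<and> nat_weight height m < height v + height w)"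
    if inc: "incompatible v w" for v w
  proof -
    obtain E where E: "\<And>e. e \<in># E \<Longrightarrow> set_mset e \<subseteq> generators" "v * w = (\<Sum>e\<in>#E. prod_mset e)"
      and wt: "\<And>\<omega> e. strict \<omega> \<Longrightarrow> e \<in># E \<Longrightarrow> (\<Sum>u\<in>#e. lookup \<omega> u) < lookup \<omega> v + lookup \<omega> w"
      using incompatible_expression[OF inc] unfolding lower_expression_def by blast
    define P :: "('f, 'k) mpoly" where "P = (\<Sum>e\<in>#E. single (exponent e) 1)"
    have props: "(\<forall>e\<in>#F. set_mset e \<subseteq> generators) \<longrightarrow>
        (\<Sum>e\<in>#F. single (exponent e) 1 :: ('f, 'k) mpoly) \<in> polys generators"
      "poly_eval \<iota> (\<Sum>e\<in>#F. single (exponent e) 1) = (\<Sum>e\<in>#F. prod_mset e)"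
      "keys (\<Sum>e\<in>#F. single (exponent e) 1 :: ('f, 'k) mpoly) \<subseteq> exponent ` set_mset F" for F
    proof (induction F)
      case (add e F)
      { case 1
        show ?case
        proof
          assume "\<forall>e\<in>#add_mset e F. set_mset e \<subseteq> generators"
          then show "(\<Sum>e\<in>#add_mset e F. single (exponent e) 1 :: ('f, 'k) mpoly) \<in> polys generators"
            using add.IH(1) subset_trans[OF keys_exponent[of e]] by (auto intro!: polys_add polys_single)
        qed
      next
        case 2 show ?case using add.IH(2)
          by (simp add: poly_eval_eq_peval hom.peval_add hom.one eval_mon_exponent)
      next
        case 3 show ?case
          using add.IH(3) Poly_Mapping.keys_add[of "single (exponent e) (1::'k)" "\<Sum>e\<in>#F. single (exponent e) 1"]
          by auto
      }
    qed (simp_all add: poly_eval_def)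
    have "P \<in> polys generators" "poly_eval \<iota> P = v * w" using props(1,2)[of E] E by (auto simp: P_def)
    moreover have "weight \<omega> m < lookup \<omega> v + lookup \<omega> w \<and> nat_weight height m < height v + height w"
      if m: "m \<in> keys P" for m
    proof -
      from m props(3)[of E] obtain e where e: "e \<in># E" "m = exponent e" unfolding P_def by blast
      have "nat_weight height (exponent f) = (\<Sum>u\<in>#f. height u)" for f
        by (induction f) (simp_all add: nat_weight_add)
      moreover have "(\<Sum>u\<in>#f. lookup \<omega>\<^sub>0 u) = real (\<Sum>u\<in>#f. height u)" if "set_mset f \<subseteq> generators" for f
        using that by (induction f) (simp_all add: lookup_\<omega>\<^sub>0)
      \<comment> \<open>The same expression, read with the strict weight
        \<open>\<omega>\<^sub>0\<close>, bounds the heights and makes the rewriting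
        terminate.\<close>
      then have "real (\<Sum>u\<in>#e. height u) < real (height v + height w)"
        using wt[OF strict_\<omega>\<^sub>0 e(1)] E(1)[OF e(1)] incompatible_generators[OF inc] by (simp add: lookup_\<omega>\<^sub>0)
      then have "(\<Sum>u\<in>#e. height u) < height v + height w" unfolding of_nat_less_iff .
      ultimately show ?thesis using wt[OF assms e(1)] by (simp add: e(2) weight_exponent)
    qed
    ultimately show ?thesis by blast
  qed
  then show ?thesis
    unfolding relation_ideal_def monomial_ideal_eq
    using incompatible_generators compatible_monomials_independent
    by (intro initial_ideal_kernel_eq_pair_ideal[OF coeff_hom]) auto
qed

end

section \<open>The Groebner cone\<close>

lemma lookup_scaleR: "lookup (r *\<^sub>R \<omega>) k = r *\<^sub>R lookup \<omega> k"
proof -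
  have "{i. r *\<^sub>R lookup \<omega> i \<noteq> 0} \<subseteq> keys \<omega>" by (auto simp: in_keys_iff)
  then have "finite {i. r *\<^sub>R lookup \<omega> i \<noteq> 0}" by (rule finite_subset) simp
  then show ?thesis by (simp add: scaleR_poly_mapping_def)
qed

text \<open>The norm is the sum of the absolute values of the coordinates.\<close>

lemma bounded_linear_lookup: "bounded_linear (\<lambda>\<omega> :: 'a \<Rightarrow>\<^sub>0 real. lookup \<omega> k)"
proof (rule bounded_linear_intro[of _ 1])
  fix \<omega> :: "'a \<Rightarrow>\<^sub>0 real"
  have "norm (lookup \<omega> k) \<le> (\<Sum>i\<in>keys \<omega>. norm (lookup \<omega> i))"
  proof (cases "k \<in> keys \<omega>")
    case True
    then show ?thesis by (intro member_le_sum) auto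
  next
    case False
    then show ?thesis by (simp add: in_keys_iff sum_nonneg)
  qed
  then show "norm (lookup \<omega> k) \<le> norm \<omega> * 1"
    by (simp add: norm_poly_mapping_def dist_poly_mapping_def)
qed (simp_all add: lookup_add lookup_scaleR)

lemmas continuous_on_lookup = bounded_linear.continuous_on[OF bounded_linear_lookup]

text \<open>The two cancellations in the alternating sums of \<open>w_jk_vec\<close>: blue slacks
  cancel with a shift by one and leave the last term, red slacks cancel without a shift and leave
  the first.\<close>

lemma sum_interval_telescope:
  fixes f :: "int \<Rightarrow> real"
  assumes "0 \<le> m"
  shows "(\<Sum>i\<in>{0..m}. f i) - (\<Sum>i\<in>{1..m}. f (i - 1)) = f m"
    and "(\<Sum>i\<in>{0..m}. f i) - (\<Sum>i\<in>{1..m}. f i) = f 0"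
proof -
  have "(\<Sum>i\<in>{1..m}. f (i - 1)) = (\<Sum>i\<in>{0..m - 1}. f i)"
    by (rule sum.reindex_bij_witness[of _ "\<lambda>i. i + 1" "\<lambda>i. i - 1"]) auto
  moreover have "{0..m} = insert m {0..m - 1}" using assms by auto
  ultimately show "(\<Sum>i\<in>{0..m}. f i) - (\<Sum>i\<in>{1..m}. f (i - 1)) = f m" by simp
  have "{0..m} = insert 0 {1..m}" using assms by auto
  then show "(\<Sum>i\<in>{0..m}. f i) - (\<Sum>i\<in>{1..m}. f i) = f 0" by simp
qed

lemma sum_periodic_shift:
  fixes f :: "int \<Rightarrow> real"
  assumes "0 < n" "f n = f 0"
  shows "(\<Sum>a\<in>{0..<n}. f (a + 1)) = (\<Sum>a\<in>{0..<n}. f a)"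
proof -
  have "(\<Sum>a\<in>{0..<n}. f (a + 1)) = (\<Sum>a\<in>{1..<n + 1}. f a)"
    by (rule sum.reindex_bij_witness[of _ "\<lambda>i. i - 1" "\<lambda>i. i + 1"]) auto
  moreover have "{1..<n + 1} = insert n {1..<n}" "{0..<n} = insert 0 {1..<n}" using assms(1) by auto
  ultimately show ?thesis using assms(2) by simp
qed

lemma mod_eq_shift_iff:
  fixes a b c d n :: int
  assumes "a - b = c - d" shows "a mod n = b mod n \<longleftrightarrow> c mod n = d mod n"
  unfolding mod_eq_dvd_iff assms ..

context polygon_model
begin

section \<open>Slacks as linear functionals and the facet description of the cone\<close>

definition chord_slack :: "('f \<Rightarrow>\<^sub>0 real) \<Rightarrow> int \<Rightarrow> int \<Rightarrow> real" where
  "chord_slack \<omega> a c = D \<omega> a c + D \<omega> (a + 1) (c + 1) - D \<omega> a (c + 1) - D \<omega> (a + 1) c"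

definition blue_slack :: "('f \<Rightarrow>\<^sub>0 real) \<Rightarrow> int \<Rightarrow> real" where
  "blue_slack \<omega> a = lookup \<omega> (B a) + lookup \<omega> (R (a + 1)) - D \<omega> (a + 1) (a + int n)"

definition red_slack :: "('f \<Rightarrow>\<^sub>0 real) \<Rightarrow> int \<Rightarrow> real" where
  "red_slack \<omega> a = lookup \<omega> (R a) + lookup \<omega> (B (a + 1)) - D \<omega> (a + 1) (a + int n)"

fun slack :: "side \<Rightarrow> ('f \<Rightarrow>\<^sub>0 real) \<Rightarrow> real" where
  "slack (Chord a c) \<omega> = chord_slack \<omega> a c"
| "slack (BlueDiam a) \<omega> = blue_slack \<omega> a"
| "slack (RedDiam a) \<omega> = red_slack \<omega> a"

lemma D_add: "D (\<omega> + \<omega>') a c = D \<omega> a c + D \<omega>' a c"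
  and D_scale: "D (t *\<^sub>R \<omega>) a c = t * D \<omega> a c"
  by (simp_all add: D_def lookup_add lookup_scaleR distrib_left)

lemma slack_add: "slack s (\<omega> + \<omega>') = slack s \<omega> + slack s \<omega>'"
  and slack_scale: "slack s (t *\<^sub>R \<omega>) = t * slack s \<omega>"
  by (cases s; simp add: chord_slack_def blue_slack_def red_slack_def D_add D_scale lookup_add lookup_scaleR algebra_simps)+

lemma slack_0: "slack s 0 = 0"
  using slack_scale[of s 0 0] by simp

lemma slack_minus: "slack s (\<omega> - \<omega>') = slack s \<omega> - slack s \<omega>'"
  using slack_add[of s "\<omega> - \<omega>'" \<omega>'] by simp

lemma slack_sum: "slack s (sum f A) = (\<Sum>a\<in>A. slack s (f a))"
  by (induction A rule: infinite_finite_induct) (simp_all add: slack_0 slack_add)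

lemma continuous_on_slack: "continuous_on UNIV (slack s)"
proof -
  have D: "continuous_on UNIV (\<lambda>\<omega>. D \<omega> a c)" for a c
    by (cases "c = a + int n") (auto simp: D_def intro!: continuous_intros continuous_on_lookup)
  have "slack s = (\<lambda>\<omega>. slack s \<omega>)" by simp
  then show ?thesis
    by (cases s) (auto simp: chord_slack_def blue_slack_def red_slack_def
        intro!: continuous_intros continuous_on_lookup D)
qed

lemma D_shift: "D \<omega> (a + int n) (c + int n) = D \<omega> a c"
  by (simp add: D_def B_shift R_shift X_shift)

lemma slack_mod:
  "chord_slack \<omega> (a mod int n) (c + (a mod int n - a)) = chord_slack \<omega> a c"
  "blue_slack \<omega> (a mod int n) = blue_slack \<omega> a"
  "red_slack \<omega> (a mod int n) = red_slack \<omega> a"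
proof -
  have "chord_slack \<omega> (a + int n) (c + int n) = chord_slack \<omega> a c" for a c
    using D_shift[of \<omega> a c] D_shift[of \<omega> "a + 1" "c + 1"] D_shift[of \<omega> a "c + 1"] D_shift[of \<omega> "a + 1" c]
    by (simp add: chord_slack_def algebra_simps)
  then have "chord_slack \<omega> (a + int n * k) (c + int n * k) = chord_slack \<omega> a c" for k
    by (rule shift_multiple2)
  moreover have "c + (a mod int n - a) = c + int n * (- (a div int n))" unfolding mod_mult by simp
  ultimately show "chord_slack \<omega> (a mod int n) (c + (a mod int n - a)) = chord_slack \<omega> a c"
    unfolding mod_mult by (simp only:)
  have br: "blue_slack \<omega> (a + int n) = blue_slack \<omega> a" "red_slack \<omega> (a + int n) = red_slack \<omega> a" for a
    using D_shift[of \<omega> "a + 1" "a + int n"] B_shift[of a] B_shift[of "a + 1"] R_shift[of a] R_shift[of "a + 1"]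
    by (simp_all add: blue_slack_def red_slack_def algebra_simps)
  have "blue_slack \<omega> (a + int n * k) = blue_slack \<omega> a" "red_slack \<omega> (a + int n * k) = red_slack \<omega> a" for k
    by (rule shift_multiple, rule br(1)) (rule shift_multiple, rule br(2))
  then show "blue_slack \<omega> (a mod int n) = blue_slack \<omega> a" "red_slack \<omega> (a mod int n) = red_slack \<omega> a"
    unfolding mod_mult by blast+
qed

text \<open>The facet \<open>Chord a c\<close> belongs to the vector of the chord
  \<open>[a + 1, c]\<close>, whose length \<open>c - a - 1\<close> ranges from \<open>1\<close> to
  \<open>n - 2\<close>.\<close>

definition facet_chords :: "side set" where
  "facet_chords = {Chord a c | a c. 0 \<le> a \<and> a < int n \<and> a + 2 \<le> c \<and> c < a + int n}"

definition facets :: "side set" where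
  "facets = facet_chords \<union> BlueDiam ` {0..<int n} \<union> RedDiam ` {0..<int n}"

definition coordinate_space :: "('f \<Rightarrow>\<^sub>0 real) set" where
  "coordinate_space = {\<omega>. keys \<omega> \<subseteq> generators}"

lemma facets_cases:
  assumes "\<And>s. s \<in> facets \<Longrightarrow> Q (slack s \<omega>)"
  shows "a + 2 \<le> c \<Longrightarrow> c < a + int n \<Longrightarrow> Q (chord_slack \<omega> a c)"
    and "Q (blue_slack \<omega> a)" and "Q (red_slack \<omega> a)"
proof -
  have a: "0 \<le> a mod int n" "a mod int n < int n" using int_n_pos by simp_all
  show "Q (chord_slack \<omega> a c)" if "a + 2 \<le> c" "c < a + int n"
  proof -
    have "Chord (a mod int n) (c + (a mod int n - a)) \<in> facets"
      using a that by (auto simp: facets_def facet_chords_def)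
    from assms[OF this] show ?thesis by (simp add: slack_mod)
  qed
  have "BlueDiam (a mod int n) \<in> facets" "RedDiam (a mod int n) \<in> facets" using a by (auto simp: facets_def)
  from assms[OF this(1)] assms[OF this(2)] show "Q (blue_slack \<omega> a)" "Q (red_slack \<omega> a)"
    by (simp_all add: slack_mod)
qed

lemma strict_iff_slack: "strict \<omega> \<longleftrightarrow> (\<forall>s\<in>facets. 0 < slack s \<omega>)"
proof
  assume strict: "strict \<omega>"
  show "\<forall>s\<in>facets. 0 < slack s \<omega>"
  proof
    fix s assume s: "s \<in> facets"
    show "0 < slack s \<omega>"
    proof (cases s)
      case (Chord a c)
      then have "a + 2 \<le> c" "c < a + int n" using s by (auto simp: facets_def facet_chords_def)
      then have "D \<omega> a (c + 1) + D \<omega> (a + 1) c < D \<omega> a c + D \<omega> (a + 1) (c + 1)"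
        using strict unfolding strict_iff by blast
      then show ?thesis using Chord by (simp add: chord_slack_def)
    qed (use strict[unfolded strict_iff] in \<open>simp_all add: blue_slack_def red_slack_def\<close>)
  qed
next
  assume pos: "\<forall>s\<in>facets. 0 < slack s \<omega>"
  show "strict \<omega>"
    unfolding strict_iff
  proof (intro conjI allI impI)
    fix a c assume "a + 2 \<le> c" "c < a + int n"
    then have "0 < chord_slack \<omega> a c" using pos by (intro facets_cases(1)[of "\<lambda>x. 0 < x"]) auto
    then show "D \<omega> a (c + 1) + D \<omega> (a + 1) c < D \<omega> a c + D \<omega> (a + 1) (c + 1)" by (simp add: chord_slack_def)
  next
    fix a
    have "0 < blue_slack \<omega> a" using pos by (intro facets_cases(2)[of "\<lambda>x. 0 < x"]) auto
    then show "D \<omega> (a + 1) (a + int n) < lookup \<omega> (B a) + lookup \<omega> (R (a + 1))" by (simp add: blue_slack_def)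
  next
    fix a
    have "0 < red_slack \<omega> a" using pos by (intro facets_cases(3)[of "\<lambda>x. 0 < x"]) auto
    then show "D \<omega> (a + 1) (a + int n) < lookup \<omega> (R a) + lookup \<omega> (B (a + 1))" by (simp add: red_slack_def)
  qed
qed

lemma groebner_slack_nonneg:
  assumes \<omega>: "initial_ideal generators \<omega> relation_ideal = monomial_ideal" and s: "s \<in> facets"
  shows "0 \<le> slack s \<omega>"
proof -
  have n1: "1 < int n" using n3 by simp
  have le: "(\<Sum>l\<in>#P. lookup \<omega> (x l)) \<le> (\<Sum>l\<in>#L. lookup \<omega> (x l))"
    "(\<Sum>l\<in>#Q. lookup \<omega> (x l)) \<le> (\<Sum>l\<in>#L. lookup \<omega> (x l))"
    if rel: "(L, {# P, Q #}) \<in> polygon_relations n" for L P Q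
  proof -
    have e: "(image_mset x L, {# image_mset x P, image_mset x Q #}) \<in> exchange_relations"
      by (rule polygon_relation_exchange[OF rel])
    then have e': "(image_mset x L, {# image_mset x Q, image_mset x P #}) \<in> exchange_relations"
      by (simp add: add_mset_commute)
    show "(\<Sum>l\<in>#P. lookup \<omega> (x l)) \<le> (\<Sum>l\<in>#L. lookup \<omega> (x l))"
      "(\<Sum>l\<in>#Q. lookup \<omega> (x l)) \<le> (\<Sum>l\<in>#L. lookup \<omega> (x l))"
      using exchange_relation_weight_le[OF \<omega> e] exchange_relation_weight_le[OF \<omega> e']
      by (simp_all add: image_mset.compositionality o_def)
  qed
  have Xa: "x (lab n a (c + int n)) = X c (a + int n)" for a c using X_antipodal[of a c] by (simp add: X_def)
  note defs = B_def[symmetric] R_def[symmetric] X_def[symmetric]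
  show ?thesis
  proof (cases s)
    case (Chord a c)
    then have ac: "a + 2 \<le> c" "c < a + int n" using s by (auto simp: facets_def facet_chords_def)
    show ?thesis
    \<comment> \<open>If \<open>[a, c + 1]\<close> is a diameter, the relation is the one with both
      colors in a monomial, otherwise the one between four chords and two edges or diagonals of
      consecutive ends.\<close>
    proof (cases "c + 1 = a + int n")
      case False
      then have rel: "({# lab n a c, lab n (a + 1) (c + 1) #},
         {# {# lab n a (a + 1), lab n c (c + 1) #}, {# lab n a (c + 1), lab n (a + 1) c #} #}) \<in> polygon_relations n"
        unfolding polygon_relations_def using ac
        by (intro UnI1 CollectI exI[of _ a] exI[of _ "a + 1"] exI[of _ c] exI[of _ "c + 1"]) auto
      show ?thesis using le(2)[OF rel] False ac Chord
        by (simp add: chord_slack_def D_def defs)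
    next
      case True
      have rel: "({# lab n a c, lab n a (a + 1 + int n) #},
       {# {# lab n a (a + 1), lab n a (c + int n) #}, {# blue n a, red n a, lab n (a + 1) c #} #}) \<in> polygon_relations n"
        unfolding polygon_relations_def using ac
        by (intro UnI1[of _ _ "_ :: (label multiset \<times> label multiset multiset) set"] UnI2 CollectI exI[of _ a] exI[of _ "a + 1"] exI[of _ c]) auto
      show ?thesis using le(2)[OF rel] True ac Chord Xa[of a "a + 1"]
        by (simp add: chord_slack_def D_def defs)
    qed
  next
    case (BlueDiam a)
    have rel: "({# blue n a, red n (a + 1) #}, {# {# lab n a (a + 1) #}, {# lab n a (a + 1 + int n) #} #}) \<in> polygon_relations n"
    proof -
      have "a < a + 1" "a + 1 < a + int n" using n1 by simp_all
      then show ?thesis unfolding polygon_relations_def by blast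
    qed
    show ?thesis using le(2)[OF rel] BlueDiam Xa[of a "a + 1"] n1 by (simp add: blue_slack_def D_def defs)
  next
    case (RedDiam a)
    \<comment> \<open>The mixed relation has its blue end first, so the red diameter at
      \<open>a\<close> enters through its other end \<open>a + n\<close>.\<close>
    have "a + 1 < a + int n" "a + int n < a + 1 + int n" using n1 by simp_all
    then have rel: "({# blue n (a + 1), red n (a + int n) #},
        {# {# lab n (a + 1) (a + int n) #}, {# lab n (a + 1) (a + int n + int n) #} #}) \<in> polygon_relations n"
      unfolding polygon_relations_def by blast
    have "D \<omega> (a + 1) (a + int n) = lookup \<omega> (X (a + 1) (a + int n))" by (simp add: D_def)
    moreover have "lookup \<omega> (X (a + 1) (a + int n)) \<le> lookup \<omega> (B (a + 1)) + lookup \<omega> (R a)"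
      using le(1)[OF rel[unfolded red_shift]] by (simp add: defs)
    ultimately show ?thesis using RedDiam by (simp add: red_slack_def)
  qed
qed

lemma subspace_coordinate_space: "subspace coordinate_space"
proof -
  have "keys (\<omega> + \<omega>') \<subseteq> generators" if "keys \<omega> \<subseteq> generators" "keys \<omega>' \<subseteq> generators" for \<omega> \<omega>' :: "'f \<Rightarrow>\<^sub>0 real"
    using Poly_Mapping.keys_add Un_least[OF that] by (rule subset_trans)
  moreover have "keys (t *\<^sub>R \<omega>) \<subseteq> generators" if "keys \<omega> \<subseteq> generators" for t and \<omega> :: "'f \<Rightarrow>\<^sub>0 real"
  proof -
    have "keys (t *\<^sub>R \<omega>) \<subseteq> keys \<omega>" by (auto simp: in_keys_iff lookup_scaleR)
    then show ?thesis using that by (rule subset_trans)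
  qed
  ultimately show ?thesis unfolding subspace_def coordinate_space_def by simp
qed

lemma groebner_cone_eq: "groebner_cone = {\<omega> \<in> coordinate_space. \<forall>s\<in>facets. 0 \<le> slack s \<omega>}"
proof -
  let ?K = "{\<omega> \<in> coordinate_space. \<forall>s\<in>facets. 0 \<le> slack s \<omega>}"
  let ?G = "{\<omega>. keys \<omega> \<subseteq> generators \<and> initial_ideal generators \<omega> relation_ideal = monomial_ideal}"
  have "?K = (\<Inter>v\<in>- generators. {\<omega>. lookup \<omega> v = 0}) \<inter> (\<Inter>s\<in>facets. {\<omega>. 0 \<le> slack s \<omega>})"
    by (auto simp: coordinate_space_def in_keys_iff)
  moreover have "closed {\<omega> :: 'f \<Rightarrow>\<^sub>0 real. lookup \<omega> v = 0}" for v
    using closed_Collect_eq[OF continuous_on_lookup[OF continuous_on_id] continuous_on_const, of v 0] by simp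
  moreover have "closed {\<omega>. 0 \<le> slack s \<omega>}" for s
    by (intro closed_Collect_le continuous_on_const continuous_on_slack)
  ultimately have "closed ?K" by (auto intro!: closed_Int closed_INT)
  moreover have "?G \<subseteq> ?K" using groebner_slack_nonneg by (auto simp: coordinate_space_def)
  ultimately have "closure ?G \<subseteq> ?K" by (intro closure_minimal)
  moreover have "\<omega> \<in> closure ?G" if \<omega>: "\<omega> \<in> ?K" for \<omega>
    unfolding closure_sequential
  proof (intro exI conjI allI)
    \<comment> \<open>Adding small multiples of the interior weight \<open>\<omega>\<^sub>0\<close>
      makes all slacks positive, so \<open>\<omega>\<close> is a limit of weights with the required
      initial ideal.\<close>
    let ?f = "\<lambda>k. \<omega> + inverse (real (Suc k)) *\<^sub>R \<omega>\<^sub>0"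
    have "(\<lambda>k. inverse (real (Suc k)) *\<^sub>R \<omega>\<^sub>0) \<longlonglongrightarrow> 0 *\<^sub>R \<omega>\<^sub>0"
      by (intro tendsto_scaleR LIMSEQ_inverse_real_of_nat tendsto_const)
    then show "?f \<longlonglongrightarrow> \<omega>" using tendsto_add[OF tendsto_const[of \<omega>]] by force
    fix k
    have "0 < inverse (real (Suc k))" by simp
    have "\<omega>\<^sub>0 \<in> coordinate_space" using keys_\<omega>\<^sub>0 by (simp add: coordinate_space_def)
    then have "?f k \<in> coordinate_space"
      using \<omega> subspace_coordinate_space by (intro subspace_add subspace_scale) auto
    moreover have "0 < slack s (?f k)" if "s \<in> facets" for s
    proof -
      have "0 < slack s \<omega>\<^sub>0" using strict_\<omega>\<^sub>0 that by (simp add: strict_iff_slack)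
      then have "0 < inverse (real (Suc k)) * slack s \<omega>\<^sub>0" by simp
      then show ?thesis unfolding slack_add slack_scale using \<omega> that by (auto intro: add_nonneg_pos)
    qed
    then have "strict (?f k)" by (simp add: strict_iff_slack)
    ultimately show "?f k \<in> ?G" using initial_ideal_of_strict by (simp add: coordinate_space_def)
  qed
  ultimately show ?thesis unfolding groebner_cone_def by blast
qed

section \<open>Slacks of the vectors\<close>

lemma D_v_vec:
  assumes pq: "p < q" "q < p + int n" and a: "p - 1 \<le> a" "a \<le> p + int n - 1" and ac: "a < c" "c \<le> a + int n"
  shows "D (v_vec n x p q) a c = (if p \<le> a \<and> c \<le> q then - 1 else 0)"
proof (cases "c = a + int n")
  case True
  then show ?thesis using assms lookup_v_vec_diameter[OF pq, of a] by (auto simp: D_def B_def R_def)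
next
  case False
  then show ?thesis using assms lookup_v_vec_lab[OF pq a] by (simp add: D_def X_def)
qed

text \<open>Over one period \<open>D\<close> of this vector is minus the indicator of
  \<open>p \<le> a \<and> c \<le> q\<close>, whose mixed difference is concentrated at the corner
  \<open>(p - 1, q)\<close>. For \<open>q = p + n - 1\<close> this corner is a diameter, outside the
  range of chord slacks, and it shows up in a blue and a red slack instead.\<close>

lemma slack_v_vec:
  assumes pq: "p < q" "q < p + int n"
  shows "a + 2 \<le> c \<Longrightarrow> c < a + int n \<Longrightarrow>
      chord_slack (v_vec n x p q) a c = of_bool (a mod int n = (p - 1) mod int n \<and> c - a = q - p + 1)"
    and "blue_slack (v_vec n x p q) a = of_bool (a mod int n = (p - 1) mod int n \<and> q = p + int n - 1)"
    and "red_slack (v_vec n x p q) a = of_bool (a mod int n = (p - 1) mod int n \<and> q = p + int n - 1)"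
proof -
  let ?v = "v_vec n x p q"
  \<comment> \<open>\<open>b\<close> is the lift of \<open>a\<close> in
    \<open>{p - 1..p + n - 2}\<close>, chosen so that \<open>D_v_vec\<close> applies at
    \<open>b\<close> and at \<open>b + 1\<close>.\<close>
  define r where "r = (a - (p - 1)) mod int n"
  define b where "b = p - 1 + r"
  have r: "0 \<le> r" "r < int n" using int_n_pos by (simp_all add: r_def)
  have bm: "b mod int n = a mod int n" by (simp add: b_def r_def mod_add_right_eq)
  have b0: "b = p - 1 \<longleftrightarrow> a mod int n = (p - 1) mod int n"
    unfolding b_def r_def by (simp add: mod_eq_dvd_iff dvd_eq_mod_eq_0)
  have b: "p - 1 \<le> b" "b \<le> p + int n - 2" using r by (simp_all add: b_def)
  have chord: "chord_slack ?v b d = of_bool (b = p - 1 \<and> d = q)" if "b + 2 \<le> d" "d < b + int n" for d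
    using b that pq by (auto simp: chord_slack_def D_v_vec)
  have same: "chord_slack ?v a c = chord_slack ?v b (c + (b - a))"
  proof -
    have "c + (a mod int n - a) = c + (b - a) + (b mod int n - b)" using bm by simp
    then show ?thesis using slack_mod(1)[of ?v a c] slack_mod(1)[of ?v b "c + (b - a)"] bm by simp
  qed
  show "chord_slack ?v a c = of_bool (a mod int n = (p - 1) mod int n \<and> c - a = q - p + 1)"
    if "a + 2 \<le> c" "c < a + int n"
    using chord[of "c + (b - a)"] that same b0 by (auto simp: b_def)
  have far: "D ?v (b + 1) (b + int n) = - of_bool (b = p - 1 \<and> q = p + int n - 1)"
    using b pq n3 by (subst D_v_vec[OF pq]) auto
  have zero: "lookup ?v (B d) = 0" "lookup ?v (R d) = 0" for d
    using lookup_v_vec_diameter[OF pq, of d] by (simp_all add: B_def R_def)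
  have "blue_slack ?v a = blue_slack ?v b" "red_slack ?v a = red_slack ?v b"
    using slack_mod(2,3)[of ?v a] slack_mod(2,3)[of ?v b] bm by simp_all
  then show "blue_slack ?v a = of_bool (a mod int n = (p - 1) mod int n \<and> q = p + int n - 1)"
    "red_slack ?v a = of_bool (a mod int n = (p - 1) mod int n \<and> q = p + int n - 1)"
    using far b0 by (simp_all add: blue_slack_def red_slack_def zero)
qed

lemma lookup_unit_diameter:
  "lookup (unit_vec x (blue n i)) (B a) = of_bool (a mod int n = i mod int n)"
  "lookup (unit_vec x (blue n i)) (R a) = 0"
  "lookup (unit_vec x (red n i)) (R a) = of_bool (a mod int n = i mod int n)"
  "lookup (unit_vec x (red n i)) (B a) = 0"
  "a < c \<Longrightarrow> c < a + int n \<Longrightarrow> lookup (unit_vec x (blue n i)) (X a c) = 0"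
  "a < c \<Longrightarrow> c < a + int n \<Longrightarrow> lookup (unit_vec x (red n i)) (X a c) = 0"
proof -
  have neq: "R j \<noteq> B k" "B j \<noteq> R k" for j k
    using side_of_B[of j] side_of_R[of k] side_of_B[of k] side_of_R[of j] by auto
  have B: "B a = B i \<longleftrightarrow> a mod int n = i mod int n"
    using side_of_B[of a] side_of_B[of i] B_mod[of a] B_mod[of i] by (metis side.inject(2))
  have R: "R a = R i \<longleftrightarrow> a mod int n = i mod int n"
    using side_of_R[of a] side_of_R[of i] R_mod[of a] R_mod[of i] by (metis side.inject(3))
  have u: "unit_vec x (blue n i) = single (B i) 1" "unit_vec x (red n i) = single (R i) 1"
    by (simp_all add: unit_vec_def B_def R_def)
  show "lookup (unit_vec x (blue n i)) (B a) = of_bool (a mod int n = i mod int n)"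
    "lookup (unit_vec x (red n i)) (R a) = of_bool (a mod int n = i mod int n)"
    using B R unfolding u lookup_single when_def by (auto simp: eq_commute)
  show "lookup (unit_vec x (blue n i)) (R a) = 0" "lookup (unit_vec x (red n i)) (B a) = 0"
    unfolding u lookup_single using neq by (auto simp: when_def)
  assume ac: "a < c" "c < a + int n"
  have "X a c \<noteq> B i" "X a c \<noteq> R i"
    using side_of_X[OF ac] side_of_B[of i] side_of_R[of i] by auto
  then show "lookup (unit_vec x (blue n i)) (X a c) = 0" "lookup (unit_vec x (red n i)) (X a c) = 0"
    unfolding u lookup_single by (auto simp: when_def)
qed

lemma D_unit_diameter:
  assumes "a < c" "c \<le> a + int n"
  shows "D (unit_vec x (blue n i)) a c = of_bool (c = a + int n \<and> a mod int n = i mod int n)"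
    "D (unit_vec x (red n i)) a c = of_bool (c = a + int n \<and> a mod int n = i mod int n)"
  using assms by (cases "c = a + int n"; simp add: D_def lookup_unit_diameter)+

text \<open>The unit vector of a diameter raises one blue and one red slack but lowers the chord
  slack at \<open>(i, i + n - 1)\<close> by \<open>1\<close>; the summand \<open>v_vec\<close>
  raises exactly that slack.\<close>

lemma slack_w_vec:
  shows "a + 2 \<le> c \<Longrightarrow> c < a + int n \<Longrightarrow> chord_slack (w_vec n x i) a c = 0"
    and "a + 2 \<le> c \<Longrightarrow> c < a + int n \<Longrightarrow> chord_slack (w_hat_vec n x i) a c = 0"
    and "blue_slack (w_vec n x i) a = of_bool (a mod int n = i mod int n)"
    and "red_slack (w_vec n x i) a = of_bool ((a + 1) mod int n = i mod int n)"
    and "blue_slack (w_hat_vec n x i) a = of_bool ((a + 1) mod int n = i mod int n)"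
    and "red_slack (w_hat_vec n x i) a = of_bool (a mod int n = i mod int n)"
proof -
  have pq: "i + 1 < i + int n - 1" "i + int n - 1 < i + 1 + int n" using n3 by simp_all
  have n1: "a + 1 < a + int n" using n3 by simp
  note add = slack_add[of "Chord a c", simplified] slack_add[of "BlueDiam a", simplified] slack_add[of "RedDiam a", simplified]
  note v = slack_v_vec[OF pq]
  show "chord_slack (w_vec n x i) a c = 0" "chord_slack (w_hat_vec n x i) a c = 0"
    if "a + 2 \<le> c" "c < a + int n"
    unfolding w_vec_def w_hat_vec_def add v(1)[OF that] using that
    by (auto simp: chord_slack_def D_unit_diameter)
  show "blue_slack (w_vec n x i) a = of_bool (a mod int n = i mod int n)"
    "red_slack (w_vec n x i) a = of_bool ((a + 1) mod int n = i mod int n)"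
    "blue_slack (w_hat_vec n x i) a = of_bool ((a + 1) mod int n = i mod int n)"
    "red_slack (w_hat_vec n x i) a = of_bool (a mod int n = i mod int n)"
    unfolding w_vec_def w_hat_vec_def add v(2,3) using n1
    by (simp_all add: blue_slack_def red_slack_def D_unit_diameter lookup_unit_diameter)
qed

text \<open>The minor arc of this chord runs from \<open>j + n + k + 1\<close> to
  \<open>j + k + 2 n\<close>. Its length is \<open>n - 1\<close>, the exceptional case of
  \<open>slack_v_vec\<close>.\<close>

lemma v_vec_far: "v_vec n x (j + k) (j + int n + k + 1) = v_vec n x (j + k + int n + 1) (j + k + 2 * int n)"
proof -
  have n: "1 < int n" using n3 by simp
  have v1: "vertex n (int n + 1) = int n + 1" using n by (intro vertex_eq_self) auto
  have "vertex n (- int n - 1) = vertex n (- int n - 1 + 2 * int n)"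
    by (rule vertex_shift[symmetric])
  also have "\<dots> = int n - 1" using n by (subst vertex_eq_self) auto
  finally have v2: "vertex n (- int n - 1) = int n - 1" .
  have "j + int n + k + 1 - (j + k) = int n + 1" "j + k - (j + int n + k + 1) = - int n - 1" by simp_all
  then have "minor_arc n (j + k) (j + int n + k + 1) = arc n (j + int n + k + 1) (j + k)"
    unfolding minor_arc_def by (simp only: v1 v2) simp
  also have "\<dots> = {vertex n (j + int n + k + 1 + t) | t. 0 \<le> t \<and> t \<le> int n - 1}"
    unfolding arc_def \<open>j + k - (j + int n + k + 1) = - int n - 1\<close> v2 ..
  also have "\<dots> = vertex n ` {j + k + int n + 1..j + k + 2 * int n}"
  proof (intro set_eqI iffI)
    fix y assume "y \<in> vertex n ` {j + k + int n + 1..j + k + 2 * int n}"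
    then obtain i where i: "y = vertex n i" "j + k + int n + 1 \<le> i" "i \<le> j + k + 2 * int n" by auto
    have "y = vertex n (j + int n + k + 1 + (i - (j + int n + k + 1)))" using i by simp
    then show "y \<in> {vertex n (j + int n + k + 1 + t) | t. 0 \<le> t \<and> t \<le> int n - 1}" using i by fastforce
  qed auto
  also have "\<dots> = minor_arc n (j + k + int n + 1) (j + k + 2 * int n)"
    using n by (intro minor_arc_eq[symmetric]) auto
  finally show ?thesis by (simp add: v_vec_def)
qed

text \<open>\<open>w_vec\<close> at \<open>j + 2 i\<close> has blue slack at \<open>j + 2 i\<close>
  and red slack at \<open>j + 2 i - 1\<close>; \<open>w_hat_vec\<close> at
  \<open>j + 2 i - 1\<close> has red slack at \<open>j + 2 i - 1\<close> and blue slack at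
  \<open>j + 2 i - 2\<close>. The alternating sums telescope.\<close>

lemma slack_w_jk_vec:
  assumes k: "0 \<le> k"
  shows "a + 2 \<le> c \<Longrightarrow> c < a + int n \<Longrightarrow> chord_slack (w_jk_vec n x j k) a c = 0"
    and "blue_slack (w_jk_vec n x j k) a = of_bool (a mod int n = (j + k) mod int n)"
    and "red_slack (w_jk_vec n x j k) a = of_bool ((a + 1) mod int n = j mod int n)"
proof -
  have n1: "1 < int n" using n3 by simp
  let ?f = "\<lambda>i. of_bool (a mod int n = (j + 2 * i) mod int n) :: real"
  let ?g = "\<lambda>i. of_bool ((a + 1) mod int n = (j + 2 * i) mod int n) :: real"
  have f: "of_bool ((a + 1) mod int n = (j + 2 * i - 1) mod int n) = ?f (i - 1)" for i
    using mod_eq_shift_iff[of "a + 1" "j + 2 * i - 1" a "j + 2 * (i - 1)" "int n"] by simp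
  have g: "of_bool (a mod int n = (j + 2 * i - 1) mod int n) = ?g i" for i
    using mod_eq_shift_iff[of a "j + 2 * i - 1" "a + 1" "j + 2 * i" "int n"] by simp
  note lin = slack_add slack_minus slack_sum
  have lin': "slack s (w_jk_vec n x j k) =
     (if even k then (\<Sum>i = 0..k div 2. slack s (w_vec n x (j + 2 * i))) - (\<Sum>i = 1..k div 2. slack s (w_hat_vec n x (j + 2 * i - 1)))
      else slack s (v_vec n x (j + k + int n + 1) (j + k + 2 * int n))
        + (\<Sum>i = 0..(k - 1) div 2. slack s (w_vec n x (j + 2 * i)))
        - (\<Sum>i = 1..(k + 1) div 2. slack s (w_hat_vec n x (j + 2 * i - 1))))" for s
    unfolding w_jk_vec_def v_vec_far by (simp only: lin if_distrib[of "slack s"])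
  have pq: "j + k + int n + 1 < j + k + 2 * int n" "j + k + 2 * int n < j + k + int n + 1 + int n"
    using n1 by simp_all
  have vm: "(j + k + int n + 1 - 1) mod int n = (j + k) mod int n"
    using mod_add_self2[of "j + k" "int n"] by simp
  have ve: "j + k + 2 * int n = j + k + int n + 1 + int n - 1" by simp
  note v = slack_v_vec[OF pq]
  show "chord_slack (w_jk_vec n x j k) a c = 0" if ac: "a + 2 \<le> c" "c < a + int n"
    using lin'[of "Chord a c"] ac by (simp add: v(1)[OF ac] slack_w_vec(1,2)[OF ac] split: if_splits)
  have "blue_slack (w_jk_vec n x j k) a = of_bool (a mod int n = (j + k) mod int n) \<and>
      red_slack (w_jk_vec n x j k) a = of_bool ((a + 1) mod int n = j mod int n)"
  proof (cases "even k")
    case True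
    then obtain m where m: "k = 2 * m" by auto
    have m0: "0 \<le> m" using k m by simp
    have d: "k div 2 = m" using m by simp
    have "blue_slack (w_jk_vec n x j k) a = (\<Sum>i\<in>{0..m}. ?f i) - (\<Sum>i\<in>{1..m}. ?f (i - 1))"
      using lin'[of "BlueDiam a"] True d by (simp only: slack.simps slack_w_vec f if_True)
    moreover have "red_slack (w_jk_vec n x j k) a = (\<Sum>i\<in>{0..m}. ?g i) - (\<Sum>i\<in>{1..m}. ?g i)"
      using lin'[of "RedDiam a"] True d by (simp only: slack.simps slack_w_vec g if_True)
    ultimately show ?thesis using sum_interval_telescope[OF m0, of ?f] sum_interval_telescope[OF m0, of ?g] m
      by simp
  next
    case False
    then obtain m where m: "k = 2 * m + 1" by (auto elim: oddE)
    have m0: "0 \<le> m" using k m by presburger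
    have d: "(k - 1) div 2 = m" "(k + 1) div 2 = m + 1" using m by simp_all
    \<comment> \<open>For odd \<open>k\<close> the sums cancel all blue slacks and leave red
      \<open>1\<close> at \<open>j - 1\<close> and red \<open>- 1\<close> at \<open>j + k\<close>;
      the summand \<open>v_vec\<close> adds \<open>1\<close> to both slacks at
      \<open>j + k\<close>.\<close>
    let ?v = "of_bool (a mod int n = (j + k) mod int n) :: real"
    have "blue_slack (w_jk_vec n x j k) a = ?v + (\<Sum>i\<in>{0..m}. ?f i) - (\<Sum>i\<in>{1..m + 1}. ?f (i - 1))"
      using lin'[of "BlueDiam a"] False d v(2)[of a] vm ve by (simp only: slack.simps slack_w_vec f if_False) simp
    moreover have "red_slack (w_jk_vec n x j k) a = ?v + (\<Sum>i\<in>{0..m}. ?g i) - (\<Sum>i\<in>{1..m + 1}. ?g i)"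
      using lin'[of "RedDiam a"] False d v(3)[of a] vm ve by (simp only: slack.simps slack_w_vec g if_False) simp
    moreover have "(\<Sum>i\<in>{0..m + 1}. h i) = (\<Sum>i\<in>{0..m}. h i) + h (m + 1)" for h :: "int \<Rightarrow> real"
    proof -
      have "{0..m + 1} = insert (m + 1) {0..m}" using m0 by auto
      then show ?thesis by simp
    qed
    moreover have "?g (m + 1) = ?v"
      using mod_eq_shift_iff[of "a + 1" "j + 2 * (m + 1)" a "j + k" "int n"] m by simp
    ultimately show ?thesis
      using sum_interval_telescope[of "m + 1" ?f] sum_interval_telescope[of "m + 1" ?g] m0 by simp
  qed
  then show "blue_slack (w_jk_vec n x j k) a = of_bool (a mod int n = (j + k) mod int n)"
    "red_slack (w_jk_vec n x j k) a = of_bool ((a + 1) mod int n = j mod int n)" by blast+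
qed

lemma coordinate_space_vectors:
  "p < q \<Longrightarrow> q < p + int n \<Longrightarrow> v_vec n x p q \<in> coordinate_space"
  "w_jk_vec n x j k \<in> coordinate_space"
proof -
  have v: "v_vec n x p q \<in> coordinate_space" if "p < q" "q < p + int n" for p q
    using keys_v_vec[OF that] by (simp add: coordinate_space_def generators_eq)
  then show "p < q \<Longrightarrow> q < p + int n \<Longrightarrow> v_vec n x p q \<in> coordinate_space" by blast
  note sub = subspace_coordinate_space
  have w: "w_vec n x i \<in> coordinate_space" "w_hat_vec n x i \<in> coordinate_space" for i
  proof -
    have "unit_vec x (blue n i) \<in> coordinate_space" "unit_vec x (red n i) \<in> coordinate_space"
      using generator_mems(1,2)[of i] by (simp_all add: unit_vec_def coordinate_space_def B_def R_def)
    moreover have "v_vec n x (i + 1) (i + int n - 1) \<in> coordinate_space" using n3 by (intro v) auto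
    ultimately show "w_vec n x i \<in> coordinate_space" "w_hat_vec n x i \<in> coordinate_space"
      unfolding w_vec_def w_hat_vec_def by (auto intro: subspace_add[OF sub])
  qed
  have "v_vec n x (j + k) (j + int n + k + 1) \<in> coordinate_space"
    unfolding v_vec_far using n3 by (intro v) auto
  then show "w_jk_vec n x j k \<in> coordinate_space"
    unfolding w_jk_vec_def using w by (auto intro!: subspace_add[OF sub] subspace_diff[OF sub] subspace_sum[OF sub])
qed

text \<open>The \<open>D\<close> terms of both slacks coincide, and the remaining terms differ by a
  shift, which does not change a sum over a full period.\<close>

lemma slack_balance:
  "(\<Sum>s\<in>BlueDiam ` {0..<int n}. slack s \<omega>) = (\<Sum>s\<in>RedDiam ` {0..<int n}. slack s \<omega>)"
proof -
  have "(\<Sum>a\<in>{0..<int n}. lookup \<omega> (R (a + 1))) = (\<Sum>a\<in>{0..<int n}. lookup \<omega> (R a))"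
    "(\<Sum>a\<in>{0..<int n}. lookup \<omega> (B (a + 1))) = (\<Sum>a\<in>{0..<int n}. lookup \<omega> (B a))"
    using R_shift[of 0] B_shift[of 0] int_n_pos by (auto intro!: sum_periodic_shift)
  then have "(\<Sum>a\<in>{0..<int n}. blue_slack \<omega> a) = (\<Sum>a\<in>{0..<int n}. red_slack \<omega> a)"
    by (simp add: blue_slack_def red_slack_def sum.distrib sum_subtractf)
  then show ?thesis by (simp add: sum.reindex inj_on_def)
qed

definition ray_vectors :: "('f \<Rightarrow>\<^sub>0 real) set" where
  "ray_vectors = {v_vec n x i j | i j. 1 \<le> chord_length n i j \<and> chord_length n i j \<le> int n - 2}
       \<union> {w_jk_vec n x j k | j k. 1 \<le> j \<and> j \<le> int n \<and> 0 \<le> k \<and> k \<le> int n - 1}"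

lemma slack_v_vec_indicator:
  assumes pq: "p < q" "q \<le> p + int n - 2" and s: "s \<in> facets"
  shows "slack s (v_vec n x p q)
    = (if s = Chord ((p - 1) mod int n) ((p - 1) mod int n + (q - p + 1)) then 1 else 0)"
proof -
  have q: "q < p + int n" using pq by simp
  note v = slack_v_vec[OF pq(1) q]
  show ?thesis
  proof (cases s)
    case (Chord a c)
    then have ac: "0 \<le> a" "a < int n" "a + 2 \<le> c" "c < a + int n" using s by (auto simp: facets_def facet_chords_def)
    then have "a mod int n = a" by simp
    then show ?thesis using Chord v(1)[OF ac(3,4)] by auto
  qed (use v(2,3) pq in auto)
qed

lemma slack_w_jk_vec_indicator:
  assumes k: "0 \<le> k" and s: "s \<in> facets"
  shows "slack s (w_jk_vec n x j k)
    = (if s = BlueDiam ((j + k) mod int n) \<or> s = RedDiam ((j - 1) mod int n) then 1 else 0)"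
proof (cases s)
  case (Chord a c)
  then show ?thesis using s slack_w_jk_vec(1)[OF k] by (auto simp: facets_def facet_chords_def)
next
  case (BlueDiam a)
  then have "a mod int n = a" using s by (auto simp: facets_def facet_chords_def)
  then show ?thesis using BlueDiam slack_w_jk_vec(2)[OF k, of j a] by auto
next
  case (RedDiam a)
  then have "a mod int n = a" using s by (auto simp: facets_def facet_chords_def)
  moreover have "(a + 1) mod int n = j mod int n \<longleftrightarrow> a mod int n = (j - 1) mod int n"
    by (rule mod_eq_shift_iff) simp
  ultimately show ?thesis using RedDiam slack_w_jk_vec(3)[OF k, of j a] by auto
qed

theorem rays_groebner_cone:
  "ray_mod (lineality_space groebner_cone) ` ray_vectors = rays_mod_lineality groebner_cone"
proof (rule rays_mod_lineality_balanced[of coordinate_space slack _ facet_chords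
      "BlueDiam ` {0..<int n}" "RedDiam ` {0..<int n}"])
  let ?GI = "BlueDiam ` {0..<int n}" and ?HI = "RedDiam ` {0..<int n}"
  have facets: "facet_chords \<union> ?GI \<union> ?HI = facets" by (simp add: facets_def)
  show "subspace coordinate_space" by (rule subspace_coordinate_space)
  show "groebner_cone = {\<omega> \<in> coordinate_space. \<forall>s\<in>facet_chords \<union> ?GI \<union> ?HI. 0 \<le> slack s \<omega>}"
    unfolding facets by (rule groebner_cone_eq)
  show "facet_chords \<inter> ?GI = {}" "facet_chords \<inter> ?HI = {}" "?GI \<inter> ?HI = {}"
    by (auto simp: facet_chords_def)
  have v: "\<exists>p q. p < q \<and> q \<le> p + int n - 2 \<and> v_vec n x i j = v_vec n x p q"
    if "1 \<le> chord_length n i j" "chord_length n i j \<le> int n - 2" for i j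
    using v_vec_chord_length[OF that, of x] by metis
  show "ray_vectors \<subseteq> coordinate_space"
  proof
    fix u assume "u \<in> ray_vectors"
    then consider p q where "p < q" "q \<le> p + int n - 2" "u = v_vec n x p q" | j k where "u = w_jk_vec n x j k"
      unfolding ray_vectors_def using v by blast
    then show "u \<in> coordinate_space" by cases (auto intro!: coordinate_space_vectors)
  qed
  fix u assume "u \<in> ray_vectors"
  then consider p q where "p < q" "q \<le> p + int n - 2" "u = v_vec n x p q"
    | j k where "0 \<le> k" "u = w_jk_vec n x j k"
    unfolding ray_vectors_def using v by blast
  then show "(\<exists>i\<in>facet_chords. \<forall>j\<in>facet_chords \<union> ?GI \<union> ?HI. slack j u = (if j = i then 1 else 0)) \<or>
      (\<exists>g\<in>?GI. \<exists>h\<in>?HI. \<forall>j\<in>facet_chords \<union> ?GI \<union> ?HI. slack j u = (if j = g \<or> j = h then 1 else 0))"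
    unfolding facets
  proof cases
    case 1
    let ?i = "Chord ((p - 1) mod int n) ((p - 1) mod int n + (q - p + 1))"
    have "?i \<in> facet_chords" using 1 int_n_pos by (auto simp: facet_chords_def)
    moreover have "\<forall>j\<in>facets. slack j u = (if j = ?i then 1 else 0)"
      using slack_v_vec_indicator[OF 1(1,2)] 1(3) by simp
    ultimately show "(\<exists>i\<in>facet_chords. \<forall>j\<in>facets. slack j u = (if j = i then 1 else 0)) \<or>
      (\<exists>g\<in>?GI. \<exists>h\<in>?HI. \<forall>j\<in>facets. slack j u = (if j = g \<or> j = h then 1 else 0))" by blast
  next
    case 2
    let ?g = "BlueDiam ((j + k) mod int n)" and ?h = "RedDiam ((j - 1) mod int n)"
    have "?g \<in> ?GI" "?h \<in> ?HI" using int_n_pos by auto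
    moreover have "\<forall>j\<in>facets. slack j u = (if j = ?g \<or> j = ?h then 1 else 0)"
      using slack_w_jk_vec_indicator[OF 2(1)] 2(2) by simp
    ultimately show "(\<exists>i\<in>facet_chords. \<forall>j\<in>facets. slack j u = (if j = i then 1 else 0)) \<or>
      (\<exists>g\<in>?GI. \<exists>h\<in>?HI. \<forall>j\<in>facets. slack j u = (if j = g \<or> j = h then 1 else 0))" by blast
  qed
next
  fix i assume "i \<in> facet_chords"
  then obtain a c where i: "i = Chord a c" "0 \<le> a" "a < int n" "a + 2 \<le> c" "c < a + int n"
    by (auto simp: facet_chords_def)
  have pq: "a + 1 < c" "c \<le> a + 1 + int n - 2" using i by simp_all
  have "vertex n (c - (a + 1)) = c - (a + 1)" using i by (intro vertex_eq_self) auto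
  moreover have "vertex n (a + 1 - c) = vertex n (a + 1 - c + 2 * int n)" by (rule vertex_shift[symmetric])
  then have "vertex n (a + 1 - c) = a + 1 - c + 2 * int n" using i by (subst (asm) (2) vertex_eq_self) auto
  ultimately have "1 \<le> chord_length n (a + 1) c" "chord_length n (a + 1) c \<le> int n - 2"
    using i by (auto simp: chord_length_def)
  then have "v_vec n x (a + 1) c \<in> ray_vectors" unfolding ray_vectors_def by blast
  moreover have "Chord ((a + 1 - 1) mod int n) ((a + 1 - 1) mod int n + (c - (a + 1) + 1)) = i"
    using i by simp
  then have "\<forall>j\<in>facets. slack j (v_vec n x (a + 1) c) = (if j = i then 1 else 0)"
    using slack_v_vec_indicator[OF pq] by (simp only:) simp
  ultimately show "\<exists>u\<in>ray_vectors. \<forall>j\<in>facet_chords \<union> BlueDiam ` {0..<int n} \<union> RedDiam ` {0..<int n}.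
      slack j u = (if j = i then 1 else 0)"
    unfolding facets_def by (rule bexI[rotated])
next
  fix g h assume "g \<in> BlueDiam ` {0..<int n}" "h \<in> RedDiam ` {0..<int n}"
  then obtain a b where gh: "g = BlueDiam a" "h = RedDiam b" "0 \<le> a" "a < int n" "0 \<le> b" "b < int n" by auto
  \<comment> \<open>Modulo \<open>n\<close> the blue index of \<open>w_jk_vec\<close> is
    \<open>j + k\<close> and the red index \<open>j - 1\<close>; this forces
    \<open>j = b + 1\<close> and makes \<open>k\<close> the residue of \<open>a - j\<close>.\<close>
  define k where "k = (a - (b + 1)) mod int n"
  have k: "0 \<le> k" "k \<le> int n - 1" using int_n_pos pos_mod_bound[of "int n" "a - (b + 1)"] by (simp_all add: k_def)
  have "1 \<le> b + 1" "b + 1 \<le> int n" using gh by simp_all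
  then have "w_jk_vec n x (b + 1) k \<in> ray_vectors" unfolding ray_vectors_def using k by blast
  moreover have "(b + 1 + k) mod int n = a" "(b + 1 - 1) mod int n = b"
    unfolding k_def mod_add_right_eq using gh by simp_all
  then have "\<forall>j\<in>facets. slack j (w_jk_vec n x (b + 1) k) = (if j = g \<or> j = h then 1 else 0)"
    using slack_w_jk_vec_indicator[OF k(1), of _ "b + 1"] gh(1,2) by (simp only:) simp
  ultimately show "\<exists>u\<in>ray_vectors. \<forall>j\<in>facet_chords \<union> BlueDiam ` {0..<int n} \<union> RedDiam ` {0..<int n}.
      slack j u = (if j = g \<or> j = h then 1 else 0)"
    unfolding facets_def by (rule bexI[rotated])
qed (simp_all add: slack_add slack_scale slack_balance)

end

theorem theorem5p2p2:
  fixes \<iota> :: "'k::field_char_0 \<Rightarrow> 'f::field"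
    and I J :: "'i set"
    and s\<^sub>0 :: "('i, 'f) seed"
    and n :: nat
    and x :: "label \<Rightarrow> 'f"
  assumes "n \<ge> 4"
    and "polygon_model_D \<iota> I J s\<^sub>0 n x"
  shows "let C = cluster_algebra.groebner_cone \<iota> I J s\<^sub>0 in
    ray_mod (lineality_space C) `
      ({v_vec n x i j | i j. 1 \<le> chord_length n i j \<and> chord_length n i j \<le> int n - 2}
       \<union> {w_jk_vec n x j k | j k. 1 \<le> j \<and> j \<le> int n \<and> 0 \<le> k \<and> k \<le> int n - 1})
    = rays_mod_lineality C"
proof -
  interpret polygon_model_D \<iota> I J s\<^sub>0 n x by fact
  interpret polygon_model \<iota> I J s\<^sub>0 n x by unfold_locales (use assms(1) in simp)
  show ?thesis unfolding Let_def using rays_groebner_cone unfolding ray_vectors_def .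
qed

end
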